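(* Let $N\ge 1$ be an integer, $\alpha\in(0,1)$, $d>0$, $a\ge 0$, $T>0$, and let $m$ be a natural number with $m>N/2$. Then there exists a unique solution, on the time interval $[0,T]$, of the problem $$\begin{cases}\partial_t^\alpha u-d\Delta u=au, & x\in\mathbb{R}^N,\ t>0,\\ u(x,0)=\delta,\end{cases}$$ where $\delta$ is the Dirac delta in $\mathbb{R}^N$ centered at $x=0$, and where "solution" means distributional solution in the class $L^\infty_\alpha\big([0,T],H^{-m}(\mathbb{R}^N)\big)$.
   Context: $\partial_t^\alpha$ is the Caputo derivative of order $\alpha\in(0,1)$ with initial time $0$: $\partial_t^\alpha u(t)=\frac{1}{\Gamma(1-\alpha)}\int_0^t\frac{\dot u(\tau)}{(t-\tau)^\alpha}\,d\tau$; it enters only through the integral formulation below. $H^m(\mathbb{R}^N)$ is the usual Sobolev space and $H^{-m}(\mathbb{R}^N)$ is its dual, with norm $\|v\|_{H^{-m}(\mathbb{R}^N)}=\sup_{\varphi\in H^m(\mathbb{R}^N)\setminus\{0\}}\frac{|\langle v,\varphi\rangle|}{\|\varphi\|_{H^m(\mathbb{R}^N)}}$. Here $m>N/2$, so that $\delta\in H^{-m}(\mathbb{R}^N)$. We say that $v\in L^\infty_\alpha\big([0,T],H^{-m}(\mathbb{R}^N)\big)$ if $v(t)\in H^{-m}(\mathbb{R}^N)$ for all $t\in[0,T]$ and $\sup_{t\in[0,T]}t^\alpha\|v(t)\|_{H^{-m}(\mathbb{R}^N)}<+\infty$. A (distributional) solution of the problem is a $u\in L^\infty_\alpha\big([0,T],H^{-m}(\mathbb{R}^N)\big)$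 such that, for all $\varphi\in C_0^\infty(\mathbb{R}^N)$ and all $t\in[0,T]$, $$\langle u(t),\varphi\rangle=\varphi(0)+\frac{1}{\Gamma(\alpha)}\int_0^t\frac{d\langle u(\tau),\Delta\varphi\rangle+a\langle u(\tau),\varphi\rangle}{(t-\tau)^{1-\alpha}}\,d\tau$$ (in particular, the integral is required to be well defined). $C^\infty_0$ denotes smooth compactly supported functions. *)

theory Defs
  imports "HOL-Analysis.Analysis"
begin

section \<open>Test functions\<close>

definition partial_deriv :: "'n::finite \<Rightarrow> (real^'n \<Rightarrow> real) \<Rightarrow> real^'n \<Rightarrow> real" where
  "partial_deriv i f = (\<lambda>x. deriv (\<lambda>s. f (x + s *\<^sub>R axis i 1)) 0)"

definition iter_partial :: "'n::finite list \<Rightarrow> (real^'n \<Rightarrow> real) \<Rightarrow> real^'n \<Rightarrow> real" where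
  "iter_partial js f = foldr partial_deriv js f"

definition laplacian :: "(real^'n::finite \<Rightarrow> real) \<Rightarrow> real^'n \<Rightarrow> real" where
  "laplacian f = (\<lambda>x. \<Sum>i\<in>UNIV. iter_partial [i, i] f x)"

text \<open>
  \<open>C\<^sub>0\<^sup>\<infinity>\<close>: every iterated partial derivative is totally differentiable, in particular
  continuous, at every point.
\<close>

definition test_functions :: "(real^'n::finite \<Rightarrow> real) set" where
  "test_functions =
     {\<phi>. (\<forall>js x. iter_partial js \<phi> differentiable (at x)) \<and> compact (closure {x. \<phi> x \<noteq> 0})}"


section \<open>The Sobolev space \<open>H\<^sup>m\<close> and its dual\<close>

text \<open>
  \<open>L\<^sup>2\<close> and \<open>H\<^sup>m\<close> are sets of Borel representatives; functions that agree almost everywhere are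
  not identified, so the zero class is \<open>{f. l2_norm f = 0}\<close>.
\<close>

definition L2 :: "(real^'n::finite \<Rightarrow> real) set" where
  "L2 = {f. f \<in> borel_measurable lborel \<and> integrable lborel (\<lambda>x. (f x)\<^sup>2)}"

definition l2_norm :: "(real^'n::finite \<Rightarrow> real) \<Rightarrow> real" where
  "l2_norm f = sqrt (LINT x|lborel. (f x)\<^sup>2)"

text \<open>
  A multi-index is a function \<open>\<beta> :: 'n \<Rightarrow> nat\<close>. The classical derivative \<open>D\<^sup>\<beta> \<phi>\<close> of a test function
  is \<open>iter_partial js \<phi>\<close> for any list \<open>js\<close> in which each \<open>i\<close> occurs \<open>\<beta> i\<close> times; by the symmetry of
  second derivatives the order is immaterial.
\<close>

definition mi_order :: "('n::finite \<Rightarrow> nat) \<Rightarrow> nat" where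
  "mi_order \<beta> = (\<Sum>i\<in>UNIV. \<beta> i)"

definition has_weak_deriv ::
    "('n::finite \<Rightarrow> nat) \<Rightarrow> (real^'n \<Rightarrow> real) \<Rightarrow> (real^'n \<Rightarrow> real) \<Rightarrow> bool" where
  "has_weak_deriv \<beta> f g \<longleftrightarrow>
     (\<forall>\<phi>\<in>test_functions. \<forall>js. (\<forall>i. count_list js i = \<beta> i) \<longrightarrow>
        (LINT x|lborel. f x * iter_partial js \<phi> x) =
        (-1) ^ mi_order \<beta> * (LINT x|lborel. g x * \<phi> x))"

text \<open>Unique up to equality almost everywhere, so that its \<open>L\<^sup>2\<close> norm is well defined.\<close>

definition weak_deriv :: "('n::finite \<Rightarrow> nat) \<Rightarrow> (real^'n \<Rightarrow> real) \<Rightarrow> real^'n \<Rightarrow> real" where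
  "weak_deriv \<beta> f = (SOME g. g \<in> L2 \<and> has_weak_deriv \<beta> f g)"

definition sobolev :: "nat \<Rightarrow> (real^'n::finite \<Rightarrow> real) set" where
  "sobolev m = {f \<in> L2. \<forall>\<beta>. mi_order \<beta> \<le> m \<longrightarrow> (\<exists>g\<in>L2. has_weak_deriv \<beta> f g)}"

definition sobolev_norm :: "nat \<Rightarrow> (real^'n::finite \<Rightarrow> real) \<Rightarrow> real" where
  "sobolev_norm m f = sqrt (\<Sum>\<beta> | mi_order \<beta> \<le> m. (l2_norm (weak_deriv \<beta> f))\<^sup>2)"

text \<open>
  \<open>H\<^sup>-\<^sup>m\<close>: the bounded linear functionals on \<open>H\<^sup>m\<close>. Boundedness makes them invariant under changes
  on null sets; extensionality turns equality as functionals on \<open>H\<^sup>m\<close> into HOL equality.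
\<close>

definition sobolev_dual :: "nat \<Rightarrow> ((real^'n::finite \<Rightarrow> real) \<Rightarrow> real) set" where
  "sobolev_dual m =
     {v \<in> extensional (sobolev m).
        (\<forall>f\<in>sobolev m. \<forall>g\<in>sobolev m. v (\<lambda>x. f x + g x) = v f + v g) \<and>
        (\<forall>c. \<forall>f\<in>sobolev m. v (\<lambda>x. c * f x) = c * v f) \<and>
        (\<exists>C. \<forall>f\<in>sobolev m. \<bar>v f\<bar> \<le> C * sobolev_norm m f)}"

definition sobolev_dual_norm :: "nat \<Rightarrow> ((real^'n::finite \<Rightarrow> real) \<Rightarrow> real) \<Rightarrow> real" where
  "sobolev_dual_norm m v =
     (SUP f\<in>{f \<in> sobolev m. sobolev_norm m f \<noteq> 0}. \<bar>v f\<bar> / sobolev_norm m f)"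


section \<open>Distributional solutions\<close>

definition Linf_alpha ::
    "real \<Rightarrow> real \<Rightarrow> nat \<Rightarrow> (real \<Rightarrow> (real^'n::finite \<Rightarrow> real) \<Rightarrow> real) set" where
  "Linf_alpha \<alpha> T m =
     {v \<in> {0..T} \<rightarrow>\<^sub>E sobolev_dual m.
        bdd_above ((\<lambda>t. t powr \<alpha> * sobolev_dual_norm m (v t)) ` {0..T})}"

text \<open>
  Solutions of \<open>\<partial>\<^sub>t\<^sup>\<alpha> u - d \<Delta>u = a u\<close>, \<open>u(0) = \<delta>\<close> on \<open>[0, T]\<close>. The functionals \<open>u \<tau>\<close> depend on
  \<open>\<tau>\<close> arbitrarily, so measurability in \<open>\<tau>\<close> is part of the requirement that the integral exist.
\<close>

definition distributional_solution ::
    "real \<Rightarrow> real \<Rightarrow> real \<Rightarrow> real \<Rightarrow> nat \<Rightarrow>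
     (real \<Rightarrow> (real^'n::finite \<Rightarrow> real) \<Rightarrow> real) \<Rightarrow> bool" where
  "distributional_solution \<alpha> d a T m u \<longleftrightarrow>
     u \<in> Linf_alpha \<alpha> T m \<and>
     (\<forall>\<phi>\<in>test_functions. \<forall>t\<in>{0..T}.
        set_integrable lebesgue {0..t}
          (\<lambda>\<tau>. (d * u \<tau> (laplacian \<phi>) + a * u \<tau> \<phi>) / (t - \<tau>) powr (1 - \<alpha>)) \<and>
        u t \<phi> = \<phi> 0 + 1 / Gamma \<alpha> *
          (LINT \<tau>:{0..t}|lebesgue.
             (d * u \<tau> (laplacian \<phi>) + a * u \<tau> \<phi>) / (t - \<tau>) powr (1 - \<alpha>)))"

end

theory Submission
  imports Defs "HOL-Computational_Algebra.Polynomial" "HOL-Library.Multiset"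
begin

text \<open>
  Everything is reduced to band-limited functions, the smooth \<open>f\<close> with
  \<open>\<parallel>\<partial>\<^sup>\<beta>f\<parallel> \<le> C K\<^bsup>|\<beta>|\<^esup>\<close> in \<open>L\<^sup>2\<close>. They are dense in \<open>H\<^sup>m\<close> by convolution with a product of
  squared cardinal sines, and cutoffs approximate them by test functions.

  Existence. With \<open>L = d \<Delta> + a\<close>, the Mittag-Leffler series \<open>\<Sum>\<^sub>k t\<^bsup>\<alpha>k\<^esup> / \<Gamma>(\<alpha>k + 1) (L\<^sup>kf)(0)\<close> converges
  for band-limited \<open>f\<close> and solves the equation term by term. An energy estimate for its partial sums,
  based on a maximum principle for the Caputo derivative and on \<open>\<langle>f, L f\<rangle> \<le> a \<parallel>f\<parallel>\<^sup>2\<close>, bounds the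
  \<open>L\<^sup>2\<close> norms of all their derivatives; as \<open>m > N/2\<close>, the Sobolev inequality at the origin then
  bounds the value of the series by \<open>C \<parallel>f\<parallel>\<close> in \<open>H\<^sup>m\<close>, and the functional extends to \<open>H\<^sup>m\<close>.

  Uniqueness. The difference \<open>w\<close> of two solutions satisfies \<open>w(t) f = I\<^sup>\<alpha> (w(\<cdot>) (L f)) (t)\<close>, first
  for test functions and by cutoff for band-limited \<open>f\<close>. Iteration gives a bound of order
  \<open>\<kappa>\<^sup>n t\<^bsup>\<alpha>n-\<alpha>\<^esup> / \<Gamma>(\<alpha>n + 1 - \<alpha>)\<close>, which tends to zero.
\<close>

section \<open>Smooth functions\<close>

text \<open>Two classes that meet only in zero have to be reconciled. The equation is posed for test
  functions, but the powers \<open>(ellop d a ^^ k) f\<close> of a nonzero compactly supported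
  function admit no geometric bound; where such a bound holds, supports are unbounded. Cutoff and
  mollification, both convergent in Sobolev norms, cross from one class to the other.

  Summability of the series alone would not do: the termwise bound depends on the bandwidth K and
  does not extend to \<open>sobolev m\<close>. At high frequencies the terms alternate in sign and
  only their cancellation keeps the sum bounded, so a uniform bound has to come from scalar products
  and a maximum principle. Derivatives commute with \<open>ellop\<close>, hence an estimate in
  \<open>L\<^sup>2\<close> serves for each of them.

  For uniqueness the a priori bound is singular like t^(-\<alpha>) at the initial time. It is
  integrable because \<alpha> < 1, and a single fractional integration removes the
  singularity.\<close>

definition smooth :: "(real^'n::finite \<Rightarrow> real) \<Rightarrow> bool" where
  "smooth f \<longleftrightarrow> (\<forall>js x. iter_partial js f differentiable (at x))"

section \<open>Partial derivatives and the chain rule along lines\<close>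

lemma iter_partial_Nil [simp]: "iter_partial [] f = f"
  by (simp add: iter_partial_def)

lemma iter_partial_Cons: "iter_partial (i # js) f = partial_deriv i (iter_partial js f)"
  by (simp add: iter_partial_def)

lemma iter_partial_append: "iter_partial (js @ ks) f = iter_partial js (iter_partial ks f)"
  by (simp add: iter_partial_def)

lemma iter_partial_single [simp]: "iter_partial [i] f = partial_deriv i f"
  by (simp add: iter_partial_def)

lemma has_derivative_line:
  fixes f :: "real^'n::finite \<Rightarrow> real"
  assumes "(f has_derivative f') (at (x + s *\<^sub>R v))"
  shows "((\<lambda>s. f (x + s *\<^sub>R v)) has_real_derivative f' v) (at s)"
proof -
  have "((\<lambda>s. x + s *\<^sub>R v) has_derivative (\<lambda>s. s *\<^sub>R v)) (at s)"
    by (auto intro!: derivative_eq_intros)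
  from has_derivative_compose[OF this assms]
  have "((\<lambda>s. f (x + s *\<^sub>R v)) has_derivative (\<lambda>s. f' (s *\<^sub>R v))) (at s)" .
  moreover have "f' (s *\<^sub>R v) = f' v * s" for s
    using has_derivative_linear[OF assms] by (simp add: linear_scale mult.commute)
  ultimately show ?thesis
    by (simp add: has_field_derivative_def mult_commute_abs)
qed

lemma partial_deriv_eq:
  fixes f :: "real^'n::finite \<Rightarrow> real"
  assumes "(f has_derivative f') (at x)"
  shows "partial_deriv i f x = f' (axis i 1)"
  unfolding partial_deriv_def
  by (rule DERIV_imp_deriv) (use has_derivative_line[of f f' x 0 "axis i 1"] assms in simp)

lemma has_derivative_partials:
  fixes f :: "real^'n::finite \<Rightarrow> real"
  assumes "f differentiable (at x)"
  shows "(f has_derivative (\<lambda>h. \<Sum>i\<in>UNIV. h $ i * partial_deriv i f x)) (at x)"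
proof -
  obtain f' where f': "(f has_derivative f') (at x)"
    using assms by (auto simp: differentiable_def)
  have lin: "linear f'" using f' by (rule has_derivative_linear)
  have "f' h = (\<Sum>i\<in>UNIV. h $ i * partial_deriv i f x)" for h
  proof -
    have "h = (\<Sum>i\<in>UNIV. h $ i *\<^sub>R axis i 1)"
      by (simp add: vec_eq_iff axis_def if_distrib cong: if_cong)
    then have "f' h = (\<Sum>i\<in>UNIV. f' (h $ i *\<^sub>R axis i 1))"
      by (metis lin linear_sum)
    then show ?thesis
      by (simp add: linear_scale[OF lin] partial_deriv_eq[OF f'])
  qed
  then have "f' = (\<lambda>h. \<Sum>i\<in>UNIV. h $ i * partial_deriv i f x)" by auto
  with f' show ?thesis by simp
qed

lemma DERIV_line:
  fixes f :: "real^'n::finite \<Rightarrow> real"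
  assumes "f differentiable (at (x + s *\<^sub>R v))"
  shows "((\<lambda>s. f (x + s *\<^sub>R v)) has_real_derivative (\<Sum>i\<in>UNIV. v $ i * partial_deriv i f (x + s *\<^sub>R v))) (at s)"
  using has_derivative_line[OF has_derivative_partials[OF assms]] .

lemma DERIV_axis:
  fixes f :: "real^'n::finite \<Rightarrow> real"
  assumes "f differentiable (at (x + s *\<^sub>R axis i 1))"
  shows "((\<lambda>s. f (x + s *\<^sub>R axis i 1)) has_real_derivative partial_deriv i f (x + s *\<^sub>R axis i 1)) (at s)"
proof -
  have "(\<Sum>j\<in>UNIV. (axis i 1 :: real^'n) $ j * partial_deriv j f (x + s *\<^sub>R axis i 1))
      = partial_deriv i f (x + s *\<^sub>R axis i 1)"
    by (simp add: axis_def of_bool_def[symmetric] if_distrib cong: if_cong)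
  then show ?thesis using DERIV_line[OF assms] by simp
qed

section \<open>Closure properties of smooth functions\<close>

lemma smooth_differentiable: "smooth f \<Longrightarrow> f differentiable (at x)"
  unfolding smooth_def by (metis iter_partial_Nil)

lemma smooth_iter_partial: "smooth f \<Longrightarrow> smooth (iter_partial js f)"
  unfolding smooth_def by (metis iter_partial_append)

lemma smooth_partial: "smooth f \<Longrightarrow> smooth (partial_deriv i f)"
  using smooth_iter_partial[of f "[i]"] by simp

text \<open>Smoothness as a greatest fixed point. To prove a function smooth it suffices to exhibit
  a suitable invariant set around it, which spares the closure proofs a formula for iterated
  derivatives.\<close>

lemma smooth_coinduct:
  assumes "f \<in> S" "\<And>g x. g \<in> S \<Longrightarrow> g differentiable (at x)" "\<And>g i. g \<in> S \<Longrightarrow> partial_deriv i g \<in> S"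
  shows "smooth f"
proof -
  have "iter_partial js f \<in> S" for js
    by (induction js) (use assms in \<open>auto simp: iter_partial_Cons\<close>)
  then show ?thesis unfolding smooth_def using assms(2) by blast
qed

lemma smooth_continuous: "smooth f \<Longrightarrow> continuous_on A f"
  by (meson continuous_at_imp_continuous_on differentiable_imp_continuous_within smooth_differentiable)

lemma smooth_borel [measurable (raw)]: "smooth f \<Longrightarrow> f \<in> borel_measurable borel"
  by (rule borel_measurable_continuous_onI) (rule smooth_continuous)

lemma partial_deriv_add:
  assumes "f differentiable (at x)" "g differentiable (at x)"
  shows "partial_deriv i (\<lambda>x. f x + g x) x = partial_deriv i f x + partial_deriv i g x"
proof -
  obtain f' g' where *: "(f has_derivative f') (at x)" "(g has_derivative g') (at x)"
    using assms unfolding differentiable_def by auto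
  show ?thesis
    using partial_deriv_eq[OF has_derivative_add[OF *], of i] partial_deriv_eq[OF *(1)] partial_deriv_eq[OF *(2)]
    by simp
qed

lemma partial_deriv_mult:
  assumes "f differentiable (at x)" "g differentiable (at x)"
  shows "partial_deriv i (\<lambda>x. f x * g x) x = partial_deriv i f x * g x + f x * partial_deriv i g x"
proof -
  obtain f' g' where *: "(f has_derivative f') (at x)" "(g has_derivative g') (at x)"
    using assms unfolding differentiable_def by auto
  show ?thesis
    using partial_deriv_eq[OF has_derivative_mult[OF *], of i] partial_deriv_eq[OF *(1)] partial_deriv_eq[OF *(2)]
    by simp
qed

lemma partial_deriv_const [simp]: "partial_deriv i (\<lambda>x. c) = (\<lambda>x. 0)"
  by (auto simp: partial_deriv_def)

lemma smooth_const [intro, simp]: "smooth (\<lambda>x. c)"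
  by (rule smooth_coinduct[of _ "range (\<lambda>c x. c)"]) auto

lemma iter_partial_zero [simp]: "iter_partial js (\<lambda>x. 0) = (\<lambda>x. 0)"
  by (induction js) (auto simp: iter_partial_Cons)

lemma partial_deriv_add_smooth:
  assumes "smooth f" "smooth g"
  shows "partial_deriv i (\<lambda>x. f x + g x) = (\<lambda>x. partial_deriv i f x + partial_deriv i g x)"
  using assms by (intro ext partial_deriv_add smooth_differentiable)

lemma partial_deriv_mult_smooth:
  assumes "smooth f" "smooth g"
  shows "partial_deriv i (\<lambda>x. f x * g x) = (\<lambda>x. partial_deriv i f x * g x + f x * partial_deriv i g x)"
  using assms by (intro ext partial_deriv_mult smooth_differentiable)

lemma smooth_add [intro]:
  assumes "smooth f" "smooth g" shows "smooth (\<lambda>x. f x + g x)"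
proof (rule smooth_coinduct[of _ "{\<lambda>x. f x + g x |f g. smooth f \<and> smooth g}"])
  show "g differentiable at x" if "g \<in> {\<lambda>x. f x + g x |f g. smooth f \<and> smooth g}" for g x
    using that by (auto intro!: derivative_intros intro: smooth_differentiable)
  show "partial_deriv i g \<in> {\<lambda>x. f x + g x |f g. smooth f \<and> smooth g}"
    if "g \<in> {\<lambda>x. f x + g x |f g. smooth f \<and> smooth g}" for g i
    using that by (auto simp: partial_deriv_add_smooth) (use smooth_partial in blast)
qed (use assms in auto)

text \<open>The Leibniz rule turns a product into a sum of two, so products alone are not closed
  under \<open>partial_deriv\<close>; sums of products are, and form the set used in
  \<open>smooth_coinduct\<close>.\<close>

inductive_set smooth_products :: "(real^'n::finite \<Rightarrow> real) set" where
  "smooth f \<Longrightarrow> smooth g \<Longrightarrow> (\<lambda>x. f x * g x) \<in> smooth_products"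
| "p \<in> smooth_products \<Longrightarrow> q \<in> smooth_products \<Longrightarrow> (\<lambda>x. p x + q x) \<in> smooth_products"

lemma smooth_products_differentiable:
  assumes "p \<in> smooth_products" shows "p differentiable (at x)"
  using assms
  by induction (auto intro!: derivative_intros intro: smooth_differentiable)

lemma smooth_products_partial:
  assumes "p \<in> smooth_products" shows "partial_deriv i p \<in> smooth_products"
  using assms
proof induction
  case (1 f g)
  then show ?case
    by (auto simp: partial_deriv_mult_smooth intro!: smooth_products.intros smooth_partial)
next
  case (2 p q)
  then have "partial_deriv i (\<lambda>x. p x + q x) = (\<lambda>x. partial_deriv i p x + partial_deriv i q x)"
    by (intro ext partial_deriv_add smooth_products_differentiable)
  with 2 show ?case by (auto intro: smooth_products.intros)
qed

lemma smooth_mult [intro]: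
  assumes "smooth f" "smooth g" shows "smooth (\<lambda>x. f x * g x)"
  by (rule smooth_coinduct[of _ smooth_products])
    (use assms in \<open>auto intro: smooth_products.intros smooth_products_differentiable smooth_products_partial\<close>)

lemma smooth_cmult [intro]: "smooth f \<Longrightarrow> smooth (\<lambda>x. c * f x)"
  by (rule smooth_mult) auto

lemma smooth_sum: "(\<And>k. k \<in> I \<Longrightarrow> smooth (f k)) \<Longrightarrow> smooth (\<lambda>x. \<Sum>k\<in>I. f k x)"
  by (induction I rule: infinite_finite_induct) auto

lemma smooth_prod: "(\<And>k. k \<in> I \<Longrightarrow> smooth (f k)) \<Longrightarrow> smooth (\<lambda>x. \<Prod>k\<in>I. f k x)"
  by (induction I rule: infinite_finite_induct) auto

lemma iter_partial_add:
  assumes "smooth f" "smooth g"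
  shows "iter_partial js (\<lambda>x. f x + g x) = (\<lambda>x. iter_partial js f x + iter_partial js g x)"
  by (induction js) (use assms in \<open>auto simp: iter_partial_Cons partial_deriv_add_smooth smooth_iter_partial\<close>)

lemma partial_deriv_cmult_smooth:
  assumes "smooth f" shows "partial_deriv i (\<lambda>x. c * f x) = (\<lambda>x. c * partial_deriv i f x)"
  using partial_deriv_mult_smooth[of "\<lambda>x. c" f i] assms by simp

lemma iter_partial_cmult:
  assumes "smooth f"
  shows "iter_partial js (\<lambda>x. c * f x) = (\<lambda>x. c * iter_partial js f x)"
  by (induction js) (use assms in \<open>auto simp: iter_partial_Cons partial_deriv_cmult_smooth smooth_iter_partial\<close>)

lemma iter_partial_diff:
  assumes "smooth f" "smooth g"
  shows "iter_partial js (\<lambda>x. f x - g x) = (\<lambda>x. iter_partial js f x - iter_partial js g x)"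
  using iter_partial_add[of f "\<lambda>x. - 1 * g x" js] iter_partial_cmult[of g js "-1"] smooth_cmult[of g "-1"] assms
  by simp

lemma iter_partial_sum:
  assumes "\<And>k. k \<in> I \<Longrightarrow> smooth (f k)"
  shows "iter_partial js (\<lambda>x. \<Sum>k\<in>I. f k x) = (\<lambda>x. \<Sum>k\<in>I. iter_partial js (f k) x)"
  using assms
  by (induction I rule: infinite_finite_induct) (auto simp: iter_partial_add smooth_sum)

text \<open>Lists act from the right, so the last index is applied first. Splitting it off leaves
  iterated derivatives of products again, which is why inductions on products use
  \<open>rev_induct\<close> with arbitrary factors.\<close>

lemma iter_partial_mult_snoc:
  assumes "smooth f" "smooth g"
  shows "iter_partial (js @ [i]) (\<lambda>x. f x * g x) =
    (\<lambda>x. iter_partial js (\<lambda>x. partial_deriv i f x * g x) x + iter_partial js (\<lambda>x. f x * partial_deriv i g x) x)"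
  using assms
  by (simp add: iter_partial_append partial_deriv_mult_smooth iter_partial_add smooth_mult smooth_partial)

lemma partial_deriv_affine:
  fixes f :: "real^'n::finite \<Rightarrow> real"
  assumes "smooth f"
  shows "partial_deriv i (\<lambda>x. f (c *\<^sub>R x + b)) = (\<lambda>x. c * partial_deriv i f (c *\<^sub>R x + b))"
proof
  fix x
  have "((\<lambda>x. f (c *\<^sub>R x + b)) has_derivative
     (\<lambda>h. \<Sum>j\<in>UNIV. (c *\<^sub>R h) $ j * partial_deriv j f (c *\<^sub>R x + b))) (at x)"
    by (rule has_derivative_compose[OF _ has_derivative_partials[OF smooth_differentiable[OF assms]]])
       (auto intro!: derivative_eq_intros)
  from partial_deriv_eq[OF this, of i]
  have "partial_deriv i (\<lambda>x. f (c *\<^sub>R x + b)) x =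
      (\<Sum>j\<in>UNIV. (c *\<^sub>R axis i 1 :: real^'n) $ j * partial_deriv j f (c *\<^sub>R x + b))" .
  also have "\<dots> = (\<Sum>j\<in>UNIV. if j = i then c * partial_deriv j f (c *\<^sub>R x + b) else 0)"
    by (rule sum.cong) (auto simp: axis_def)
  finally show "partial_deriv i (\<lambda>x. f (c *\<^sub>R x + b)) x = c * partial_deriv i f (c *\<^sub>R x + b)"
    by simp
qed

lemma smooth_affine:
  fixes f :: "real^'n::finite \<Rightarrow> real"
  assumes "smooth f"
  shows "smooth (\<lambda>x. f (c *\<^sub>R x + b))"
proof (rule smooth_coinduct[of _ "{\<lambda>x. a * f (c *\<^sub>R x + b) |f a. smooth f}"])
  \<comment> \<open>The free factor a collects the powers of c that the chain rule produces.\<close>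
  show "(\<lambda>x. f (c *\<^sub>R x + b)) \<in> {\<lambda>x. a * f (c *\<^sub>R x + b) |f a. smooth f}"
    using assms by (auto intro!: exI[of _ f] exI[of _ 1])
  have d: "(\<lambda>x. f (c *\<^sub>R x + b)) differentiable at x" if "smooth f" for f :: "real^'n::finite \<Rightarrow> real" and x
    using has_derivative_compose[OF _ has_derivative_partials[OF smooth_differentiable[OF that]], of "\<lambda>x. c *\<^sub>R x + b" _ x UNIV]
    unfolding differentiable_def by (fastforce intro: derivative_eq_intros)
  show "g differentiable at x" if "g \<in> {\<lambda>x. a * f (c *\<^sub>R x + b) |f a. smooth f}" for g x
    using that by (auto intro!: derivative_intros d)
  show "partial_deriv i g \<in> {\<lambda>x. a * f (c *\<^sub>R x + b) |f a. smooth f}"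
    if g: "g \<in> {\<lambda>x. a * f (c *\<^sub>R x + b) |f a. smooth f}" for g i
  proof -
    obtain f a where f: "g = (\<lambda>x. a * f (c *\<^sub>R x + b))" "smooth f" using g by auto
    have "partial_deriv i g = (\<lambda>x. (a * c) * partial_deriv i f (c *\<^sub>R x + b))"
    proof
      fix x show "partial_deriv i g x = (a * c) * partial_deriv i f (c *\<^sub>R x + b)"
        unfolding f using partial_deriv_mult[of "\<lambda>x. a" x "\<lambda>x. f (c *\<^sub>R x + b)" i] d[OF f(2)]
        by (simp add: partial_deriv_affine[OF f(2)])
    qed
    then show ?thesis using smooth_partial[OF f(2)] by blast
  qed
qed

lemma iter_partial_affine:
  fixes f :: "real^'n::finite \<Rightarrow> real"
  assumes "smooth f"
  shows "iter_partial js (\<lambda>x. f (c *\<^sub>R x + b)) = (\<lambda>x. c ^ length js * iter_partial js f (c *\<^sub>R x + b))"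
proof (induction js)
  case (Cons i js)
  then show ?case
    using smooth_affine[OF smooth_iter_partial[OF assms]] partial_deriv_affine[OF smooth_iter_partial[OF assms]]
    by (simp add: iter_partial_Cons partial_deriv_cmult_smooth mult_ac)
qed simp

section \<open>Symmetry of second derivatives\<close>

lemma second_difference:
  fixes f :: "real^'n::finite \<Rightarrow> real"
  assumes "smooth f" and "s > 0"
  shows "\<exists>a b. 0 < a \<and> a < s \<and> 0 < b \<and> b < s \<and>
    f (x + s *\<^sub>R axis i 1 + s *\<^sub>R axis j 1) - f (x + s *\<^sub>R axis i 1) - f (x + s *\<^sub>R axis j 1) + f x
    = s\<^sup>2 * partial_deriv j (partial_deriv i f) (x + a *\<^sub>R axis i 1 + b *\<^sub>R axis j 1)"
proof -
  \<comment> \<open>The increment in direction j as a function of the displacement in direction i.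
    The mean value theorem for g, and then for h in direction j, leaves one second derivative at an
    interior point.\<close>
  define g where "g r = f ((x + s *\<^sub>R axis j 1) + r *\<^sub>R axis i 1) - f (x + r *\<^sub>R axis i 1)" for r
  have "\<exists>z>0. z < s \<and> g s - g 0 = (s - 0) *
      (partial_deriv i f ((x + s *\<^sub>R axis j 1) + z *\<^sub>R axis i 1) - partial_deriv i f (x + z *\<^sub>R axis i 1))"
    unfolding g_def
    by (rule MVT2) (use assms in \<open>auto intro!: derivative_intros DERIV_axis smooth_differentiable\<close>)
  then obtain a where a: "0 < a" "a < s" "g s - g 0 = (s - 0) *
      (partial_deriv i f ((x + s *\<^sub>R axis j 1) + a *\<^sub>R axis i 1) - partial_deriv i f (x + a *\<^sub>R axis i 1))"
    by blast
  define h where "h r = partial_deriv i f ((x + a *\<^sub>R axis i 1) + r *\<^sub>R axis j 1)" for r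
  have "\<exists>z>0. z < s \<and> h s - h 0 = (s - 0) *
      partial_deriv j (partial_deriv i f) ((x + a *\<^sub>R axis i 1) + z *\<^sub>R axis j 1)"
    unfolding h_def
    by (rule MVT2) (use assms in \<open>auto intro!: DERIV_axis smooth_differentiable smooth_partial\<close>)
  then obtain b where b: "0 < b" "b < s" "h s - h 0 = (s - 0) *
      partial_deriv j (partial_deriv i f) ((x + a *\<^sub>R axis i 1) + b *\<^sub>R axis j 1)"
    by blast
  have "g s - g 0 = s * (h s - h 0)"
    using a(3) by (simp add: h_def add_ac)
  also have "\<dots> = s\<^sup>2 * partial_deriv j (partial_deriv i f) ((x + a *\<^sub>R axis i 1) + b *\<^sub>R axis j 1)"
    using b(3) by (simp add: power2_eq_square)
  finally show ?thesis
    using a(1,2) b(1,2) by (intro exI[of _ a] exI[of _ b]) (simp add: g_def algebra_simps)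
qed

text \<open>Both sides are limits of the second difference quotient of \<open>f\<close> over small squares.\<close>

lemma partial_deriv_commute:
  fixes f :: "real^'n::finite \<Rightarrow> real"
  assumes "smooth f"
  shows "partial_deriv i (partial_deriv j f) = partial_deriv j (partial_deriv i f)"
proof
  fix x
  define S where "S n = inverse (real (Suc n))" for n
  have S: "S n > 0" for n by (simp add: S_def)
  have S0: "S \<longlonglongrightarrow> 0" unfolding S_def by (rule LIMSEQ_inverse_real_of_nat)
  define Q where "Q n = (f (x + S n *\<^sub>R axis i 1 + S n *\<^sub>R axis j 1) - f (x + S n *\<^sub>R axis i 1)
      - f (x + S n *\<^sub>R axis j 1) + f x) / (S n)\<^sup>2" for n
  have lim: "Q \<longlonglongrightarrow> partial_deriv j (partial_deriv i f) x" if ij: "\<And>n. \<exists>a b. 0 < a \<and> a < S n \<and> 0 < b \<and> b < S n \<and>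
     Q n = partial_deriv j (partial_deriv i f) (x + a *\<^sub>R axis i 1 + b *\<^sub>R axis j 1)" for i j
  proof -
    from ij obtain a b where ab: "\<And>n. 0 < a n" "\<And>n. a n < S n" "\<And>n. 0 < b n" "\<And>n. b n < S n"
      "\<And>n. Q n = partial_deriv j (partial_deriv i f) (x + a n *\<^sub>R axis i 1 + b n *\<^sub>R axis j 1)"
      by metis
    have a0: "a \<longlonglongrightarrow> 0"
      by (rule tendsto_sandwich[OF _ _ tendsto_const S0]) (auto intro!: always_eventually less_imp_le ab)
    have b0: "b \<longlonglongrightarrow> 0"
      by (rule tendsto_sandwich[OF _ _ tendsto_const S0]) (auto intro!: always_eventually less_imp_le ab)
    have "(\<lambda>n. x + a n *\<^sub>R axis i 1 + b n *\<^sub>R axis j 1) \<longlonglongrightarrow> x + 0 *\<^sub>R axis i 1 + 0 *\<^sub>R axis j 1"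
      by (intro tendsto_intros a0 b0)
    moreover have "isCont (partial_deriv j (partial_deriv i f)) x"
      using smooth_differentiable[OF smooth_partial[OF smooth_partial[OF assms]]]
      by (rule differentiable_imp_continuous_within)
    ultimately show ?thesis
      unfolding ab(5) by (auto intro: isCont_tendsto_compose)
  qed
  have 1: "Q \<longlonglongrightarrow> partial_deriv j (partial_deriv i f) x"
  proof (rule lim)
    fix n
    obtain a b where "0 < a" "a < S n" "0 < b" "b < S n" 
      "f (x + S n *\<^sub>R axis i 1 + S n *\<^sub>R axis j 1) - f (x + S n *\<^sub>R axis i 1) - f (x + S n *\<^sub>R axis j 1) + f x
    = (S n)\<^sup>2 * partial_deriv j (partial_deriv i f) (x + a *\<^sub>R axis i 1 + b *\<^sub>R axis j 1)"
      using second_difference[OF assms S, where x = x and i = i and j = j] by metis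
    then show "\<exists>a b. 0 < a \<and> a < S n \<and> 0 < b \<and> b < S n \<and>
     Q n = partial_deriv j (partial_deriv i f) (x + a *\<^sub>R axis i 1 + b *\<^sub>R axis j 1)"
      using S[of n] by (intro exI[of _ a] exI[of _ b]) (simp add: Q_def field_simps add_ac)
  qed
  \<comment> \<open>The quotient is symmetric in i and j; expanding it in the other order gives the
    other mixed derivative.\<close>
  have 2: "Q \<longlonglongrightarrow> partial_deriv i (partial_deriv j f) x"
  proof (rule lim)
    fix n
    obtain a b where "0 < a" "a < S n" "0 < b" "b < S n" 
      "f (x + S n *\<^sub>R axis j 1 + S n *\<^sub>R axis i 1) - f (x + S n *\<^sub>R axis j 1) - f (x + S n *\<^sub>R axis i 1) + f x
    = (S n)\<^sup>2 * partial_deriv i (partial_deriv j f) (x + a *\<^sub>R axis j 1 + b *\<^sub>R axis i 1)"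
      using second_difference[OF assms S, where x = x and i = j and j = i] by metis
    then show "\<exists>a b. 0 < a \<and> a < S n \<and> 0 < b \<and> b < S n \<and>
     Q n = partial_deriv i (partial_deriv j f) (x + a *\<^sub>R axis j 1 + b *\<^sub>R axis i 1)"
      using S[of n] by (intro exI[of _ a] exI[of _ b]) (simp add: Q_def field_simps add_ac)
  qed
  show "partial_deriv i (partial_deriv j f) x = partial_deriv j (partial_deriv i f) x"
    using LIMSEQ_unique[OF 2 1] .
qed

lemma iter_partial_partial_commute:
  assumes "smooth f"
  shows "iter_partial js (partial_deriv i f) = partial_deriv i (iter_partial js f)"
  by (induction js) (use assms in \<open>auto simp: iter_partial_Cons partial_deriv_commute smooth_iter_partial\<close>)

lemma iter_partial_swap:
  assumes "smooth f"
  shows "iter_partial js (iter_partial ks f) = iter_partial ks (iter_partial js f)"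
  by (induction ks) (use assms in \<open>auto simp: iter_partial_Cons iter_partial_partial_commute smooth_iter_partial\<close>)

lemma iter_partial_mset_eq:
  assumes "smooth f" "mset js = mset ks"
  shows "iter_partial js f = iter_partial ks f"
  using assms(2)
proof (induction js arbitrary: ks)
  case (Cons i js)
  then have "i \<in> set ks" by (metis list.set_intros(1) mset_eq_setD)
  then obtain k1 k2 where ks: "ks = k1 @ i # k2" by (meson split_list)
  with Cons have "mset js = mset (k1 @ k2)" by simp
  from Cons.IH[OF this] show ?case
    using iter_partial_partial_commute[OF smooth_iter_partial[OF assms(1)]]
    by (simp add: ks iter_partial_append iter_partial_Cons)
qed simp

text \<open>Here \<open>g p\<close> is the p-th derivative of \<open>g 0\<close>; the two sequences
  that occur are \<open>bump_part (bump_poly p)\<close> and \<open>sinc_deriv p\<close>. An index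
  other than i differentiates in a direction in which the function is constant.\<close>

lemma coordinate_function:
  fixes g :: "nat \<Rightarrow> real \<Rightarrow> real" and i :: "'n::finite"
  assumes g: "\<And>p x. (g p has_real_derivative g (Suc p) x) (at x)"
  shows "smooth (\<lambda>x::real^'n. g p (x $ i))"
    and "iter_partial js (\<lambda>x::real^'n. g p (x $ i)) =
      (if set js \<subseteq> {i} then (\<lambda>x. g (p + length js) (x $ i)) else (\<lambda>x. 0))"
proof -
  have hd: "((\<lambda>x::real^'n. g p (x $ i)) has_derivative (\<lambda>h. g (Suc p) (x $ i) * h $ i)) (at x)" for p x
    using has_derivative_compose[OF bounded_linear.has_derivative[OF bounded_linear_vec_nth[of i] has_derivative_ident]
      g[unfolded has_field_derivative_def]] by simp
  then have d: "(\<lambda>x::real^'n. g p (x $ i)) differentiable (at x)" for p x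
    unfolding differentiable_def by blast
  have pd: "partial_deriv j (\<lambda>x::real^'n. g p (x $ i)) = (if j = i then (\<lambda>x. g (Suc p) (x $ i)) else (\<lambda>x. 0))" for j p
    by (rule ext) (auto simp: partial_deriv_eq[OF hd] axis_def)
  show "smooth (\<lambda>x::real^'n. g p (x $ i))"
    by (rule smooth_coinduct[of _ "insert (\<lambda>x. 0) (range (\<lambda>p x::real^'n. g p (x $ i)))"]) (auto simp: pd d)
  show "iter_partial js (\<lambda>x::real^'n. g p (x $ i)) =
      (if set js \<subseteq> {i} then (\<lambda>x. g (p + length js) (x $ i)) else (\<lambda>x. 0))"
    by (induction js) (auto simp: iter_partial_Cons pd)
qed

text \<open>A pointwise Bernstein inequality with amplitude C, bandwidth K and spatial profile w.
  Keeping the three apart makes the class multiplicative.\<close>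

definition exp_type :: "real \<Rightarrow> real \<Rightarrow> (real^'n::finite \<Rightarrow> real) \<Rightarrow> (real^'n \<Rightarrow> real) \<Rightarrow> bool" where
  "exp_type C K w f \<longleftrightarrow> smooth f \<and> (\<forall>js x. \<bar>iter_partial js f x\<bar> \<le> C * K ^ length js * w x)"

lemma exp_type_partial:
  assumes "exp_type C K w f" shows "exp_type (C * K) K w (partial_deriv i f)"
  using assms unfolding exp_type_def
  by (metis (no_types, lifting) iter_partial_append iter_partial_single length_append_singleton
      mult.assoc power_Suc smooth_partial)

text \<open>Bandwidths add under multiplication, as spectra do. The induction builds the binomial
  expansion of (K + K')^n one factor at a time: a derivative costs K if it hits f and K' if it hits
  g.\<close>

lemma exp_type_mult:
  assumes "exp_type C K w f" "exp_type C' K' w' g" "C \<ge> 0" "K \<ge> 0" "C' \<ge> 0" "K' \<ge> 0"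
    "\<And>x. w x \<ge> 0" "\<And>x. w' x \<ge> 0"
  shows "exp_type (C * C') (K + K') (\<lambda>x. w x * w' x) (\<lambda>x. f x * g x)"
proof -
  have "\<bar>iter_partial js (\<lambda>x. f x * g x) x\<bar> \<le> C * C' * (K + K') ^ length js * (w x * w' x)"
    if "exp_type C K w f" "exp_type C' K' w' g" "C \<ge> 0" "C' \<ge> 0" for C C' f g js x
    using that
  proof (induction js arbitrary: C C' f g rule: rev_induct)
    case Nil
    then have "\<bar>f x\<bar> \<le> C * w x" "\<bar>g x\<bar> \<le> C' * w' x"
      unfolding exp_type_def by (metis iter_partial_Nil list.size(3) mult.right_neutral power_0)+
    then have "\<bar>f x\<bar> * \<bar>g x\<bar> \<le> (C * w x) * (C' * w' x)"
      by (intro mult_mono) (use Nil assms in auto)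
    then show ?case by (simp add: abs_mult mult_ac)
  next
    case (snoc i js)
    have s: "smooth f" "smooth g" using snoc.prems by (auto simp: exp_type_def)
    have "\<bar>iter_partial js (\<lambda>x. partial_deriv i f x * g x) x\<bar> \<le> (C * K) * C' * (K + K') ^ length js * (w x * w' x)"
      by (rule snoc.IH) (use snoc.prems assms exp_type_partial in auto)
    moreover have "\<bar>iter_partial js (\<lambda>x. f x * partial_deriv i g x) x\<bar> \<le> C * (C' * K') * (K + K') ^ length js * (w x * w' x)"
      by (rule snoc.IH) (use snoc.prems assms exp_type_partial in auto)
    ultimately have "\<bar>iter_partial (js @ [i]) (\<lambda>x. f x * g x) x\<bar> \<le> 
        (C * K) * C' * (K + K') ^ length js * (w x * w' x) + C * (C' * K') * (K + K') ^ length js * (w x * w' x)"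
      unfolding iter_partial_mult_snoc[OF s] by linarith
    also have "\<dots> = C * C' * (K + K') ^ length (js @ [i]) * (w x * w' x)"
      by (simp add: algebra_simps)
    finally show ?case .
  qed
  with assms show ?thesis unfolding exp_type_def by blast
qed

lemma exp_type_prod:
  fixes f :: "'k \<Rightarrow> real^'n::finite \<Rightarrow> real"
  assumes "finite I" "\<And>k. k \<in> I \<Longrightarrow> exp_type C K (w k) (f k)" "C \<ge> 0" "K \<ge> 0" "\<And>k x. w k x \<ge> 0"
  shows "exp_type (C ^ card I) (K * card I) (\<lambda>x. \<Prod>k\<in>I. w k x) (\<lambda>x. \<Prod>k\<in>I. f k x)"
  using assms(1,2)
proof (induction I rule: finite_induct)
  case empty
  \<comment> \<open>An empty product has bandwidth 0, and \<open>0 ^ 0 = 1\<close> leaves exactly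
    the undifferentiated constant.\<close>
  have "\<bar>iter_partial js (\<lambda>x::real^'n. 1) x\<bar> \<le> 0 ^ length js" for js x
    by (cases js rule: rev_cases) (auto simp: iter_partial_append)
  then show ?case by (simp add: exp_type_def)
next
  case (insert k I)
  have "exp_type (C * C ^ card I) (K + K * card I) (\<lambda>x. w k x * (\<Prod>k\<in>I. w k x)) (\<lambda>x. f k x * (\<Prod>k\<in>I. f k x))"
    by (rule exp_type_mult) (use insert assms in \<open>auto intro: prod_nonneg\<close>)
  with insert show ?case by (simp add: algebra_simps)
qed

section \<open>The space \<open>L\<^sup>2\<close>\<close>

lemma L2_alt: "f \<in> L2 \<longleftrightarrow> f \<in> borel_measurable borel \<and> integrable lborel (\<lambda>x. (f x)\<^sup>2)"
  by (simp add: L2_def)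

lemma L2_measurable: "f \<in> L2 \<Longrightarrow> f \<in> borel_measurable borel"
  by (simp add: L2_alt)

lemma L2_integrable_sq: "f \<in> L2 \<Longrightarrow> integrable lborel (\<lambda>x. (f x)\<^sup>2)"
  by (simp add: L2_alt)

lemma L2_integrable_mult:
  assumes "f \<in> L2" "g \<in> L2"
  shows "integrable lborel (\<lambda>x. f x * g x)"
proof (rule Bochner_Integration.integrable_bound)
  show "integrable lborel (\<lambda>x. (f x)\<^sup>2 + (g x)\<^sup>2)"
    using assms by (auto intro: L2_integrable_sq)
  show "(\<lambda>x. f x * g x) \<in> borel_measurable lborel"
    using assms by (auto dest!: L2_measurable)
  have "\<bar>a * b\<bar> \<le> \<bar>a\<^sup>2 + b\<^sup>2\<bar>" for a b :: real
  proof -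
    have "2 * \<bar>a\<bar> * \<bar>b\<bar> \<le> \<bar>a\<bar>\<^sup>2 + \<bar>b\<bar>\<^sup>2" by (rule sum_squares_bound)
    moreover have "0 \<le> \<bar>a\<bar> * \<bar>b\<bar>" by simp
    ultimately have "\<bar>a\<bar> * \<bar>b\<bar> \<le> a\<^sup>2 + b\<^sup>2" unfolding power2_abs by linarith
    then show ?thesis by (simp only: abs_mult)
  qed
  then show "AE x in lborel. norm (f x * g x) \<le> norm ((f x)\<^sup>2 + (g x)\<^sup>2)"
    by (intro AE_I2) (simp only: real_norm_def)
qed

lemma l2_norm_nonneg [simp]: "l2_norm f \<ge> 0"
  by (simp add: l2_norm_def)

lemma l2_norm_sq: "(l2_norm f)\<^sup>2 = (LINT x|lborel. (f x)\<^sup>2)"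
  by (simp add: l2_norm_def)

lemma l2_norm_minus: "l2_norm (\<lambda>x. - f x) = l2_norm f"
  by (simp add: l2_norm_def)

lemma l2_norm_zero [simp]: "l2_norm (\<lambda>x. 0) = 0"
  by (simp add: l2_norm_def)

lemma l2_norm_cmult: "l2_norm (\<lambda>x. c * f x) = \<bar>c\<bar> * l2_norm f"
  by (simp add: l2_norm_def power_mult_distrib real_sqrt_mult)

lemma L2_Cauchy_Schwarz:
  assumes "f \<in> L2" "g \<in> L2"
  shows "\<bar>LINT x|lborel. f x * g x\<bar> \<le> l2_norm f * l2_norm g"
proof -
  define A B C where "A = (LINT x|lborel. (f x)\<^sup>2)" and "B = (LINT x|lborel. f x * g x)"
    and "C = (LINT x|lborel. (g x)\<^sup>2)"
  have nn: "A \<ge> 0" "C \<ge> 0" by (simp_all add: A_def C_def)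
  \<comment> \<open>A nonnegative quadratic form in (s, t); the claim is its discriminant
    inequality.\<close>
  have q: "s\<^sup>2 * A - 2 * s * t * B + t\<^sup>2 * C \<ge> 0" for s t
  proof -
    have "0 \<le> (LINT x|lborel. (s * f x - t * g x)\<^sup>2)" by simp
    also have "\<dots> = (LINT x|lborel. s\<^sup>2 * (f x)\<^sup>2 - 2 * s * t * (f x * g x) + t\<^sup>2 * (g x)\<^sup>2)"
      by (intro Bochner_Integration.integral_cong) (auto simp: power2_eq_square algebra_simps)
    also have "\<dots> = s\<^sup>2 * A - 2 * s * t * B + t\<^sup>2 * C"
      unfolding A_def B_def C_def
      using L2_integrable_sq[OF assms(1)] L2_integrable_sq[OF assms(2)] L2_integrable_mult[OF assms]
      by simp
    finally show ?thesis .
  qed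
  have "B\<^sup>2 \<le> A * C"
  proof (cases "C = 0")
    case True
    have "B = 0"
    proof (rule ccontr)
      assume "B \<noteq> 0"
      \<comment> \<open>These parameters give the form the value A - (A + 1) = -1.\<close>
      have "A - 2 * ((A + 1) / (2 * B)) * B \<ge> 0" using q[of 1 "(A + 1) / (2 * B)"] True by simp
      then show False using \<open>B \<noteq> 0\<close> by simp
    qed
    with True show ?thesis by simp
  next
    case False
    \<comment> \<open>At s = C, t = B the form factors into C and A C - B^2.\<close>
    have "C * (A * C - B\<^sup>2) \<ge> 0"
      using q[of C B] by (simp add: power2_eq_square algebra_simps)
    with False nn show ?thesis by (simp add: zero_le_mult_iff)
  qed
  then have "sqrt (B\<^sup>2) \<le> sqrt (A * C)" by (rule real_sqrt_le_mono)
  then show ?thesis by (simp add: A_def B_def C_def l2_norm_def real_sqrt_mult)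
qed

lemma L2_add:
  assumes "f \<in> L2" "g \<in> L2" shows "(\<lambda>x. f x + g x) \<in> L2"
proof -
  have "integrable lborel (\<lambda>x. (f x)\<^sup>2 + 2 * (f x * g x) + (g x)\<^sup>2)"
    using L2_integrable_sq[OF assms(1)] L2_integrable_sq[OF assms(2)] L2_integrable_mult[OF assms] by auto
  then show ?thesis
    using assms by (auto simp: L2_alt power2_sum algebra_simps)
qed

lemma L2_cmult: "f \<in> L2 \<Longrightarrow> (\<lambda>x. c * f x) \<in> L2"
  by (auto simp: L2_alt power_mult_distrib)

lemma L2_diff: "f \<in> L2 \<Longrightarrow> g \<in> L2 \<Longrightarrow> (\<lambda>x. f x - g x) \<in> L2"
  using L2_add[of f "\<lambda>x. -1 * g x"] L2_cmult[of g "-1"] by simp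

lemma L2_zero [simp]: "(\<lambda>x. 0) \<in> L2"
  by (simp add: L2_alt)

lemma L2_sum: "(\<And>k. k \<in> I \<Longrightarrow> f k \<in> L2) \<Longrightarrow> (\<lambda>x. \<Sum>k\<in>I. f k x) \<in> L2"
  by (induction I rule: infinite_finite_induct) (auto intro: L2_add)

lemma l2_norm_triangle:
  assumes "f \<in> L2" "g \<in> L2"
  shows "l2_norm (\<lambda>x. f x + g x) \<le> l2_norm f + l2_norm g"
proof (rule power2_le_imp_le)
  have "(l2_norm (\<lambda>x. f x + g x))\<^sup>2 = (LINT x|lborel. (f x)\<^sup>2 + 2 * (f x * g x) + (g x)\<^sup>2)"
    unfolding l2_norm_sq by (intro Bochner_Integration.integral_cong) (auto simp: power2_sum)
  also have "\<dots> = (l2_norm f)\<^sup>2 + 2 * (LINT x|lborel. f x * g x) + (l2_norm g)\<^sup>2"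
    using L2_integrable_sq[OF assms(1)] L2_integrable_sq[OF assms(2)] L2_integrable_mult[OF assms]
    by (simp add: l2_norm_sq)
  also have "\<dots> \<le> (l2_norm f + l2_norm g)\<^sup>2"
    using L2_Cauchy_Schwarz[OF assms] by (simp add: power2_sum)
  finally show "(l2_norm (\<lambda>x. f x + g x))\<^sup>2 \<le> (l2_norm f + l2_norm g)\<^sup>2" .
qed simp

lemma l2_norm_triangle_diff:
  assumes "f \<in> L2" "g \<in> L2"
  shows "l2_norm (\<lambda>x. f x - g x) \<le> l2_norm f + l2_norm g"
  using l2_norm_triangle[OF assms(1) L2_cmult[OF assms(2), of "-1"]] l2_norm_minus[of g] by simp

lemma l2_norm_sum_le:
  "(\<And>k. k \<in> I \<Longrightarrow> f k \<in> L2) \<Longrightarrow> l2_norm (\<lambda>x. \<Sum>k\<in>I. f k x) \<le> (\<Sum>k\<in>I. l2_norm (f k))"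
proof (induction I rule: infinite_finite_induct)
  case (insert k I)
  then show ?case
    using l2_norm_triangle[of "f k" "\<lambda>x. \<Sum>k\<in>I. f k x"] L2_sum[of I f] by auto
qed auto

lemma L2_dominated:
  assumes "g \<in> L2" "f \<in> borel_measurable borel" "\<And>x. \<bar>f x\<bar> \<le> C * \<bar>g x\<bar>"
  shows "f \<in> L2" and "l2_norm f \<le> \<bar>C\<bar> * l2_norm g"
proof -
  have le: "(f x)\<^sup>2 \<le> C\<^sup>2 * (g x)\<^sup>2" for x
    using power_mono[OF assms(3)[of x], of 2] by (simp add: power_mult_distrib)
  have int: "integrable lborel (\<lambda>x. C\<^sup>2 * (g x)\<^sup>2)"
    using L2_integrable_sq[OF assms(1)] by simp
  have "integrable lborel (\<lambda>x. (f x)\<^sup>2)"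
    by (rule Bochner_Integration.integrable_bound[OF int]) (use assms le in auto)
  then show "f \<in> L2" using assms by (simp add: L2_alt)
  have "(LINT x|lborel. (f x)\<^sup>2) \<le> (LINT x|lborel. C\<^sup>2 * (g x)\<^sup>2)"
    by (rule integral_mono) (use int le \<open>f \<in> L2\<close> L2_integrable_sq in auto)
  then have "sqrt (LINT x|lborel. (f x)\<^sup>2) \<le> sqrt (LINT x|lborel. C\<^sup>2 * (g x)\<^sup>2)"
    by (rule real_sqrt_le_mono)
  then show "l2_norm f \<le> \<bar>C\<bar> * l2_norm g"
    by (simp add: l2_norm_def real_sqrt_mult)
qed

lemma l2_norm_tendsto_zero_dominated:
  assumes "g \<in> L2" "\<And>n. f n \<in> borel_measurable borel" "\<And>n x. \<bar>f n x\<bar> \<le> C * \<bar>g x\<bar>"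
    "\<And>x. (\<lambda>n. f n x) \<longlonglongrightarrow> 0"
  shows "(\<lambda>n::nat. l2_norm (f n)) \<longlonglongrightarrow> 0"
proof -
  have le: "(f n x)\<^sup>2 \<le> C\<^sup>2 * (g x)\<^sup>2" for n x
    using power_mono[OF assms(3)[of n x], of 2] by (simp add: power_mult_distrib)
  have "(\<lambda>n. LINT x|lborel. (f n x)\<^sup>2) \<longlonglongrightarrow> (LINT x|(lborel :: (real^'a) measure). 0)"
  proof (rule integral_dominated_convergence[where w = "\<lambda>x. C\<^sup>2 * (g x)\<^sup>2"])
    show "integrable lborel (\<lambda>x. C\<^sup>2 * (g x)\<^sup>2)"
      using L2_integrable_sq[OF assms(1)] by simp
    have "(\<lambda>n. (f n x)\<^sup>2) \<longlonglongrightarrow> 0" for x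
      using tendsto_power[OF assms(4)[of x], of 2] by simp
    then show "AE x in lborel. (\<lambda>n. (f n x)\<^sup>2) \<longlonglongrightarrow> 0" by simp
  qed (use assms le in auto)
  then have "(\<lambda>n. sqrt (LINT x|lborel. (f n x)\<^sup>2)) \<longlonglongrightarrow> sqrt 0"
    by (intro tendsto_real_sqrt) simp
  then show ?thesis by (simp add: l2_norm_def)
qed

section \<open>Affine substitutions and integrals of derivatives\<close>

lemma integral_lborel_affine:
  fixes f :: "real^'n::finite \<Rightarrow> real"
  assumes "c \<noteq> 0" and [measurable]: "f \<in> borel_measurable borel"
  shows "(LINT x|lborel. f (t + c *\<^sub>R x)) = (LINT x|lborel. f x) / \<bar>c\<bar> ^ CARD('n)"
    and "integrable lborel (\<lambda>x. f (t + c *\<^sub>R x)) \<longleftrightarrow> integrable lborel f"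
    and "(\<integral>\<^sup>+x. ennreal (f (t + c *\<^sub>R x)) \<partial>lborel) = (\<integral>\<^sup>+x. ennreal (f x) \<partial>lborel) / ennreal (\<bar>c\<bar> ^ CARD('n))"
proof -
  have c: "\<bar>c\<bar> ^ CARD('n) > 0" using assms(1) by simp
  have L: "(lborel :: (real^'n) measure) = density (distr lborel borel (\<lambda>x. t + c *\<^sub>R x)) (\<lambda>_. ennreal (\<bar>c\<bar> ^ CARD('n)))"
    using lborel_affine[OF assms(1), of t] by simp
  have "(LINT x|lborel. f x) = (LINT x|density (distr lborel borel (\<lambda>x. t + c *\<^sub>R x)) (\<lambda>_. ennreal (\<bar>c\<bar> ^ CARD('n))). f x)"
    by (simp only: L[symmetric])
  also have "\<dots> = \<bar>c\<bar> ^ CARD('n) * (LINT x|lborel. f (t + c *\<^sub>R x))"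
    using c by (subst integral_real_density) (auto simp: integral_distr)
  finally show "(LINT x|lborel. f (t + c *\<^sub>R x)) = (LINT x|lborel. f x) / \<bar>c\<bar> ^ CARD('n)"
    using c by simp
  have "integrable lborel f \<longleftrightarrow> integrable (density (distr lborel borel (\<lambda>x. t + c *\<^sub>R x)) (\<lambda>_. ennreal (\<bar>c\<bar> ^ CARD('n)))) f"
    by (simp only: L[symmetric])
  also have "\<dots> \<longleftrightarrow> integrable lborel (\<lambda>x. f (t + c *\<^sub>R x))"
    using c assms(1) by (subst integrable_real_density) (auto simp: integrable_distr_eq)
  finally show "integrable lborel (\<lambda>x. f (t + c *\<^sub>R x)) \<longleftrightarrow> integrable lborel f" by simp
  have "(\<integral>\<^sup>+x. ennreal (f x) \<partial>lborel) = (\<integral>\<^sup>+x. ennreal (f x) \<partial>density (distr lborel borel (\<lambda>x. t + c *\<^sub>R x)) (\<lambda>_. ennreal (\<bar>c\<bar> ^ CARD('n))))"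
    by (simp only: L[symmetric])
  also have "\<dots> = ennreal (\<bar>c\<bar> ^ CARD('n)) * (\<integral>\<^sup>+x. ennreal (f (t + c *\<^sub>R x)) \<partial>lborel)"
    by (subst nn_integral_density) (auto simp: nn_integral_distr nn_integral_cmult)
  finally have "(\<integral>\<^sup>+x. ennreal (f x) \<partial>lborel) = ennreal (\<bar>c\<bar> ^ CARD('n)) * (\<integral>\<^sup>+x. ennreal (f (t + c *\<^sub>R x)) \<partial>lborel)" .
  then show "(\<integral>\<^sup>+x. ennreal (f (t + c *\<^sub>R x)) \<partial>lborel) = (\<integral>\<^sup>+x. ennreal (f x) \<partial>lborel) / ennreal (\<bar>c\<bar> ^ CARD('n))"
    using c by (simp add: ennreal_mult_divide_eq mult.commute[of "ennreal _"])
qed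

lemma L2_affine:
  fixes f :: "real^'n::finite \<Rightarrow> real"
  assumes "c \<noteq> 0" "f \<in> L2"
  shows "(\<lambda>x. f (t + c *\<^sub>R x)) \<in> L2"
  using assms integral_lborel_affine(2)[of c "\<lambda>x. (f x)\<^sup>2" t]
  by (auto simp: L2_alt)

text \<open>Averaging \<open>u (x + s e\<^sub>i) - u x = \<integral> \<partial>\<^sub>i u (x + r e\<^sub>i) dr\<close> over all \<open>x\<close>
  gives zero on the left and \<open>s \<integral> \<partial>\<^sub>i u\<close> on the right.\<close>

lemma integral_partial_deriv_zero:
  fixes u :: "real^'n::finite \<Rightarrow> real"
  assumes "smooth u" "integrable lborel u" "integrable lborel (partial_deriv i u)"
  shows "(LINT x|lborel. partial_deriv i u x) = 0"
proof -
  define v where "v = partial_deriv i u"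
  have v: "smooth v" "integrable lborel v" using assms smooth_partial by (auto simp: v_def)
  have [measurable]: "v \<in> borel_measurable borel" "u \<in> borel_measurable borel"
    using v assms smooth_borel by auto
  define e :: "real^'n" where "e = axis i 1"
  have tr: "(LINT x|lborel. f (x + t)) = (LINT x|lborel. f x)" 
    "integrable lborel (\<lambda>x. f (x + t)) \<longleftrightarrow> integrable lborel f"
    if "f \<in> borel_measurable borel" for f :: "real^'n \<Rightarrow> real" and t
    using integral_lborel_affine(1,2)[of 1 f t] that by (simp_all add: add.commute)
  have ftc: "(LINT r|lborel. indicator {0..1::real} r * v (x + r *\<^sub>R e)) = u (x + e) - u x" for x
  proof -
    have "(LINT r|lborel. indicator {0..1} r *\<^sub>R v (x + r *\<^sub>R e)) = u (x + 1 *\<^sub>R e) - u (x + 0 *\<^sub>R e)"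
      unfolding v_def e_def
    proof (rule integral_FTC_Icc)
      fix r show "((\<lambda>r. u (x + r *\<^sub>R axis i 1)) has_vector_derivative
         partial_deriv i u (x + r *\<^sub>R axis i 1)) (at r within {0..1})"
        using DERIV_axis[OF smooth_differentiable[OF assms(1)], where x = x and s = r and i = i]
        by (meson has_field_derivative_at_within has_real_derivative_iff_has_vector_derivative)
      show "continuous_on {0..1} (\<lambda>r. partial_deriv i u (x + r *\<^sub>R axis i 1))"
        by (rule continuous_on_compose2[OF smooth_continuous[OF smooth_partial[OF assms(1)]]])
          (auto intro!: continuous_intros)
    qed simp
    then show ?thesis by simp
  qed
  \<comment> \<open>Fubini applies because the integral of \<bar>v\<bar> over a translate is the
    same finite number for every r.\<close>
  have 1: "integrable (lborel \<Otimes>\<^sub>M lborel) (\<lambda>(r, x). indicator {0..1::real} r * v (x + r *\<^sub>R e))"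
  proof (rule lborel_pair.Fubini_integrable)
    have "integrable lborel (\<lambda>r. indicator {0..1::real} r * (LINT x|lborel. \<bar>v x\<bar>))"
      by (intro integrable_mult_left) simp
    moreover have "(LINT x|lborel. norm (indicator {0..1::real} r * v (x + r *\<^sub>R e))) = indicator {0..1::real} r * (LINT x|lborel. \<bar>v x\<bar>)" for r
      using tr(1)[of "\<lambda>x. \<bar>v x\<bar>" "r *\<^sub>R e"] by (simp add: abs_mult)
    ultimately show "integrable lborel (\<lambda>x. LINT y|lborel. norm (case (x, y) of (r, x) \<Rightarrow> indicator {0..1::real} r * v (x + r *\<^sub>R e)))"
      by simp
    show "AE x in lborel. integrable lborel (\<lambda>y. case (x, y) of (r, x) \<Rightarrow> indicator {0..1::real} r * v (x + r *\<^sub>R e))"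
      using tr(2)[of v] v by simp
  qed measurable
  have "(LINT x|lborel. (LINT r|lborel. indicator {0..1::real} r * v (x + r *\<^sub>R e))) = 
     (LINT r|lborel. (LINT x|lborel. indicator {0..1::real} r * v (x + r *\<^sub>R e)))"
    by (rule lborel_pair.Fubini_integral[OF 1])
  also have "\<dots> = (LINT r|lborel. indicator {0..1::real} r * (LINT x|lborel. v x))"
    using tr(1)[of v] by simp
  also have "\<dots> = (LINT x|lborel. v x)"
    by simp
  finally have "(LINT x|lborel. v x) = (LINT x|lborel. u (x + e) - u x)"
    by (simp add: ftc)
  also have "\<dots> = 0"
    using tr[of u e] assms(2) by simp
  finally show ?thesis by (simp add: v_def)
qed

section \<open>Test functions and cutoff\<close>

lemma test_functions_iff: "\<phi> \<in> test_functions \<longleftrightarrow> smooth \<phi> \<and> compact (closure {x. \<phi> x \<noteq> 0})"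
  by (simp add: test_functions_def smooth_def)

lemma test_functions_smooth: "\<phi> \<in> test_functions \<Longrightarrow> smooth \<phi>"
  by (simp add: test_functions_iff)

lemma test_functionsI:
  assumes "smooth \<phi>" "compact S" "\<And>x. x \<notin> S \<Longrightarrow> \<phi> x = 0"
  shows "\<phi> \<in> test_functions"
proof -
  have "closure {x. \<phi> x \<noteq> 0} \<subseteq> S"
    by (rule closure_minimal) (use assms compact_imp_closed in auto)
  then have "compact (closure {x. \<phi> x \<noteq> 0})"
    using assms(2) by (metis closed_closure compact_Int_closed inf.absorb_iff2)
  with assms show ?thesis by (simp add: test_functions_iff)
qed

text \<open>One compact set serves for all derivatives: each point off the closed support has a
  neighbourhood on which the function, and hence every derivative, is zero.\<close>

lemma test_functions_support:
  assumes "\<phi> \<in> test_functions"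
  obtains S where "compact S" "\<And>js x. x \<notin> S \<Longrightarrow> iter_partial js \<phi> x = 0"
proof
  define S where "S = closure {x. \<phi> x \<noteq> 0}"
  show "compact S" using assms by (simp add: test_functions_iff S_def)
  then have o: "open (- S)" by (simp add: compact_imp_closed open_Compl)
  show "iter_partial js \<phi> x = 0" if "x \<notin> S" for js x
    using that
  proof (induction js arbitrary: x)
    case Nil
    then show ?case using closure_subset[of "{x. \<phi> x \<noteq> 0}"] by (auto simp: S_def)
  next
    case (Cons i js)
    have "((\<lambda>x. 0) has_derivative (\<lambda>h. 0)) (at x)" by simp
    then have "(iter_partial js \<phi> has_derivative (\<lambda>h. 0)) (at x)"
      by (rule has_derivative_transform_within_open[OF _ o]) (use Cons in auto)
    then show ?case by (simp add: iter_partial_Cons partial_deriv_eq)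
  qed
qed

lemma test_functions_iter_partial: "\<phi> \<in> test_functions \<Longrightarrow> iter_partial js \<phi> \<in> test_functions"
  by (metis test_functionsI test_functions_support test_functions_smooth smooth_iter_partial)

lemma test_functions_mult_smooth:
  assumes "\<phi> \<in> test_functions" "smooth g"
  shows "(\<lambda>x. \<phi> x * g x) \<in> test_functions"
proof -
  obtain S where S: "compact S" "\<And>js x. x \<notin> S \<Longrightarrow> iter_partial js \<phi> x = 0"
    by (rule test_functions_support[OF assms(1)]) blast
  show ?thesis
    by (rule test_functionsI[OF _ S(1)]) (use assms test_functions_smooth S(2)[of _ "[]"] in auto)
qed

lemma test_functions_cmult: "\<phi> \<in> test_functions \<Longrightarrow> (\<lambda>x. c * \<phi> x) \<in> test_functions"
  using test_functions_mult_smooth[of \<phi> "\<lambda>x. c"] by (simp add: mult.commute)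

lemma laplacian_eq: "laplacian f = (\<lambda>x. \<Sum>i\<in>UNIV. iter_partial [i, i] f x)"
  by (simp add: laplacian_def)

lemma test_functions_bounded:
  assumes "\<phi> \<in> test_functions"
  obtains M where "M \<ge> 0" "\<And>x. \<bar>\<phi> x\<bar> \<le> M"
proof -
  obtain S where S: "compact S" "\<And>js x. x \<notin> S \<Longrightarrow> iter_partial js \<phi> x = 0"
    by (rule test_functions_support[OF assms]) blast
  have "compact (\<phi> ` S)"
    by (rule compact_continuous_image[OF smooth_continuous[OF test_functions_smooth[OF assms]] S(1)])
  then obtain M where "\<forall>y\<in>\<phi> ` S. norm y \<le> M"
    by (meson compact_imp_bounded bounded_iff)
  then have M: "\<bar>\<phi> x\<bar> \<le> M" if "x \<in> S" for x using that by auto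
  have "\<bar>\<phi> x\<bar> \<le> max M 0" for x
    using M[of x] S(2)[of x "[]"] by (cases "x \<in> S") auto
  then show ?thesis using that[of "max M 0"] by auto
qed

lemma test_functions_integrable:
  assumes "\<phi> \<in> test_functions"
  shows "integrable lborel \<phi>"
proof -
  obtain S where S: "compact S" "\<And>js x. x \<notin> S \<Longrightarrow> iter_partial js \<phi> x = 0"
    by (rule test_functions_support[OF assms]) blast
  obtain M where M: "M \<ge> 0" "\<And>x. \<bar>\<phi> x\<bar> \<le> M" by (rule test_functions_bounded[OF assms]) blast
  show ?thesis
  proof (rule Bochner_Integration.integrable_bound)
    show "integrable lborel (\<lambda>x. M * indicator S x :: real)"
      using S(1) by (intro integrable_mult_right integrable_real_indicator)
        (use emeasure_compact_finite[OF S(1)] in \<open>auto simp: compact_imp_closed borel_closed less_top\<close>)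
    show "\<phi> \<in> borel_measurable lborel" using smooth_borel[OF test_functions_smooth[OF assms]] by simp
    show "AE x in lborel. norm (\<phi> x) \<le> norm (M * indicator S x)"
      using M S(2)[of _ "[]"] by (auto simp: indicator_def)
  qed
qed

lemma test_functions_L2: "\<phi> \<in> test_functions \<Longrightarrow> \<phi> \<in> L2"
  using test_functions_integrable[OF test_functions_mult_smooth[of \<phi> \<phi>]] test_functions_smooth[of \<phi>]
  by (simp add: L2_alt smooth_borel power2_eq_square)

section \<open>A smooth function with compact support\<close>

lemma tendsto_poly_exp_neg: "((\<lambda>y. poly p y * exp (- y :: real)) \<longlongrightarrow> 0) at_top"
proof -
  have "((\<lambda>y. \<Sum>k\<le>degree p. coeff p k * (y ^ k / exp y)) \<longlongrightarrow> (\<Sum>k\<le>degree p. coeff p k * 0)) at_top"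
    by (intro tendsto_intros tendsto_power_div_exp_0)
  then show ?thesis
    by (simp add: poly_altdef sum_distrib_left exp_minus divide_inverse mult_ac)
qed

text \<open>A family stable under differentiation that contains the flat function exp(-1/x), so that
  smoothness of the latter reduces to first derivatives within the family.\<close>

definition bump_part :: "real poly \<Rightarrow> real \<Rightarrow> real" where
  "bump_part p x = (if x > 0 then poly p (1 / x) * exp (- (1 / x)) else 0)"

text \<open>With y = 1/x, the derivative of p(y) exp(-y) in x is y^2 (p(y) - p'(y)) exp(-y); the
  polynomial \<open>[:0, 0, 1:]\<close> is y^2.\<close>

lemma bump_part_deriv:
  "(bump_part p has_real_derivative bump_part ([:0, 0, 1:] * (p - pderiv p)) x) (at x)"
proof -
  consider "x > 0" | "x < 0" | "x = 0" by linarith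
  then show ?thesis
  proof cases
    case 1
    have "((\<lambda>x. poly p (1 / x) * exp (- (1 / x))) has_real_derivative
        bump_part ([:0, 0, 1:] * (p - pderiv p)) x) (at x)"
      using 1 by (auto intro!: derivative_eq_intros DERIV_chain2[OF poly_DERIV] 
          simp: bump_part_def power2_eq_square field_simps)
    then show ?thesis
      by (rule has_field_derivative_transform_within_open[of _ _ _ "{0<..}"]) (use 1 in \<open>auto simp: bump_part_def\<close>)
  next
    case 2
    have "((\<lambda>x. 0) has_real_derivative 0) (at x)" by simp
    then have "(bump_part p has_real_derivative 0) (at x)"
      by (rule has_field_derivative_transform_within_open[of _ _ _ "{..<0}"]) (use 2 in \<open>auto simp: bump_part_def\<close>)
    with 2 show ?thesis by (simp add: bump_part_def)
  next
    case 3
    \<comment> \<open>The difference quotient at 0 is y p(y) exp(-y) with y = 1/h; the extra factor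
      y is the \<open>pCons 0\<close>.\<close>
    have "((\<lambda>y. poly (pCons 0 p) y * exp (- y)) \<longlongrightarrow> 0) at_top"
      by (rule tendsto_poly_exp_neg)
    then have "((\<lambda>h. poly (pCons 0 p) (inverse h) * exp (- inverse h)) \<longlongrightarrow> 0) (at_right 0)"
      by (rule filterlim_compose[OF _ filterlim_inverse_at_top_right])
    then have "((\<lambda>h. bump_part p h / h) \<longlongrightarrow> 0) (at_right 0)"
      by (rule Lim_transform_eventually)
        (auto simp: eventually_at_right_field bump_part_def field_simps intro!: exI[of _ 1])
    moreover have "((\<lambda>h. bump_part p h / h) \<longlongrightarrow> 0) (at_left 0)"
      by (rule Lim_transform_eventually[of "\<lambda>h. 0"])
        (auto simp: eventually_at_left_field bump_part_def intro!: exI[of _ "-1"])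
    ultimately have "((\<lambda>h. bump_part p h / h) \<longlongrightarrow> 0) (at 0)"
      by (simp add: filterlim_split_at)
    then show ?thesis
      unfolding 3 by (simp add: DERIV_def bump_part_def)
  qed
qed

primrec bump_poly :: "nat \<Rightarrow> real poly" where
  "bump_poly 0 = 1"
| "bump_poly (Suc k) = [:0, 0, 1:] * (bump_poly k - pderiv (bump_poly k))"

lemma bump_exists: "\<exists>\<eta>\<in>test_functions. \<eta> (0 :: real^'n::finite) = 1"
proof -
  define g where "g = bump_part 1"
  have sm: "smooth (\<lambda>x::real^'n. g (x $ i))" for i
    using coordinate_function(1)[of "\<lambda>k. bump_part (bump_poly k)" 0 i] bump_part_deriv
    by (simp add: g_def)
  define b :: "real^'n" where "b = (\<chi> i. 1)"
  have sm2: "smooth (\<lambda>x::real^'n. g ((c *\<^sub>R x + b) $ i))" for c i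
    by (rule smooth_affine[OF sm])
  \<comment> \<open>Each factor is positive when \<bar>\<open>x $ i\<close>\<bar> < 1 and zero
    otherwise, so the product lives on the cube \<open>cbox (-b) b\<close>.\<close>
  define f where "f x = (\<Prod>i\<in>UNIV. g ((1 *\<^sub>R x + b) $ i) * g ((-1 *\<^sub>R x + b) $ i))" for x :: "real^'n"
  have f: "smooth f"
    unfolding f_def by (intro smooth_prod smooth_mult sm2)
  have f0: "f 0 > 0" by (auto simp: f_def b_def g_def bump_part_def intro!: prod_pos)
  have "f \<in> test_functions"
  proof (rule test_functionsI[OF f compact_cbox[of "-b" b]])
    fix x assume "x \<notin> cbox (-b) b"
    then obtain i where i: "x $ i < -1 \<or> x $ i > 1"
      by (auto simp: mem_box_cart b_def not_le)
    then have "g ((1 *\<^sub>R x + b) $ i) * g ((-1 *\<^sub>R x + b) $ i) = 0"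
      by (auto simp: b_def g_def bump_part_def)
    then show "f x = 0" unfolding f_def by (intro prod_zero) auto
  qed
  then have "(\<lambda>x. (1 / f 0) * f x) \<in> test_functions" by (rule test_functions_cmult)
  then show ?thesis using f0 by (intro bexI[of _ "\<lambda>x. (1 / f 0) * f x"]) auto
qed

section \<open>Smooth functions with square integrable derivatives\<close>

definition smooth_L2 :: "(real^'n::finite \<Rightarrow> real) set" where
  "smooth_L2 = {f. smooth f \<and> (\<forall>js. iter_partial js f \<in> L2)}"

lemma smooth_L2_smooth: "f \<in> smooth_L2 \<Longrightarrow> smooth f"
  and smooth_L2_iter_L2: "f \<in> smooth_L2 \<Longrightarrow> iter_partial js f \<in> L2"
  by (auto simp: smooth_L2_def)

lemma smooth_L2_L2: "f \<in> smooth_L2 \<Longrightarrow> f \<in> L2"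
  using smooth_L2_iter_L2[of f "[]"] by simp

lemma smooth_L2_iter_partial: "f \<in> smooth_L2 \<Longrightarrow> iter_partial js f \<in> smooth_L2"
  by (auto simp: smooth_L2_def smooth_iter_partial iter_partial_append[symmetric])

lemma smooth_L2_partial: "f \<in> smooth_L2 \<Longrightarrow> partial_deriv i f \<in> smooth_L2"
  using smooth_L2_iter_partial[of f "[i]"] by simp

lemma smooth_L2_add: "f \<in> smooth_L2 \<Longrightarrow> g \<in> smooth_L2 \<Longrightarrow> (\<lambda>x. f x + g x) \<in> smooth_L2"
  by (auto simp: smooth_L2_def iter_partial_add intro: L2_add)

lemma smooth_L2_cmult: "f \<in> smooth_L2 \<Longrightarrow> (\<lambda>x. c * f x) \<in> smooth_L2"
  by (auto simp: smooth_L2_def iter_partial_cmult intro: L2_cmult)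

lemma smooth_L2_diff: "f \<in> smooth_L2 \<Longrightarrow> g \<in> smooth_L2 \<Longrightarrow> (\<lambda>x. f x - g x) \<in> smooth_L2"
  using smooth_L2_add[of f "\<lambda>x. -1 * g x"] smooth_L2_cmult[of g "-1"] by simp

lemma smooth_L2_sum: "(\<And>k. k \<in> I \<Longrightarrow> f k \<in> smooth_L2) \<Longrightarrow> (\<lambda>x. \<Sum>k\<in>I. f k x) \<in> smooth_L2"
  by (auto simp: smooth_L2_def iter_partial_sum intro: L2_sum smooth_sum)

lemma test_functions_smooth_L2: "\<phi> \<in> test_functions \<Longrightarrow> \<phi> \<in> smooth_L2"
  by (simp add: smooth_L2_def test_functions_smooth test_functions_L2 test_functions_iter_partial)

text \<open>The Leibniz rule for cutoffs. The limit c is a parameter because the induction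
  differentiates \<psi>: the sequence \<open>partial_deriv i (\<psi> n)\<close> satisfies the
  hypotheses again, with 0 in place of c.\<close>

lemma product_converges:
  fixes \<psi> :: "nat \<Rightarrow> real^'n::finite \<Rightarrow> real"
  assumes "\<And>n. smooth (\<psi> n)" "\<And>js. \<exists>M. \<forall>n x. \<bar>iter_partial js (\<psi> n) x\<bar> \<le> M"
    "\<And>x. (\<lambda>n. \<psi> n x) \<longlonglongrightarrow> c" "\<And>js x. js \<noteq> [] \<Longrightarrow> (\<lambda>n. iter_partial js (\<psi> n) x) \<longlonglongrightarrow> 0"
    "f \<in> smooth_L2"
  shows "(\<forall>n. iter_partial js (\<lambda>x. \<psi> n x * f x) \<in> L2) \<and>
    (\<lambda>n. l2_norm (\<lambda>x. iter_partial js (\<lambda>x. \<psi> n x * f x) x - c * iter_partial js f x)) \<longlonglongrightarrow> 0"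
  using assms
proof (induction js arbitrary: \<psi> c f rule: rev_induct)
  case Nil
  obtain M where M: "\<And>n x. \<bar>\<psi> n x\<bar> \<le> M" using Nil(2)[of "[]"] by auto
  have [measurable]: "f \<in> borel_measurable borel" "\<And>n. \<psi> n \<in> borel_measurable borel"
    by (rule smooth_borel[OF smooth_L2_smooth[OF Nil(5)]]) (rule smooth_borel[OF Nil(1)])
  have "(\<lambda>x. \<psi> n x * f x) \<in> L2" for n
    by (rule L2_dominated(1)[OF smooth_L2_L2[OF Nil(5)], of _ M])
      (auto simp: abs_mult intro!: mult_right_mono M)
  moreover have "(\<lambda>n. l2_norm (\<lambda>x. \<psi> n x * f x - c * f x)) \<longlonglongrightarrow> 0"
  proof (rule l2_norm_tendsto_zero_dominated[OF smooth_L2_L2[OF Nil(5)]])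
    show "\<bar>\<psi> n x * f x - c * f x\<bar> \<le> (M + \<bar>c\<bar>) * \<bar>f x\<bar>" for n x
    proof -
      have "\<bar>\<psi> n x * f x - c * f x\<bar> = \<bar>\<psi> n x - c\<bar> * \<bar>f x\<bar>"
        by (simp add: abs_mult[symmetric] algebra_simps)
      also have "\<dots> \<le> (M + \<bar>c\<bar>) * \<bar>f x\<bar>"
        by (rule mult_right_mono) (use M[of n x] in auto)
      finally show ?thesis .
    qed
    show "(\<lambda>n. \<psi> n x * f x - c * f x) \<longlonglongrightarrow> 0" for x
      using tendsto_diff[OF tendsto_mult_right[OF Nil(3)[of x], of "f x"] tendsto_const[of "c * f x"]] by simp
  qed measurable
  ultimately show ?case by simp
next
  case (snoc i js)
  note s = snoc.prems(1) smooth_L2_smooth[OF snoc.prems(5)]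
  have 1: "(\<forall>n. iter_partial js (\<lambda>x. partial_deriv i (\<psi> n) x * f x) \<in> L2) \<and>
    (\<lambda>n. l2_norm (\<lambda>x. iter_partial js (\<lambda>x. partial_deriv i (\<psi> n) x * f x) x - 0 * iter_partial js f x)) \<longlonglongrightarrow> 0"
  proof (rule snoc.IH)
    show "\<exists>M. \<forall>n x. \<bar>iter_partial ks (partial_deriv i (\<psi> n)) x\<bar> \<le> M" for ks
      using snoc.prems(2)[of "ks @ [i]"] by (simp add: iter_partial_append)
    show "(\<lambda>n. partial_deriv i (\<psi> n) x) \<longlonglongrightarrow> 0" for x
      using snoc.prems(4)[of "[i]" x] by simp
    show "(\<lambda>n. iter_partial ks (partial_deriv i (\<psi> n)) x) \<longlonglongrightarrow> 0" for ks x
      using snoc.prems(4)[of "ks @ [i]" x] by (simp add: iter_partial_append)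
  qed (use snoc.prems in \<open>auto intro: smooth_partial\<close>)
  have 2: "(\<forall>n. iter_partial js (\<lambda>x. \<psi> n x * partial_deriv i f x) \<in> L2) \<and>
    (\<lambda>n. l2_norm (\<lambda>x. iter_partial js (\<lambda>x. \<psi> n x * partial_deriv i f x) x - c * iter_partial js (partial_deriv i f) x)) \<longlonglongrightarrow> 0"
    by (rule snoc.IH) (use snoc.prems smooth_L2_partial in auto)
  have eq: "iter_partial (js @ [i]) (\<lambda>x. \<psi> n x * f x) = (\<lambda>x. iter_partial js (\<lambda>x. partial_deriv i (\<psi> n) x * f x) x
      + iter_partial js (\<lambda>x. \<psi> n x * partial_deriv i f x) x)" for n
    by (rule iter_partial_mult_snoc[OF s])
  have e2: "iter_partial (js @ [i]) f = iter_partial js (partial_deriv i f)"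
    by (simp add: iter_partial_append)
  have "(\<lambda>n. l2_norm (\<lambda>x. iter_partial (js @ [i]) (\<lambda>x. \<psi> n x * f x) x - c * iter_partial (js @ [i]) f x)) \<longlonglongrightarrow> 0"
  proof (rule tendsto_sandwich[OF _ _ tendsto_const])
    show "(\<lambda>n. l2_norm (iter_partial js (\<lambda>x. partial_deriv i (\<psi> n) x * f x)) +
       l2_norm (\<lambda>x. iter_partial js (\<lambda>x. \<psi> n x * partial_deriv i f x) x - c * iter_partial js (partial_deriv i f) x)) \<longlonglongrightarrow> 0"
      using tendsto_add[OF conjunct2[OF 1] conjunct2[OF 2]] by simp
    have "l2_norm (\<lambda>x. iter_partial (js @ [i]) (\<lambda>x. \<psi> n x * f x) x - c * iter_partial (js @ [i]) f x) \<le>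
       l2_norm (iter_partial js (\<lambda>x. partial_deriv i (\<psi> n) x * f x)) +
       l2_norm (\<lambda>x. iter_partial js (\<lambda>x. \<psi> n x * partial_deriv i f x) x - c * iter_partial js (partial_deriv i f) x)" for n
      unfolding eq e2 add_diff_eq[symmetric]
      by (rule l2_norm_triangle)
        (use 1 2 smooth_L2_iter_L2[OF smooth_L2_partial[OF snoc.prems(5), of i], of js] in \<open>auto intro: L2_diff L2_cmult\<close>)
    then show "\<forall>\<^sub>F n in sequentially. l2_norm (\<lambda>x. iter_partial (js @ [i]) (\<lambda>x. \<psi> n x * f x) x - c * iter_partial (js @ [i]) f x) \<le>
       l2_norm (iter_partial js (\<lambda>x. partial_deriv i (\<psi> n) x * f x)) +
       l2_norm (\<lambda>x. iter_partial js (\<lambda>x. \<psi> n x * partial_deriv i f x) x - c * iter_partial js (partial_deriv i f) x)"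
      by simp
  qed simp
  moreover have "iter_partial (js @ [i]) (\<lambda>x. \<psi> n x * f x) \<in> L2" for n
    unfolding eq by (rule L2_add) (use 1 2 in auto)
  ultimately show ?case by simp
qed

text \<open>For the dilated cutoffs \<eta>(x / (n + 1)) every derivative gains a factor 1 / (n + 1),
  so only the term in which the cutoff is not differentiated survives. One sequence works for all
  js, hence for all Sobolev norms.\<close>

lemma test_functions_dense_smooth_L2:
  assumes "f \<in> smooth_L2"
  obtains \<phi> :: "nat \<Rightarrow> real^'n::finite \<Rightarrow> real" where "\<And>n. \<phi> n \<in> test_functions"
    "\<And>js. (\<lambda>n. l2_norm (\<lambda>x. iter_partial js (\<phi> n) x - iter_partial js f x)) \<longlonglongrightarrow> 0"
proof -
  obtain \<eta> :: "real^'n \<Rightarrow> real" where \<eta>: "\<eta> \<in> test_functions" "\<eta> 0 = 1" using bump_exists by blast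
  note s = test_functions_smooth[OF \<eta>(1)]
  define c where "c n = inverse (real (Suc n))" for n
  have c: "0 < c n" "c n \<le> 1" for n by (auto simp: c_def field_simps)
  have c0: "c \<longlonglongrightarrow> 0" unfolding c_def by (rule LIMSEQ_inverse_real_of_nat)
  define \<psi> where "\<psi> n x = \<eta> (c n *\<^sub>R x + 0)" for n x
  have sm: "smooth (\<psi> n)" for n unfolding \<psi>_def by (rule smooth_affine[OF s])
  have ip: "iter_partial js (\<psi> n) = (\<lambda>x. c n ^ length js * iter_partial js \<eta> (c n *\<^sub>R x + 0))" for js n
    unfolding \<psi>_def by (rule iter_partial_affine[OF s])
  have bd: "\<exists>M. \<forall>n x. \<bar>iter_partial js (\<psi> n) x\<bar> \<le> M \<and> \<bar>iter_partial js \<eta> x\<bar> \<le> M" for js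
  proof -
    obtain M where M: "M \<ge> 0" "\<And>x. \<bar>iter_partial js \<eta> x\<bar> \<le> M"
      using test_functions_bounded[OF test_functions_iter_partial[OF \<eta>(1)]] by metis
    have "\<bar>iter_partial js (\<psi> n) x\<bar> \<le> 1 * M" for n x
      unfolding ip abs_mult by (rule mult_mono) (use M c[of n] in \<open>auto intro: power_le_one\<close>)
    with M show ?thesis by auto
  qed
  have lim: "(\<lambda>n. iter_partial js (\<psi> n) x) \<longlonglongrightarrow> 0" if "js \<noteq> []" for js x
  proof -
    obtain M where M: "\<And>x. \<bar>iter_partial js \<eta> x\<bar> \<le> M" using bd[of js] by blast
    show ?thesis
  proof (rule Lim_null_comparison)
    show "\<forall>\<^sub>F n in sequentially. norm (iter_partial js (\<psi> n) x) \<le> c n * M"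
    proof (intro always_eventually allI)
      fix n
      have "c n ^ length js \<le> c n ^ 1" by (rule power_decreasing) (use c[of n] that in \<open>auto simp: Suc_le_eq\<close>)
      then show "norm (iter_partial js (\<psi> n) x) \<le> c n * M"
        unfolding ip real_norm_def abs_mult by (intro mult_mono) (use c[of n] M in \<open>auto simp: less_imp_le\<close>)
    qed
    show "(\<lambda>n. c n * M) \<longlonglongrightarrow> 0" using tendsto_mult_left_zero[OF c0] .
  qed
  qed
  have lim0: "(\<lambda>n. \<psi> n x) \<longlonglongrightarrow> 1" for x
  proof -
    have "(\<lambda>n. c n *\<^sub>R x + 0) \<longlonglongrightarrow> 0 *\<^sub>R x + 0" by (intro tendsto_intros c0)
    moreover have "isCont \<eta> 0" using smooth_differentiable[OF s] by (rule differentiable_imp_continuous_within)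
    ultimately show ?thesis unfolding \<psi>_def \<eta>(2)[symmetric] by (auto intro: isCont_tendsto_compose)
  qed
  have "\<psi> n \<in> test_functions" for n
  proof -
    obtain S where S: "compact S" "\<And>js x. x \<notin> S \<Longrightarrow> iter_partial js \<eta> x = 0"
      by (rule test_functions_support[OF \<eta>(1)]) blast
    show ?thesis
    proof (rule test_functionsI[OF sm])
      show "compact ((\<lambda>x. inverse (c n) *\<^sub>R x) ` S)"
        using S(1) by (rule compact_scaling)
      show "\<psi> n x = 0" if "x \<notin> (\<lambda>x. inverse (c n) *\<^sub>R x) ` S" for x
      proof -
        have "c n *\<^sub>R x \<notin> S"
        proof
          assume "c n *\<^sub>R x \<in> S"
          then have "inverse (c n) *\<^sub>R (c n *\<^sub>R x) \<in> (\<lambda>x. inverse (c n) *\<^sub>R x) ` S" by (rule imageI)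
          with that show False using c[of n] by simp
        qed
        then show ?thesis using S(2)[of _ "[]"] by (simp add: \<psi>_def)
      qed
    qed
  qed
  then have "(\<lambda>x. \<psi> n x * f x) \<in> test_functions" for n
    using test_functions_mult_smooth smooth_L2_smooth[OF assms] by blast
  moreover have "(\<lambda>n. l2_norm (\<lambda>x. iter_partial js (\<lambda>x. \<psi> n x * f x) x - 1 * iter_partial js f x)) \<longlonglongrightarrow> 0" for js
    using product_converges[of \<psi> 1 f js] sm bd lim lim0 assms by blast
  ultimately show ?thesis using that[of "\<lambda>n x. \<psi> n x * f x"] by simp
qed

section \<open>Continuity of translations\<close>

lemma translate_integral:
  fixes f :: "real^'n::finite \<Rightarrow> real"
  assumes "f \<in> borel_measurable borel"
  shows "(LINT x|lborel. f (x + h)) = (LINT x|lborel. f x)"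
    "integrable lborel (\<lambda>x. f (x + h)) \<longleftrightarrow> integrable lborel f"
  using integral_lborel_affine(1,2)[of 1 f h] assms by (simp_all add: add.commute)

lemma translate_L2: "f \<in> L2 \<Longrightarrow> (\<lambda>x. f (x + h)) \<in> L2"
  using L2_affine[of 1 f h] by (simp add: add.commute)

text \<open>Translations preserve the \<open>L\<^sup>1\<close> norm, so the functions with
  continuous translations form a closed set. This serves twice: for measurable sets approximated by
  open ones and for limits of simple functions.\<close>

lemma L1_translation_approx:
  fixes f :: "real^'n::finite \<Rightarrow> real" and h :: "nat \<Rightarrow> real^'n"
  assumes f: "integrable lborel f"
    and g: "\<And>e. e > 0 \<Longrightarrow> \<exists>g. integrable lborel g \<and> (LINT x|lborel. \<bar>f x - g x\<bar>) \<le> e \<and>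
      (\<lambda>n. LINT x|lborel. \<bar>g (x + h n) - g x\<bar>) \<longlonglongrightarrow> 0"
  shows "(\<lambda>n. LINT x|lborel. \<bar>f (x + h n) - f x\<bar>) \<longlonglongrightarrow> 0"
proof (rule LIMSEQ_I)
  fix e :: real assume "e > 0"
  then have "e / 3 > 0" by simp
  from g[OF this] obtain g where g: "integrable lborel g" "(LINT x|lborel. \<bar>f x - g x\<bar>) \<le> e / 3"
      "(\<lambda>n. LINT x|lborel. \<bar>g (x + h n) - g x\<bar>) \<longlonglongrightarrow> 0" by blast
  from LIMSEQ_D[OF g(3) \<open>e / 3 > 0\<close>] obtain N where
    N: "\<And>n. n \<ge> N \<Longrightarrow> \<bar>LINT x|lborel. \<bar>g (x + h n) - g x\<bar>\<bar> < e / 3" by auto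
  have m[measurable]: "f \<in> borel_measurable borel" "g \<in> borel_measurable borel"
    using f g by auto
  have "norm ((LINT x|lborel. \<bar>f (x + h n) - f x\<bar>) - 0) < e" if "n \<ge> N" for n
  proof -
    have i: "integrable lborel (\<lambda>x. f (x + h n))" "integrable lborel (\<lambda>x. g (x + h n))"
      "integrable lborel (\<lambda>x. \<bar>f (x + h n) - g (x + h n)\<bar>)" "integrable lborel (\<lambda>x. \<bar>f x - g x\<bar>)"
      using translate_integral(2)[OF m(1)] translate_integral(2)[OF m(2)] f g(1) by auto
    have "(LINT x|lborel. \<bar>f (x + h n) - f x\<bar>) \<le>
      (LINT x|lborel. \<bar>f (x + h n) - g (x + h n)\<bar> + \<bar>g (x + h n) - g x\<bar> + \<bar>f x - g x\<bar>)"
      by (rule integral_mono) (use f g(1) i in \<open>auto intro!: integrable_abs\<close>)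
    also have "\<dots> = (LINT x|lborel. \<bar>f (x + h n) - g (x + h n)\<bar>) + (LINT x|lborel. \<bar>g (x + h n) - g x\<bar>) + (LINT x|lborel. \<bar>f x - g x\<bar>)"
      using f g(1) i by (simp add: integrable_abs)
    also have "(LINT x|lborel. \<bar>f (x + h n) - g (x + h n)\<bar>) = (LINT x|lborel. \<bar>f x - g x\<bar>)"
      by (rule translate_integral(1)) measurable
    finally have "(LINT x|lborel. \<bar>f (x + h n) - f x\<bar>) < e"
      using N[OF that] g(2) by linarith
    moreover have "0 \<le> (LINT x|lborel. \<bar>f (x + h n) - f x\<bar>)" by simp
    ultimately show ?thesis by simp
  qed
  then show "\<exists>N. \<forall>n\<ge>N. norm ((LINT x|lborel. \<bar>f (x + h n) - f x\<bar>) - 0) < e" by blast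
qed

text \<open>For an open set the mass lost by a small translation tends to zero by dominated convergence,
  and the mass gained equals the mass lost.\<close>

lemma L1_translation_open:
  fixes h :: "nat \<Rightarrow> real^'n::finite"
  assumes "h \<longlonglongrightarrow> 0" "open U" "emeasure lborel U < \<infinity>"
  shows "(\<lambda>n. LINT x|lborel. \<bar>indicator U (x + h n) - indicator U x :: real\<bar>) \<longlonglongrightarrow> 0"
proof -
  let ?I = "indicator U :: real^'n \<Rightarrow> real"
  have [measurable]: "U \<in> sets borel" using assms(2) by simp
  have iU: "integrable lborel ?I" using assms(3) by (intro integrable_real_indicator) auto
  have iUh: "integrable lborel (\<lambda>x. ?I (x + h n))" for n
    using iU by (subst translate_integral(2)) auto
  have "(\<lambda>n. LINT x|lborel. max (?I x - ?I (x + h n)) 0) \<longlonglongrightarrow> (LINT x|(lborel::(real^'n) measure). 0)"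
  proof (rule integral_dominated_convergence[where w = ?I])
    show "AE x in lborel. (\<lambda>n. max (?I x - ?I (x + h n)) 0) \<longlonglongrightarrow> 0"
    proof (intro AE_I2)
      fix x
      show "(\<lambda>n. max (?I x - ?I (x + h n)) 0) \<longlonglongrightarrow> 0"
      proof (cases "x \<in> U")
        case True
        have "(\<lambda>n. x + h n) \<longlonglongrightarrow> x + 0" by (intro tendsto_intros assms(1))
        then have "\<forall>\<^sub>F n in sequentially. x + h n \<in> U"
          using topological_tendstoD[OF _ assms(2)] True by force
        then show ?thesis
          by (intro tendsto_eventually) (auto elim!: eventually_mono simp: True)
      qed (auto simp: indicator_def)
    qed
    show "AE x in lborel. norm (max (?I x - ?I (x + h n)) 0) \<le> ?I x" for n
      by (auto simp: indicator_def)
  qed (use iU in auto)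
  then have "(\<lambda>n. 2 * (LINT x|lborel. max (?I x - ?I (x + h n)) 0)) \<longlonglongrightarrow> 2 * 0"
    by (intro tendsto_mult_left) simp
  moreover have "2 * (LINT x|lborel. max (?I x - ?I (x + h n)) 0) = (LINT x|lborel. \<bar>?I (x + h n) - ?I x\<bar>)" for n
  proof -
    have "(LINT x|lborel. \<bar>?I (x + h n) - ?I x\<bar>) = (LINT x|lborel. 2 * max (?I x - ?I (x + h n)) 0 + (?I (x + h n) - ?I x))"
      by (intro Bochner_Integration.integral_cong) (auto simp: max_def)
    also have "\<dots> = 2 * (LINT x|lborel. max (?I x - ?I (x + h n)) 0) + ((LINT x|lborel. ?I (x + h n)) - (LINT x|lborel. ?I x))"
      using iU iUh by (subst Bochner_Integration.integral_add) auto
    also have "(LINT x|lborel. ?I (x + h n)) = (LINT x|lborel. ?I x)"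
      by (rule translate_integral(1)) measurable
    finally show ?thesis by simp
  qed
  ultimately show ?thesis by simp
qed

text \<open>Induction over the construction of integrable functions; the base case passes from open
  sets to measurable sets of finite measure by outer regularity.\<close>

lemma L1_translation_continuous:
  fixes f :: "real^'n::finite \<Rightarrow> real" and h :: "nat \<Rightarrow> real^'n"
  assumes "h \<longlonglongrightarrow> 0" "integrable lborel f"
  shows "(\<lambda>n. LINT x|lborel. \<bar>f (x + h n) - f x\<bar>) \<longlonglongrightarrow> 0"
  using assms(2)
proof (induction rule: integrable_induct)
  case (base A c)
  have A[measurable]: "A \<in> sets borel" using base by simp
  have 1: "(\<lambda>n. LINT x|lborel. \<bar>indicator A (x + h n) - indicator A x :: real\<bar>) \<longlonglongrightarrow> 0"
  proof (rule L1_translation_approx)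
    show iA: "integrable lborel (indicator A :: real^'n \<Rightarrow> real)"
      using base by (intro integrable_real_indicator) auto
    fix e :: real assume e: "e > 0"
    obtain U where U: "open U" "A \<subseteq> U" "emeasure lborel (U - A) < e"
      using outer_regular_lborel[OF A e] .
    have [measurable]: "U \<in> sets borel" using U(1) by simp
    have fU: "emeasure lborel U < \<infinity>"
    proof -
      have "emeasure lborel U \<le> emeasure lborel A + emeasure lborel (U - A)"
        using emeasure_subadditive[of A lborel "U - A"] U(2) by (simp add: Un_absorb1)
      also have "\<dots> < \<infinity>" using base U(3) by (auto simp: less_top[symmetric] top_unique)
      finally show ?thesis .
    qed
    have "(LINT x|lborel. \<bar>indicator A x - indicator U x :: real\<bar>) = (LINT x|lborel. indicator (U - A) x)"
      by (intro Bochner_Integration.integral_cong) (use U(2) in \<open>auto simp: indicator_def\<close>)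
    also have "\<dots> \<le> e"
      using U(3) e by (simp add: measure_def enn2real_leI)
    finally show "\<exists>g. integrable lborel g \<and> (LINT x|lborel. \<bar>indicator A x - g x\<bar>) \<le> e \<and>
      (\<lambda>n. LINT x|lborel. \<bar>g (x + h n) - g x\<bar>) \<longlonglongrightarrow> 0"
      using L1_translation_open[OF assms(1) U(1) fU] fU
      by (intro exI[of _ "indicator U"]) (auto intro!: integrable_real_indicator)
  qed
  have "(\<lambda>n. (LINT x|lborel. \<bar>indicator A (x + h n) - indicator A x :: real\<bar>) * \<bar>c\<bar>) \<longlonglongrightarrow> 0"
    using tendsto_mult_left_zero[OF 1] .
  moreover have "\<bar>indicator A (x + h n) *\<^sub>R c - indicator A x *\<^sub>R c\<bar> = \<bar>indicator A (x + h n) - indicator A x\<bar> * \<bar>c\<bar>" for x n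
    by (simp add: abs_mult[symmetric] left_diff_distrib)
  ultimately show ?case by simp
next
  case (add f g)
  note i = translate_integral(2)[OF borel_measurable_integrable[OF add(1), simplified]]
    translate_integral(2)[OF borel_measurable_integrable[OF add(2), simplified]]
  show ?case
  proof (rule tendsto_sandwich[OF _ _ tendsto_const])
    show "(\<lambda>n. (LINT x|lborel. \<bar>f (x + h n) - f x\<bar>) + (LINT x|lborel. \<bar>g (x + h n) - g x\<bar>)) \<longlonglongrightarrow> 0"
      using tendsto_add[OF add(3,4)] by simp
    have "(LINT x|lborel. \<bar>f (x + h n) + g (x + h n) - (f x + g x)\<bar>) \<le>
       (LINT x|lborel. \<bar>f (x + h n) - f x\<bar> + \<bar>g (x + h n) - g x\<bar>)" for n
      by (rule integral_mono) (use add i in auto)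
    also have "\<dots> n = (LINT x|lborel. \<bar>f (x + h n) - f x\<bar>) + (LINT x|lborel. \<bar>g (x + h n) - g x\<bar>)" for n
      using add i by simp
    finally show "\<forall>\<^sub>F n in sequentially. (LINT x|lborel. \<bar>f (x + h n) + g (x + h n) - (f x + g x)\<bar>) \<le>
      (LINT x|lborel. \<bar>f (x + h n) - f x\<bar>) + (LINT x|lborel. \<bar>g (x + h n) - g x\<bar>)"
      by simp
  qed simp
next
  case (lim f s)
  show ?case
  proof (rule L1_translation_approx[OF lim(4)])
    fix e :: real assume e: "e > 0"
    \<comment> \<open>The approximants satisfy \<bar>s i\<bar> \<le> 2 \<bar>f\<bar>, so 3
      \<bar>f\<bar> dominates the differences.\<close>
    have "(\<lambda>i. LINT x|lborel. \<bar>f x - s i x\<bar>) \<longlonglongrightarrow> (LINT x|(lborel::(real^'n) measure). 0)"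
    proof (rule integral_dominated_convergence[where w = "\<lambda>x. 3 * \<bar>f x\<bar>"])
      show "AE x in lborel. (\<lambda>i. \<bar>f x - s i x\<bar>) \<longlonglongrightarrow> 0"
      proof (intro AE_I2)
        fix x
        have "(\<lambda>i. \<bar>f x - s i x\<bar>) \<longlonglongrightarrow> \<bar>f x - f x\<bar>" by (intro tendsto_intros lim(2)) simp
        then show "(\<lambda>i. \<bar>f x - s i x\<bar>) \<longlonglongrightarrow> 0" by simp
      qed
      show "AE x in lborel. norm \<bar>f x - s i x\<bar> \<le> 3 * \<bar>f x\<bar>" for i
      proof (intro AE_I2)
        fix x show "norm \<bar>f x - s i x\<bar> \<le> 3 * \<bar>f x\<bar>" using lim(3)[of x i] by auto
      qed
    qed (use lim(1,4) in auto)
    then have "(\<lambda>i. LINT x|lborel. \<bar>f x - s i x\<bar>) \<longlonglongrightarrow> 0" by simp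
    from LIMSEQ_D[OF this e] obtain i where "\<bar>LINT x|lborel. \<bar>f x - s i x\<bar>\<bar> < e" by auto
    then show "\<exists>g. integrable lborel g \<and> (LINT x|lborel. \<bar>f x - g x\<bar>) \<le> e \<and>
      (\<lambda>n. LINT x|lborel. \<bar>g (x + h n) - g x\<bar>) \<longlonglongrightarrow> 0"
      using lim(1,5) by (intro exI[of _ "s i"]) auto
  qed
qed

text \<open>Reduction to \<open>L\<^sup>1\<close>: \<open>g \<mapsto> g \<bar>g\<bar>\<close> maps \<open>L\<^sup>2\<close> to \<open>L\<^sup>1\<close>.\<close>

lemma sq_diff_le_signed_sq: "(a - b)\<^sup>2 \<le> 2 * \<bar>a * \<bar>a\<bar> - b * \<bar>b\<bar>\<bar>" for a b :: real
proof -
  have le: "z \<le> 2 * \<bar>z\<bar>" for z :: real by linarith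
  have *: "(a - b)\<^sup>2 \<le> 2 * \<bar>a * \<bar>a\<bar> - b * \<bar>b\<bar>\<bar>" if "a \<ge> b" for a b :: real
  proof -
    consider "b \<ge> 0" | "a \<le> 0" | "a \<ge> 0" "b \<le> 0" by linarith
    then show ?thesis
    proof cases
      case 1
      have "(a - b)\<^sup>2 \<le> (a - b) * (a + b)"
        unfolding power2_eq_square by (rule mult_left_mono) (use 1 that in auto)
      also have "\<dots> = a * \<bar>a\<bar> - b * \<bar>b\<bar>" using 1 that by (simp add: algebra_simps)
      also have "\<dots> \<le> 2 * \<bar>a * \<bar>a\<bar> - b * \<bar>b\<bar>\<bar>" by (rule le)
      finally show ?thesis .
    next
      case 2
      have "(a - b)\<^sup>2 \<le> (a - b) * (- a - b)"
        unfolding power2_eq_square by (rule mult_left_mono) (use 2 that in auto)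
      also have "\<dots> = a * \<bar>a\<bar> - b * \<bar>b\<bar>" using 2 that by (simp add: algebra_simps)
      also have "\<dots> \<le> 2 * \<bar>a * \<bar>a\<bar> - b * \<bar>b\<bar>\<bar>" by (rule le)
      finally show ?thesis .
    next
      case 3
      \<comment> \<open>For opposite signs \<open>a * \<bar>a\<bar> - b * \<bar>b\<bar>\<close> is a
        sum of squares; this is the case that requires the factor 2.\<close>
      have "(a - b)\<^sup>2 \<le> 2 * (a\<^sup>2 + b\<^sup>2)"
        using zero_le_power2[of "a + b"] by (simp add: power2_sum power2_diff)
      also have "a\<^sup>2 + b\<^sup>2 = a * \<bar>a\<bar> - b * \<bar>b\<bar>" using 3 by (simp add: power2_eq_square)
      also have "2 * \<dots> \<le> 2 * \<bar>a * \<bar>a\<bar> - b * \<bar>b\<bar>\<bar>"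
        by (intro mult_left_mono abs_ge_self) simp
      finally show ?thesis .
    qed
  qed
  show ?thesis using *[of a b] *[of b a] by (cases "a \<ge> b") (auto simp: power2_commute abs_minus_commute)
qed

lemma L2_translation_continuous:
  fixes g :: "real^'n::finite \<Rightarrow> real" and h :: "nat \<Rightarrow> real^'n"
  assumes "h \<longlonglongrightarrow> 0" "g \<in> L2"
  shows "(\<lambda>n. LINT x|lborel. (g (x + h n) - g x)\<^sup>2) \<longlonglongrightarrow> 0"
proof -
  define G where "G x = g x * \<bar>g x\<bar>" for x
  have gm[measurable]: "g \<in> borel_measurable borel" using assms(2) by (rule L2_measurable)
  have Gm[measurable]: "G \<in> borel_measurable borel" unfolding G_def[abs_def] by measurable
  have G: "integrable lborel G"
    by (rule Bochner_Integration.integrable_bound[OF L2_integrable_sq[OF assms(2)]])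
      (auto simp: G_def abs_mult power2_eq_square)
  show ?thesis
  proof (rule tendsto_sandwich[OF _ _ tendsto_const])
    show "(\<lambda>n. 2 * (LINT x|lborel. \<bar>G (x + h n) - G x\<bar>)) \<longlonglongrightarrow> 0"
      using tendsto_mult_right_zero[OF L1_translation_continuous[OF assms(1) G]] .
    have "(LINT x|lborel. (g (x + h n) - g x)\<^sup>2) \<le> (LINT x|lborel. 2 * \<bar>G (x + h n) - G x\<bar>)" for n
    proof (rule integral_mono)
      show "integrable lborel (\<lambda>x. (g (x + h n) - g x)\<^sup>2)"
        by (rule L2_integrable_sq[OF L2_diff[OF translate_L2[OF assms(2)] assms(2)]])
      show "integrable lborel (\<lambda>x. 2 * \<bar>G (x + h n) - G x\<bar>)"
        using translate_integral(2)[OF Gm] G by auto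
    qed (simp add: G_def sq_diff_le_signed_sq)
    then show "\<forall>\<^sub>F n in sequentially. (LINT x|lborel. (g (x + h n) - g x)\<^sup>2) \<le> 2 * (LINT x|lborel. \<bar>G (x + h n) - G x\<bar>)"
      by simp
  qed simp
qed

text \<open>Cauchy-Schwarz with respect to the measure \<bar>k\<bar> dy, then Tonelli. A constant
  \<theta> gives Young's inequality; the squared norm of a translation difference as \<theta> gives
  convergence of mollifications.\<close>

lemma Minkowski_weighted:
  fixes G :: "real^'n::finite \<Rightarrow> real^'n \<Rightarrow> real"
  assumes [measurable]: "case_prod G \<in> borel_measurable borel" and k: "integrable lborel k"
    and \<theta>: "\<And>y. (\<integral>\<^sup>+x. ennreal ((G x y)\<^sup>2) \<partial>lborel) = ennreal (\<theta> y)" "\<And>y. \<theta> y \<ge> 0"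
      "integrable lborel (\<lambda>y. \<bar>k y\<bar> * \<theta> y)"
    and m: "(\<lambda>x. LINT y|lborel. G x y * k y) \<in> borel_measurable borel"
  shows "(\<lambda>x. LINT y|lborel. G x y * k y) \<in> L2"
    and "(LINT x|lborel. (LINT y|lborel. G x y * k y)\<^sup>2) \<le> (LINT y|lborel. \<bar>k y\<bar>) * (LINT y|lborel. \<bar>k y\<bar> * \<theta> y)"
proof -
  have [measurable]: "k \<in> borel_measurable borel" using k by auto
  have [measurable]: "case_prod G \<in> borel_measurable (lborel \<Otimes>\<^sub>M lborel)"
    using assms(1) by (simp add: lborel_prod)
  have [measurable]: "G x \<in> borel_measurable borel" for x
    using measurable_Pair2[of "case_prod G" lborel lborel borel x] by simp
  define I where "I x = (LINT y|lborel. G x y * k y)" for x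
  have pw: "ennreal ((I x)\<^sup>2) \<le> ennreal (LINT y|lborel. \<bar>k y\<bar>) * (\<integral>\<^sup>+y. ennreal (\<bar>k y\<bar> * (G x y)\<^sup>2) \<partial>lborel)" for x
  proof -
    have "ennreal \<bar>I x\<bar> \<le> (\<integral>\<^sup>+y. ennreal \<bar>G x y * k y\<bar> \<partial>lborel)"
    proof (cases "integrable lborel (\<lambda>y. G x y * k y)")
      case True
      from integral_norm_bound_ennreal[OF this] show ?thesis by (simp add: I_def)
    next
      \<comment> \<open>Where the integrand is not integrable, the value of the integral is 0 by
        convention.\<close>
      case False
      then show ?thesis by (simp add: I_def not_integrable_integral_eq)
    qed
    also have "\<dots> = (\<integral>\<^sup>+y. ennreal (sqrt \<bar>k y\<bar>) * ennreal (sqrt \<bar>k y\<bar> * \<bar>G x y\<bar>) \<partial>lborel)"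
    proof (intro nn_integral_cong)
      fix y
      have "\<bar>G x y * k y\<bar> = sqrt \<bar>k y\<bar> * (sqrt \<bar>k y\<bar> * \<bar>G x y\<bar>)"
      proof -
        have "sqrt \<bar>k y\<bar> * (sqrt \<bar>k y\<bar> * \<bar>G x y\<bar>) = (sqrt \<bar>k y\<bar> * sqrt \<bar>k y\<bar>) * \<bar>G x y\<bar>"
          by (simp only: mult.assoc)
        then show ?thesis by (simp add: abs_mult mult.commute)
      qed
      then show "ennreal \<bar>G x y * k y\<bar> = ennreal (sqrt \<bar>k y\<bar>) * ennreal (sqrt \<bar>k y\<bar> * \<bar>G x y\<bar>)"
        by (simp add: ennreal_mult[symmetric])
    qed
    finally have "(ennreal \<bar>I x\<bar>)\<^sup>2 \<le> (\<integral>\<^sup>+y. ennreal (sqrt \<bar>k y\<bar>) * ennreal (sqrt \<bar>k y\<bar> * \<bar>G x y\<bar>) \<partial>lborel)\<^sup>2"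
      by (rule power_mono) simp
    also have "\<dots> \<le> (\<integral>\<^sup>+y. ennreal (sqrt \<bar>k y\<bar>)^2 \<partial>lborel) * (\<integral>\<^sup>+y. ennreal (sqrt \<bar>k y\<bar> * \<bar>G x y\<bar>)^2 \<partial>lborel)"
      by (rule Cauchy_Schwarz_nn_integral) measurable
    also have "(\<integral>\<^sup>+y. ennreal (sqrt \<bar>k y\<bar>)^2 \<partial>lborel) = (\<integral>\<^sup>+y. ennreal \<bar>k y\<bar> \<partial>lborel)"
      by (intro nn_integral_cong) (simp add: ennreal_power)
    also have "\<dots> = ennreal (LINT y|lborel. \<bar>k y\<bar>)"
      using k by (intro nn_integral_eq_integral) auto
    also have "(\<integral>\<^sup>+y. ennreal (sqrt \<bar>k y\<bar> * \<bar>G x y\<bar>)^2 \<partial>lborel) = (\<integral>\<^sup>+y. ennreal (\<bar>k y\<bar> * (G x y)\<^sup>2) \<partial>lborel)"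
      by (intro nn_integral_cong) (simp add: ennreal_power power_mult_distrib)
    finally show ?thesis by (simp add: ennreal_power)
  qed
  have "(\<integral>\<^sup>+x. ennreal ((I x)\<^sup>2) \<partial>lborel) \<le>
      (\<integral>\<^sup>+x. ennreal (LINT y|lborel. \<bar>k y\<bar>) * (\<integral>\<^sup>+y. ennreal (\<bar>k y\<bar> * (G x y)\<^sup>2) \<partial>lborel) \<partial>lborel)"
    by (intro nn_integral_mono pw)
  also have "\<dots> = ennreal (LINT y|lborel. \<bar>k y\<bar>) * (\<integral>\<^sup>+x. (\<integral>\<^sup>+y. ennreal (\<bar>k y\<bar> * (G x y)\<^sup>2) \<partial>lborel) \<partial>lborel)"
    by (intro nn_integral_cmult) measurable
  also have "(\<integral>\<^sup>+x. (\<integral>\<^sup>+y. ennreal (\<bar>k y\<bar> * (G x y)\<^sup>2) \<partial>lborel) \<partial>lborel)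
     = (\<integral>\<^sup>+y. (\<integral>\<^sup>+x. ennreal (\<bar>k y\<bar> * (G x y)\<^sup>2) \<partial>lborel) \<partial>lborel)"
    by (rule lborel_pair.Fubini'[symmetric]) measurable
  also have "\<dots> = (\<integral>\<^sup>+y. ennreal (\<bar>k y\<bar> * \<theta> y) \<partial>lborel)"
    by (intro nn_integral_cong) (simp add: ennreal_mult \<theta> nn_integral_cmult)
  also have "\<dots> = ennreal (LINT y|lborel. \<bar>k y\<bar> * \<theta> y)"
    using \<theta> by (intro nn_integral_eq_integral) auto
  finally have le: "(\<integral>\<^sup>+x. ennreal ((I x)\<^sup>2) \<partial>lborel) \<le> ennreal ((LINT y|lborel. \<bar>k y\<bar>) * (LINT y|lborel. \<bar>k y\<bar> * \<theta> y))"
    using \<theta>(2) by (simp add: ennreal_mult)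
  have Im[measurable]: "I \<in> borel_measurable borel" using m by (simp add: I_def[abs_def])
  have int: "integrable lborel (\<lambda>x. (I x)\<^sup>2)"
    by (rule integrableI_nonneg) (use le in \<open>auto simp: top_unique less_top[symmetric]\<close>)
  then show "(\<lambda>x. LINT y|lborel. G x y * k y) \<in> L2"
    using Im by (simp add: L2_alt I_def[abs_def])
  have "ennreal (LINT x|lborel. (I x)\<^sup>2) \<le> ennreal ((LINT y|lborel. \<bar>k y\<bar>) * (LINT y|lborel. \<bar>k y\<bar> * \<theta> y))"
    using le int by (subst nn_integral_eq_integral[symmetric]) auto
  then show "(LINT x|lborel. (LINT y|lborel. G x y * k y)\<^sup>2) \<le> (LINT y|lborel. \<bar>k y\<bar>) * (LINT y|lborel. \<bar>k y\<bar> * \<theta> y)"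
    using \<theta>(2) by (subst (asm) ennreal_le_iff) (auto simp: I_def[abs_def] intro!: mult_nonneg_nonneg)
qed

section \<open>Convolution with a band-limited kernel\<close>

text \<open>Chosen to be integrable, square integrable and comparable with its translates by bounded
  vectors, which a Gaussian is not. In one variable it is the square of 1 / sqrt(1 + x^2), the decay
  rate of the cardinal sine.\<close>

definition decay :: "real^'n::finite \<Rightarrow> real" where
  "decay x = (\<Prod>i\<in>UNIV. 1 / (1 + (x $ i)\<^sup>2))"

lemma decay_pos: "decay x > 0"
  unfolding decay_def by (intro prod_pos) (auto intro!: divide_pos_pos add_pos_nonneg)

lemma decay_nonneg [simp]: "decay x \<ge> 0"
  using decay_pos[of x] by simp

lemma decay_le_1: "decay x \<le> 1"
  unfolding decay_def by (intro prod_le_1) (auto simp: divide_le_eq add_pos_nonneg)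

lemma one_plus_sq_pos: "1 + (x::real)\<^sup>2 > 0"
  by (simp add: add_pos_nonneg)

lemma decay_borel [measurable]: "decay \<in> borel_measurable borel"
proof -
  have "continuous_on UNIV (decay :: real^'n \<Rightarrow> real)"
    unfolding decay_def[abs_def]
    by (intro continuous_intros) (auto simp: one_plus_sq_pos[THEN less_imp_neq, symmetric])
  then show ?thesis by (rule borel_measurable_continuous_onI)
qed

lemma nn_integral_inverse_square_finite:
  "(\<integral>\<^sup>+x. ennreal (1 / (1 + x\<^sup>2)) \<partial>lborel) < \<infinity>"
proof -
  have half: "(\<integral>\<^sup>+x. ennreal (1 / (1 + x\<^sup>2)) * indicator {0..} x \<partial>lborel) < \<infinity>"
  proof -
    have "(\<integral>\<^sup>+x. ennreal (1 / (1 + x\<^sup>2)) * indicator {0..} x \<partial>lborel) = pi / 2 - arctan 0"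
      by (rule nn_integral_FTC_atLeast[where F = arctan])
        (auto intro!: derivative_eq_intros tendsto_arctan_at_top simp: one_plus_sq_pos less_imp_le inverse_eq_divide)
    then show ?thesis by simp
  qed
  have "(\<integral>\<^sup>+x. ennreal (1 / (1 + x\<^sup>2)) \<partial>lborel) \<le>
      (\<integral>\<^sup>+x. ennreal (1 / (1 + x\<^sup>2)) * indicator {0..} x + ennreal (1 / (1 + (- x)\<^sup>2)) * indicator {0..} (- x) \<partial>lborel)"
    by (intro nn_integral_mono) (auto simp: indicator_def)
  also have "\<dots> = (\<integral>\<^sup>+x. ennreal (1 / (1 + x\<^sup>2)) * indicator {0..} x \<partial>lborel)
     + (\<integral>\<^sup>+x. ennreal (1 / (1 + (- x)\<^sup>2)) * indicator {0..} (- x) \<partial>lborel)"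
    by (rule nn_integral_add) measurable
  also have "(\<integral>\<^sup>+x. ennreal (1 / (1 + (- x)\<^sup>2)) * indicator {0..} (- x) \<partial>lborel)
     = (\<integral>\<^sup>+x. ennreal (1 / (1 + x\<^sup>2)) * indicator {0..} x \<partial>lborel)"
    using nn_integral_real_affine[of "\<lambda>x. ennreal (1 / (1 + x\<^sup>2)) * indicator {0..} x" "-1" 0] by simp
  finally show ?thesis using half by (auto simp: less_top[symmetric] top_unique)
qed

lemma Basis_vec_range: "(Basis :: (real^'n::finite) set) = range (\<lambda>i. axis i 1)"
  by (auto simp: Basis_vec_def)

lemma prod_Basis: "(\<Prod>b\<in>Basis. f (x \<bullet> b)) = (\<Prod>i\<in>UNIV. f (x $ i))" for x :: "real^'n::finite"
  unfolding Basis_vec_range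
  by (subst prod.reindex) (auto simp: inj_on_def axis_eq_axis inner_axis)

lemma decay_integrable: "integrable lborel (decay :: real^'n::finite \<Rightarrow> real)"
proof (rule integrableI_nonneg)
  have "(\<integral>\<^sup>+x. ennreal (decay x) \<partial>(lborel :: (real^'n) measure)) = (\<integral>\<^sup>+x. (\<Prod>b\<in>Basis. ennreal (1 / (1 + (x \<bullet> b)\<^sup>2))) \<partial>(lborel :: (real^'n) measure))"
    unfolding decay_def prod_Basis[symmetric, where f = "\<lambda>z. 1 / (1 + z\<^sup>2)"]
    by (intro nn_integral_cong prod_ennreal[symmetric]) (simp add: less_imp_le[OF one_plus_sq_pos])
  also have "\<dots> = (\<Prod>b\<in>(Basis :: (real^'n) set). (\<integral>\<^sup>+x. ennreal (1 / (1 + x\<^sup>2)) \<partial>lborel))"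
    by (rule nn_integral_lborel_prod) auto
  also have "\<dots> < \<infinity>"
    using nn_integral_inverse_square_finite by (auto simp: less_top[symmetric] ennreal_prod_eq_top power_eq_top_ennreal)
  finally show "(\<integral>\<^sup>+x. ennreal (decay x) \<partial>(lborel :: (real^'n) measure)) < \<infinity>" .
qed (auto simp: less_imp_le)

lemma decay_L2: "(decay :: real^'n::finite \<Rightarrow> real) \<in> L2"
proof -
  have "integrable lborel (\<lambda>x::real^'n. (decay x)\<^sup>2)"
  proof (rule Bochner_Integration.integrable_bound[OF decay_integrable])
    show "AE x in lborel. norm ((decay x)\<^sup>2) \<le> norm (decay (x :: real^'n))"
      by (simp add: power2_eq_square mult_left_le decay_le_1)
  qed measurable
  then show ?thesis by (simp add: L2_alt)
qed

lemma decay_shift: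
  fixes x h :: "real^'n::finite"
  assumes "norm h \<le> 1"
  shows "decay (x + h) \<le> 3 ^ CARD('n) * decay x"
proof -
  have gen: "b \<le> 1 \<Longrightarrow> a \<le> 2 * q + 2 * b \<Longrightarrow> 0 \<le> q \<Longrightarrow> 1 + a \<le> 3 * (1 + q)" for a b q :: real
    by (simp add: algebra_simps)
  have "1 / (1 + (x $ i + h $ i)\<^sup>2) \<le> 3 * (1 / (1 + (x $ i)\<^sup>2))" for i
  proof -
    have "\<bar>h $ i\<bar> \<le> 1" using component_le_norm_cart[of h i] assms by linarith
    then have h: "(h $ i)\<^sup>2 \<le> 1" by (simp add: abs_square_le_1)
    \<comment> \<open>The two sides differ by the square of \<open>x $ i + 2 * h $ i\<close>;
      together with the bound on \<open>h $ i\<close> this yields the constant 3.\<close>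
    have "(x $ i)\<^sup>2 \<le> 2 * (x $ i + h $ i)\<^sup>2 + 2 * (h $ i)\<^sup>2"
      using zero_le_power2[of "x $ i + 2 * h $ i"] by (simp add: power2_eq_square algebra_simps)
    then have "1 + (x $ i)\<^sup>2 \<le> 3 * (1 + (x $ i + h $ i)\<^sup>2)" 
      by (intro gen[OF h] zero_le_power2)
    then show ?thesis by (simp add: divide_simps one_plus_sq_pos)
  qed
  then have "decay (x + h) \<le> (\<Prod>i\<in>UNIV. 3 * (1 / (1 + (x $ i)\<^sup>2)))"
    unfolding decay_def by (intro prod_mono) (simp add: less_imp_le[OF one_plus_sq_pos])
  also have "\<dots> = 3 ^ CARD('n) * decay x"
    by (simp add: decay_def prod.distrib prod_dividef)
  finally show ?thesis .
qed

lemma decay_scale: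
  assumes "c \<ge> 1" shows "decay (c *\<^sub>R x) \<le> decay x"
proof -
  have "(x $ i)\<^sup>2 \<le> (c * x $ i)\<^sup>2" for i
  proof -
    have "1 * (x $ i)\<^sup>2 \<le> c\<^sup>2 * (x $ i)\<^sup>2" using assms by (intro mult_right_mono) (auto simp: one_le_power)
    then show ?thesis by (simp add: power_mult_distrib)
  qed
  then have "1 / (1 + (c * x $ i)\<^sup>2) \<le> 1 / (1 + (x $ i)\<^sup>2)" for i
    by (intro divide_left_mono mult_pos_pos one_plus_sq_pos) auto
  then show ?thesis unfolding decay_def by (intro prod_mono) (simp add: less_imp_le[OF one_plus_sq_pos])
qed

section \<open>Kernels of exponential type with integrable decay\<close>

definition decaying_kernels :: "(real^'n::finite \<Rightarrow> real) set" where
  "decaying_kernels = {\<kappa>. \<exists>C\<ge>0. \<exists>K\<ge>0. exp_type C K decay \<kappa>}"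

lemma decaying_kernels_smooth: "\<kappa> \<in> decaying_kernels \<Longrightarrow> smooth \<kappa>"
  by (auto simp: decaying_kernels_def exp_type_def)

lemma decaying_kernels_partial: "\<kappa> \<in> decaying_kernels \<Longrightarrow> partial_deriv i \<kappa> \<in> decaying_kernels"
  unfolding decaying_kernels_def using exp_type_partial mult_nonneg_nonneg by (smt (verit) mem_Collect_eq)

lemma decaying_kernels_iter_partial: "\<kappa> \<in> decaying_kernels \<Longrightarrow> iter_partial js \<kappa> \<in> decaying_kernels"
  by (induction js) (auto simp: iter_partial_Cons decaying_kernels_partial)

lemma decaying_kernels_bound:
  assumes "\<kappa> \<in> decaying_kernels"
  obtains C where "C \<ge> 0" "\<And>x. \<bar>\<kappa> x\<bar> \<le> C * decay x"
proof -
  obtain C K where *: "C \<ge> 0" "exp_type C K decay \<kappa>" using assms by (auto simp: decaying_kernels_def)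
  have "\<bar>\<kappa> x\<bar> \<le> C * decay x" for x
    using *(2) unfolding exp_type_def by (metis iter_partial_Nil list.size(3) mult.right_neutral power_0)
  with * that show ?thesis by blast
qed

lemma decaying_kernels_integrable:
  assumes "\<kappa> \<in> decaying_kernels"
  shows "integrable lborel \<kappa>" and "\<kappa> \<in> L2"
proof -
  obtain C where C: "C \<ge> 0" "\<And>x. \<bar>\<kappa> x\<bar> \<le> C * decay x" using decaying_kernels_bound[OF assms] by metis
  have m: "\<kappa> \<in> borel_measurable borel" by (rule smooth_borel[OF decaying_kernels_smooth[OF assms]])
  show "integrable lborel \<kappa>"
    by (rule Bochner_Integration.integrable_bound[OF integrable_mult_right[OF decay_integrable, of C]])
      (use m C in \<open>auto simp: abs_mult\<close>)
  show "\<kappa> \<in> L2"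
    by (rule L2_dominated(1)[OF decay_L2 m, of C]) (use C in auto)
qed

lemma decaying_kernels_smooth_L2: "\<kappa> \<in> decaying_kernels \<Longrightarrow> \<kappa> \<in> smooth_L2"
  by (simp add: smooth_L2_def decaying_kernels_smooth decaying_kernels_integrable decaying_kernels_iter_partial)

text \<open>The remainder carries the weight \<open>decay z\<close> and not merely a constant, so
  that it can be integrated against a square integrable function in a convolution.\<close>

lemma kernel_taylor:
  fixes \<kappa> :: "real^'n::finite \<Rightarrow> real"
  assumes "\<kappa> \<in> decaying_kernels"
  obtains A where "A \<ge> 0" "\<And>z h. norm h \<le> 1 \<Longrightarrow>
    \<bar>\<kappa> (z + h) - \<kappa> z - (\<Sum>i\<in>UNIV. h $ i * partial_deriv i \<kappa> z)\<bar> \<le> A * (norm h)\<^sup>2 * decay z"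
proof -
  obtain C K where ck: "C \<ge> 0" "K \<ge> 0" "exp_type C K decay \<kappa>" using assms by (auto simp: decaying_kernels_def)
  note s = decaying_kernels_smooth[OF assms]
  define N where "N = real CARD('n)"
  \<comment> \<open>One factor N for each of the two sums over coordinates, and
    \<open>3 ^ CARD('n)\<close> from moving the weight from an intermediate point back to z by
    \<open>decay_shift\<close>.\<close>
  define A where "A = N * (N * (C * K\<^sup>2 * 3 ^ CARD('n)))"
  have A: "A \<ge> 0" using ck by (simp add: A_def N_def)
  have "\<bar>\<kappa> (z + h) - \<kappa> z - (\<Sum>i\<in>UNIV. h $ i * partial_deriv i \<kappa> z)\<bar> \<le> A * (norm h)\<^sup>2 * decay z"
    if h: "norm h \<le> 1" for z h
  proof -
    have hi: "\<bar>h $ i\<bar> \<le> norm h" for i by (rule component_le_norm_cart)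
    have d2: "\<bar>partial_deriv j (partial_deriv i \<kappa>) (z + r *\<^sub>R h)\<bar> \<le> C * K\<^sup>2 * 3 ^ CARD('n) * decay z" if "0 \<le> r" "r \<le> 1" for i j r
    proof -
      have "\<bar>iter_partial [j, i] \<kappa> (z + r *\<^sub>R h)\<bar> \<le> C * K ^ length [j, i] * decay (z + r *\<^sub>R h)"
        using ck(3) unfolding exp_type_def by blast
      also have "\<dots> \<le> C * K ^ length [j, i] * (3 ^ CARD('n) * decay z)"
      proof (rule mult_left_mono[OF decay_shift])
        have "r * norm h \<le> 1 * 1" using that h by (intro mult_mono) auto
        then show "norm (r *\<^sub>R h) \<le> 1" using that by simp
      qed (use ck in auto)
      finally show ?thesis by (simp add: iter_partial_Cons power2_eq_square mult_ac)
    qed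
    have d1: "\<bar>partial_deriv i \<kappa> (z + r *\<^sub>R h) - partial_deriv i \<kappa> z\<bar> \<le> norm h * (N * (C * K\<^sup>2 * 3 ^ CARD('n) * decay z))"
      if r: "0 < r" "r < 1" for i r
    proof -
      have "\<exists>q>0. q < r \<and> partial_deriv i \<kappa> (z + r *\<^sub>R h) - partial_deriv i \<kappa> (z + 0 *\<^sub>R h) =
          (r - 0) * (\<Sum>j\<in>UNIV. h $ j * partial_deriv j (partial_deriv i \<kappa>) (z + q *\<^sub>R h))"
        by (rule MVT2) (use r in \<open>auto intro!: DERIV_line smooth_differentiable smooth_partial s\<close>)
      then obtain q where q: "0 < q" "q < r" "partial_deriv i \<kappa> (z + r *\<^sub>R h) - partial_deriv i \<kappa> z =
          r * (\<Sum>j\<in>UNIV. h $ j * partial_deriv j (partial_deriv i \<kappa>) (z + q *\<^sub>R h))" by auto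
      have "\<bar>partial_deriv i \<kappa> (z + r *\<^sub>R h) - partial_deriv i \<kappa> z\<bar> \<le> 1 * \<bar>\<Sum>j\<in>UNIV. h $ j * partial_deriv j (partial_deriv i \<kappa>) (z + q *\<^sub>R h)\<bar>"
        unfolding q(3) abs_mult by (rule mult_right_mono) (use r in auto)
      also have "\<dots> \<le> (\<Sum>j\<in>(UNIV::'n set). norm h * (C * K\<^sup>2 * 3 ^ CARD('n) * decay z))"
        unfolding mult_1
        by (rule order_trans[OF sum_abs], rule sum_mono, unfold abs_mult, rule mult_mono) (use hi d2[of q] q r in auto)
      finally show ?thesis by (simp add: N_def mult_ac)
    qed
    have "\<exists>r>0. r < 1 \<and> \<kappa> (z + 1 *\<^sub>R h) - \<kappa> (z + 0 *\<^sub>R h) = (1 - 0) * (\<Sum>i\<in>UNIV. h $ i * partial_deriv i \<kappa> (z + r *\<^sub>R h))"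
      by (rule MVT2) (auto intro!: DERIV_line smooth_differentiable s)
    then obtain r where r: "0 < r" "r < 1" "\<kappa> (z + h) - \<kappa> z = (\<Sum>i\<in>UNIV. h $ i * partial_deriv i \<kappa> (z + r *\<^sub>R h))" by auto
    have "\<bar>\<kappa> (z + h) - \<kappa> z - (\<Sum>i\<in>UNIV. h $ i * partial_deriv i \<kappa> z)\<bar>
       = \<bar>\<Sum>i\<in>UNIV. h $ i * (partial_deriv i \<kappa> (z + r *\<^sub>R h) - partial_deriv i \<kappa> z)\<bar>"
      unfolding r(3) by (simp add: sum_subtractf right_diff_distrib)
    also have "\<dots> \<le> (\<Sum>i\<in>(UNIV::'n set). norm h * (norm h * (N * (C * K\<^sup>2 * 3 ^ CARD('n) * decay z))))"
      by (rule order_trans[OF sum_abs], rule sum_mono, unfold abs_mult, rule mult_mono) (use hi d1 r in auto)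
    also have "\<dots> = A * (norm h)\<^sup>2 * decay z"
      by (simp add: A_def N_def power2_eq_square mult_ac)
    finally show ?thesis .
  qed
  with A that show ?thesis by blast
qed

section \<open>Convolution\<close>

definition convolve :: "(real^'n::finite \<Rightarrow> real) \<Rightarrow> (real^'n \<Rightarrow> real) \<Rightarrow> real^'n \<Rightarrow> real" where
  "convolve f \<kappa> x = (LINT y|lborel. f y * \<kappa> (x - y))"

lemma reflect_L2: "f \<in> L2 \<Longrightarrow> (\<lambda>y. f (x - y)) \<in> L2"
  using L2_affine[of "-1" f x] by simp

lemma convolve_integrable:
  assumes "f \<in> L2" "\<kappa> \<in> L2" shows "integrable lborel (\<lambda>y. f y * \<kappa> (x - y))"
  by (rule L2_integrable_mult[OF assms(1) reflect_L2[OF assms(2)]])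

text \<open>The weighted Taylor remainder integrates to \<open>A * D * (norm h)\<^sup>2\<close>,
  which yields the total derivative at once, with no limit taken under the integral.\<close>

lemma convolve_has_derivative:
  fixes f \<kappa> :: "real^'n::finite \<Rightarrow> real"
  assumes f: "f \<in> L2" and k: "\<kappa> \<in> decaying_kernels"
  shows "(convolve f \<kappa> has_derivative (\<lambda>h. \<Sum>i\<in>UNIV. h $ i * convolve f (partial_deriv i \<kappa>) x)) (at x)"
proof -
  obtain A where A: "A \<ge> 0" "\<And>z h. norm h \<le> 1 \<Longrightarrow>
    \<bar>\<kappa> (z + h) - \<kappa> z - (\<Sum>i\<in>UNIV. h $ i * partial_deriv i \<kappa> z)\<bar> \<le> A * (norm h)\<^sup>2 * decay z"
    using kernel_taylor[OF k] by blast
  have fm[measurable]: "f \<in> borel_measurable borel" using f by (rule L2_measurable)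
  note kL2 = decaying_kernels_integrable(2)[OF k]
  note ik = convolve_integrable[OF f kL2]
  have ikp: "integrable lborel (\<lambda>y. f y * partial_deriv i \<kappa> (x - y))" for i x
    by (rule convolve_integrable[OF f decaying_kernels_integrable(2)[OF decaying_kernels_partial[OF k]]])
  define D where "D = (LINT y|lborel. \<bar>f y\<bar> * decay (x - y))"
  have iD: "integrable lborel (\<lambda>y. \<bar>f y\<bar> * decay (x - y))"
    using integrable_abs[OF convolve_integrable[OF f decay_L2, of x]] by (simp add: abs_mult)
  have bound: "\<bar>convolve f \<kappa> (x + h) - convolve f \<kappa> x - (\<Sum>i\<in>UNIV. h $ i * convolve f (partial_deriv i \<kappa>) x)\<bar> \<le> A * D * (norm h)\<^sup>2"
    if h: "norm h \<le> 1" for h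
  proof -
    let ?R = "\<lambda>y. f y * \<kappa> (x + h - y) - f y * \<kappa> (x - y) - (\<Sum>i\<in>UNIV. h $ i * (f y * partial_deriv i \<kappa> (x - y)))"
    have iR: "integrable lborel ?R"
      by (intro Bochner_Integration.integrable_diff Bochner_Integration.integrable_sum ik integrable_mult_right ikp)
    have gen: "u * (a - b - (\<Sum>i\<in>UNIV. h $ i * p i)) = u * a - u * b - (\<Sum>i\<in>UNIV. h $ i * (u * p i))" for u a b :: real and p
    proof -
      have "u * (\<Sum>i\<in>UNIV. h $ i * p i) = (\<Sum>i\<in>UNIV. h $ i * (u * p i))"
        unfolding sum_distrib_left by (intro sum.cong) (simp_all add: mult_ac)
      then show ?thesis by (simp only: right_diff_distrib)
    qed
    have eq: "convolve f \<kappa> (x + h) - convolve f \<kappa> x - (\<Sum>i\<in>UNIV. h $ i * convolve f (partial_deriv i \<kappa>) x) = (LINT y|lborel. ?R y)"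
    proof -
      have "(LINT y|lborel. ?R y) = (LINT y|lborel. f y * \<kappa> (x + h - y) - f y * \<kappa> (x - y))
          - (LINT y|lborel. (\<Sum>i\<in>UNIV. h $ i * (f y * partial_deriv i \<kappa> (x - y))))"
        by (intro Bochner_Integration.integral_diff Bochner_Integration.integrable_diff
            Bochner_Integration.integrable_sum ik integrable_mult_right ikp)
      also have "(LINT y|lborel. f y * \<kappa> (x + h - y) - f y * \<kappa> (x - y)) = convolve f \<kappa> (x + h) - convolve f \<kappa> x"
        unfolding convolve_def by (intro Bochner_Integration.integral_diff ik)
      also have "(LINT y|lborel. (\<Sum>i\<in>UNIV. h $ i * (f y * partial_deriv i \<kappa> (x - y)))) =
          (\<Sum>i\<in>UNIV. LINT y|lborel. h $ i * (f y * partial_deriv i \<kappa> (x - y)))"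
        by (intro Bochner_Integration.integral_sum integrable_mult_right ikp)
      also have "\<dots> = (\<Sum>i\<in>UNIV. h $ i * convolve f (partial_deriv i \<kappa>) x)"
        by (simp only: convolve_def integral_mult_right_zero)
      finally show ?thesis by simp
    qed
    have "\<bar>LINT y|lborel. ?R y\<bar> \<le> (LINT y|lborel. \<bar>?R y\<bar>)" by (rule integral_abs_bound)
    also have "\<dots> \<le> (LINT y|lborel. A * (norm h)\<^sup>2 * (\<bar>f y\<bar> * decay (x - y)))"
    proof (rule integral_mono)
      fix y
      have "?R y = f y * (\<kappa> ((x - y) + h) - \<kappa> (x - y) - (\<Sum>i\<in>UNIV. h $ i * partial_deriv i \<kappa> (x - y)))"
      proof -
        have "x + h - y = (x - y) + h" by simp
        then show ?thesis by (simp only: gen)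
      qed
      then have "\<bar>?R y\<bar> = \<bar>f y\<bar> * \<bar>\<kappa> ((x - y) + h) - \<kappa> (x - y) - (\<Sum>i\<in>UNIV. h $ i * partial_deriv i \<kappa> (x - y))\<bar>"
        by (simp only: abs_mult)
      also have "\<dots> \<le> \<bar>f y\<bar> * (A * (norm h)\<^sup>2 * decay (x - y))"
        by (intro mult_left_mono A(2) h) simp
      finally show "\<bar>?R y\<bar> \<le> A * (norm h)\<^sup>2 * (\<bar>f y\<bar> * decay (x - y))" by (simp only: mult_ac)
    qed (use iR iD in auto)
    also have "\<dots> = A * D * (norm h)\<^sup>2"
      by (subst integral_mult_right_zero) (simp add: D_def)
    finally show ?thesis unfolding eq .
  qed
  show ?thesis
    unfolding has_derivative_at
  proof
    show "bounded_linear (\<lambda>h. \<Sum>i\<in>UNIV. h $ i * convolve f (partial_deriv i \<kappa>) x)"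
      by (intro bounded_linear_intros bounded_linear_sum bounded_linear_mult_const bounded_linear_vec_nth)
    have "isCont (\<lambda>h. A * D * norm h) (0 :: real^'n)"
      by (intro continuous_intros)
    from isContD[OF this] have t: "((\<lambda>h. A * D * norm h) \<longlongrightarrow> 0) (at (0 :: real^'n))" by simp
    show "(\<lambda>h. norm (convolve f \<kappa> (x + h) - convolve f \<kappa> x - (\<Sum>i\<in>UNIV. h $ i * convolve f (partial_deriv i \<kappa>) x)) / norm h) \<midarrow>0\<rightarrow> 0"
    proof (rule Lim_null_comparison[OF _ t])
      show "\<forall>\<^sub>F h in at 0. norm (norm (convolve f \<kappa> (x + h) - convolve f \<kappa> x - (\<Sum>i\<in>UNIV. h $ i * convolve f (partial_deriv i \<kappa>) x)) / norm h) \<le> A * D * norm h"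
        unfolding eventually_at
      proof (intro exI[of _ 1] conjI ballI impI)
        fix h :: "real^'n" assume "h \<noteq> 0 \<and> dist h 0 < 1"
        then have h: "norm h \<le> 1" "norm h > 0" by auto
        show "norm (norm (convolve f \<kappa> (x + h) - convolve f \<kappa> x - (\<Sum>i\<in>UNIV. h $ i * convolve f (partial_deriv i \<kappa>) x)) / norm h) \<le> A * D * norm h"
          using bound[OF h(1)] h(2) by (simp add: divide_le_eq power2_eq_square mult.assoc)
      qed simp
    qed
  qed
qed

lemma convolve_partial:
  assumes "f \<in> L2" "\<kappa> \<in> decaying_kernels"
  shows "partial_deriv i (convolve f \<kappa>) = convolve f (partial_deriv i \<kappa>)"
proof
  fix x
  have "(\<Sum>j\<in>UNIV. axis i 1 $ j * convolve f (partial_deriv j \<kappa>) x) = (\<Sum>j\<in>UNIV. if j = i then convolve f (partial_deriv j \<kappa>) x else 0)"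
    by (intro sum.cong) (auto simp: axis_def)
  then show "partial_deriv i (convolve f \<kappa>) x = convolve f (partial_deriv i \<kappa>) x"
    using partial_deriv_eq[OF convolve_has_derivative[OF assms, of x], of i] by simp
qed

lemma convolve_smooth:
  assumes "f \<in> L2" "\<kappa> \<in> decaying_kernels"
  shows "smooth (convolve f \<kappa>)"
  by (rule smooth_coinduct[of _ "convolve f ` decaying_kernels"])
    (use assms(2) convolve_has_derivative[OF assms(1)] in
      \<open>auto simp: differentiable_def convolve_partial[OF assms(1)] decaying_kernels_partial\<close>)

lemma convolve_iter_partial:
  assumes "f \<in> L2" "\<kappa> \<in> decaying_kernels"
  shows "iter_partial js (convolve f \<kappa>) = convolve f (iter_partial js \<kappa>)"
  by (induction js) (use assms in \<open>auto simp: iter_partial_Cons convolve_partial decaying_kernels_iter_partial\<close>)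

lemma convolve_commute:
  fixes f \<kappa> :: "real^'n::finite \<Rightarrow> real"
  assumes [measurable]: "f \<in> borel_measurable borel" "\<kappa> \<in> borel_measurable borel"
  shows "convolve f \<kappa> x = (LINT y|lborel. f (x - y) * \<kappa> y)"
  using integral_lborel_affine(1)[of "-1" "\<lambda>y. f (x - y) * \<kappa> y" x]
  by (simp add: convolve_def)

lemma Young_inequality:
  fixes f \<kappa> :: "real^'n::finite \<Rightarrow> real"
  assumes f: "f \<in> L2" and k: "\<kappa> \<in> decaying_kernels"
  shows "convolve f \<kappa> \<in> L2" and "l2_norm (convolve f \<kappa>) \<le> (LINT y|lborel. \<bar>\<kappa> y\<bar>) * l2_norm f"
proof -
  have fm[measurable]: "f \<in> borel_measurable borel" using f by (rule L2_measurable)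
  have km[measurable]: "\<kappa> \<in> borel_measurable borel" using k smooth_borel decaying_kernels_smooth by blast
  note ki = decaying_kernels_integrable(1)[OF k]
  have c: "convolve f \<kappa> = (\<lambda>x. LINT y|lborel. f (x - y) * \<kappa> y)"
    by (rule ext) (rule convolve_commute, measurable)
  have 1: "(\<integral>\<^sup>+x. ennreal ((f (x - y))\<^sup>2) \<partial>lborel) = ennreal ((l2_norm f)\<^sup>2)" for y
  proof -
    have "(\<integral>\<^sup>+x. ennreal ((f (x - y))\<^sup>2) \<partial>lborel) = ennreal (LINT x|lborel. (f (x + (- y)))\<^sup>2)"
      using L2_integrable_sq[OF translate_L2[OF f, of "-y"]] by (subst nn_integral_eq_integral) auto
    also have "(LINT x|lborel. (f (x + (- y)))\<^sup>2) = (LINT x|lborel. (f x)\<^sup>2)"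
      by (rule translate_integral(1)) measurable
    finally show ?thesis by (simp add: l2_norm_sq)
  qed
  have m: "(\<lambda>x. LINT y|lborel. f (x - y) * \<kappa> y) \<in> borel_measurable borel"
    unfolding c[symmetric] by (rule smooth_borel[OF convolve_smooth[OF f k]])
  have gm: "case_prod (\<lambda>x y. f (x - y)) \<in> borel_measurable borel"
    unfolding borel_prod[symmetric] by measurable
  note M = Minkowski_weighted[OF gm ki 1 _ _ m]
  show "convolve f \<kappa> \<in> L2" unfolding c by (rule M(1)) (use ki in auto)
  have "(l2_norm (convolve f \<kappa>))\<^sup>2 \<le> (LINT y|lborel. \<bar>\<kappa> y\<bar>) * (LINT y|lborel. \<bar>\<kappa> y\<bar> * (l2_norm f)\<^sup>2)"
    unfolding l2_norm_sq[of "convolve f \<kappa>"] unfolding c by (rule M(2)) (use ki in auto)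
  also have "\<dots> = ((LINT y|lborel. \<bar>\<kappa> y\<bar>) * l2_norm f)\<^sup>2"
    by (simp add: power2_eq_square mult_ac)
  finally show "l2_norm (convolve f \<kappa>) \<le> (LINT y|lborel. \<bar>\<kappa> y\<bar>) * l2_norm f"
    by (rule power2_le_imp_le) simp
qed

text \<open>In terms of the Fourier transform, the square integrable functions with bounded
  spectrum. The formulation by derivatives is the one from which the growth of the powers of
  \<open>ellop\<close> is read off.\<close>

definition bandlimited :: "(real^'n::finite \<Rightarrow> real) set" where
  "bandlimited = {f. smooth f \<and> (\<exists>C\<ge>0. \<exists>K\<ge>0. \<forall>js. iter_partial js f \<in> L2 \<and>
      l2_norm (iter_partial js f) \<le> C * K ^ length js)}"

lemma bandlimited_smooth_L2: "f \<in> bandlimited \<Longrightarrow> f \<in> smooth_L2"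
  by (auto simp: bandlimited_def smooth_L2_def)

text \<open>All derivatives fall on the kernel; of f only the \<open>L\<^sup>2\<close> norm
  enters.\<close>

lemma convolve_bandlimited:
  fixes f \<kappa> :: "real^'n::finite \<Rightarrow> real"
  assumes f: "f \<in> L2" and k: "\<kappa> \<in> decaying_kernels"
  shows "convolve f \<kappa> \<in> bandlimited"
proof -
  obtain C K where ck: "C \<ge> 0" "K \<ge> 0" "exp_type C K decay \<kappa>" using k by (auto simp: decaying_kernels_def)
  define W where "W = (LINT y|lborel. decay (y :: real^'n))"
  have W: "W \<ge> 0" by (simp add: W_def)
  have "l2_norm (iter_partial js (convolve f \<kappa>)) \<le> C * W * l2_norm f * K ^ length js" for js
  proof -
    have "l2_norm (iter_partial js (convolve f \<kappa>)) \<le> (LINT y|lborel. \<bar>iter_partial js \<kappa> y\<bar>) * l2_norm f"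
      unfolding convolve_iter_partial[OF f k] by (rule Young_inequality(2)[OF f decaying_kernels_iter_partial[OF k]])
    also have "\<dots> \<le> (C * K ^ length js * W) * l2_norm f"
    proof (rule mult_right_mono)
      have "(LINT y|lborel. \<bar>iter_partial js \<kappa> y\<bar>) \<le> (LINT y|lborel. C * K ^ length js * decay (y :: real^'n))"
        by (rule integral_mono)
          (use ck decaying_kernels_integrable(1)[OF decaying_kernels_iter_partial[OF k]] decay_integrable in
            \<open>auto simp: exp_type_def\<close>)
      then show "(LINT y|lborel. \<bar>iter_partial js \<kappa> y\<bar>) \<le> C * K ^ length js * W" by (simp add: W_def)
    qed simp
    finally show ?thesis by (simp add: mult_ac)
  qed
  moreover have "iter_partial js (convolve f \<kappa>) \<in> L2" for js
    unfolding convolve_iter_partial[OF f k] by (rule Young_inequality(1)[OF f decaying_kernels_iter_partial[OF k]])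
  moreover have "C * W * l2_norm f \<ge> 0" using ck W by simp
  ultimately show ?thesis using convolve_smooth[OF f k] ck(2) unfolding bandlimited_def by blast
qed

text \<open>The p-th derivative of sin x / x, written as the integral of cos(s x) over [0, 1]. This
  form has no singularity at 0, and each differentiation only multiplies by s \<le> 1 and shifts the
  phase by a quarter period.\<close>

definition sinc_deriv :: "nat \<Rightarrow> real \<Rightarrow> real" where
  "sinc_deriv p x = integral (cbox 0 1) (\<lambda>s. s ^ p * cos (s * x + p * (pi / 2)))"

lemma sinc_deriv_DERIV: "(sinc_deriv p has_real_derivative sinc_deriv (Suc p) x) (at x)"
proof -
  have D: "((\<lambda>x. integral (cbox 0 1) (\<lambda>s. s ^ p * cos (s * x + p * (pi / 2)))) has_real_derivative
      integral (cbox 0 1) (\<lambda>s. s ^ p * (- sin (s * x + p * (pi / 2)) * s))) (at x within UNIV)"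
  proof (rule leibniz_rule_field_derivative)
    show "continuous_on (UNIV \<times> cbox (0::real) 1) (\<lambda>(x, s). s ^ p * (- sin (s * x + p * (pi / 2)) * s))"
      by (auto simp: split_beta intro!: continuous_intros)
    show "(\<lambda>s. s ^ p * cos (s * y + p * (pi / 2))) integrable_on cbox 0 1" for y :: real
      by (intro integrable_continuous continuous_intros)
  qed (auto intro!: derivative_eq_intros)
  have e: "s ^ p * (- sin (s * x + p * (pi / 2)) * s) = s ^ Suc p * cos (s * x + Suc p * (pi / 2))" for s
  proof -
    have "s * x + Suc p * (pi / 2) = (s * x + p * (pi / 2)) + pi / 2" by (simp add: algebra_simps add_divide_distrib)
    then have "cos (s * x + Suc p * (pi / 2)) = - sin (s * x + p * (pi / 2))"
      using minus_sin_cos_eq[of "s * x + p * (pi / 2)"] by (simp only: of_real_eq_id id_apply)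
    then show ?thesis by simp
  qed
  show ?thesis unfolding sinc_deriv_def[abs_def] using D unfolding e .
qed

lemma unit_interval_integral_bound:
  fixes g :: "real \<Rightarrow> real"
  assumes "continuous_on {0..1} g" "\<And>s. 0 \<le> s \<Longrightarrow> s \<le> 1 \<Longrightarrow> \<bar>g s\<bar> \<le> B"
  shows "\<bar>integral (cbox 0 1) g\<bar> \<le> B"
proof -
  have "norm (integral (cbox 0 1) g) \<le> integral (cbox 0 (1::real)) (\<lambda>s. B)"
    by (rule integral_norm_bound_integral)
      (use assms in \<open>auto intro: integrable_continuous_interval simp: cbox_interval integrable_const_ivl\<close>)
  then show ?thesis by simp
qed

lemma sinc_deriv_bounds: "\<bar>sinc_deriv p x\<bar> \<le> 1" "\<bar>x * sinc_deriv p x\<bar> \<le> 1 + p"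
proof -
  show "\<bar>sinc_deriv p x\<bar> \<le> 1"
    unfolding sinc_deriv_def
    by (rule unit_interval_integral_bound)
      (auto intro!: continuous_intros simp: abs_mult power_abs[symmetric] intro: mult_le_one power_le_one)
  \<comment> \<open>Integrating F' over [0, 1] brings out the factor x; g is the part of F' that
    comes from s^p. For p = 0 the truncated exponent \<open>p - 1\<close> is harmless because g has
    the factor p.\<close>
  define F where "F s = s ^ p * sin (s * x + p * (pi / 2))" for s :: real
  define g where "g s = real p * s ^ (p - 1) * sin (s * x + p * (pi / 2))" for s :: real
  have gc: "continuous_on {0..1} g" unfolding g_def by (intro continuous_intros)
  have "((\<lambda>s. g s + x * (s ^ p * cos (s * x + p * (pi / 2)))) has_integral (F 1 - F 0)) {0..1}"
    by (rule fundamental_theorem_of_calculus)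
      (auto simp: F_def g_def has_real_derivative_iff_has_vector_derivative[symmetric] algebra_simps
        intro!: derivative_eq_intros)
  moreover have "((\<lambda>s. g s + x * (s ^ p * cos (s * x + p * (pi / 2)))) has_integral
      (integral (cbox 0 1) g + x * sinc_deriv p x)) {0..1}"
    unfolding sinc_deriv_def
    by (intro has_integral_add has_integral_mult_right)
      (use gc in \<open>auto simp: integrable_continuous_interval intro!: integrable_integral integrable_continuous_interval continuous_intros\<close>)
  ultimately have eq: "integral (cbox 0 1) g + x * sinc_deriv p x = F 1 - F 0" by (metis has_integral_unique)
  have "F 0 = 0" by (cases p) (auto simp: F_def)
  moreover have "\<bar>F 1\<bar> \<le> 1" by (simp add: F_def)
  moreover have "\<bar>integral (cbox 0 1) g\<bar> \<le> real p"
  proof (rule unit_interval_integral_bound[OF gc])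
    fix s :: real assume s: "0 \<le> s" "s \<le> 1"
    have "\<bar>g s\<bar> = real p * (s ^ (p - 1) * \<bar>sin (s * x + p * (pi / 2))\<bar>)"
      using s by (simp add: g_def abs_mult)
    also have "\<dots> \<le> real p * 1"
      using s by (intro mult_left_mono mult_le_one power_le_one) auto
    finally show "\<bar>g s\<bar> \<le> real p" by simp
  qed
  ultimately show "\<bar>x * sinc_deriv p x\<bar> \<le> 1 + p" using eq by linarith
qed

text \<open>The factor 1 + p of the previous bound is relaxed to 2^p, the form that
  \<open>exp_type\<close> can express; sqrt 2 comes from adding the squared bounds for the function
  and for x times the function.\<close>

lemma sinc_deriv_decay: "\<bar>sinc_deriv p x\<bar> \<le> sqrt 2 * 2 ^ p * (1 / sqrt (1 + x\<^sup>2))"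
proof -
  have p: "1 + real p \<le> 2 ^ p" by (induction p) auto
  have eq: "(sinc_deriv p x)\<^sup>2 * (1 + x\<^sup>2) = (sinc_deriv p x)\<^sup>2 + (x * sinc_deriv p x)\<^sup>2"
    by (simp add: algebra_simps power_mult_distrib)
  have "(sinc_deriv p x)\<^sup>2 \<le> 1" using sinc_deriv_bounds(1)[of p x] by (simp add: abs_square_le_1)
  moreover have "(x * sinc_deriv p x)\<^sup>2 \<le> (2 ^ p)\<^sup>2"
    using sinc_deriv_bounds(2)[of x p] p by (intro power2_le_iff_abs_le[THEN iffD2]) auto
  moreover have "(1::real) \<le> (2 ^ p)\<^sup>2" by (simp add: one_le_power)
  ultimately have "(sinc_deriv p x)\<^sup>2 * (1 + x\<^sup>2) \<le> 2 * (2 ^ p)\<^sup>2"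
    unfolding eq by linarith
  then have "sqrt ((sinc_deriv p x)\<^sup>2 * (1 + x\<^sup>2)) \<le> sqrt (2 * (2 ^ p)\<^sup>2)" by (rule real_sqrt_le_mono)
  then show ?thesis using one_plus_sq_pos[of x] by (simp add: real_sqrt_mult pos_le_divide_eq)
qed

lemma sinc_0: "sinc_deriv 0 0 = 1"
  by (simp add: sinc_deriv_def)

text \<open>A Fejer kernel. The cardinal sine itself decays too slowly to be integrable; its square
  decays like \<open>decay\<close>, is nonnegative and is still of exponential type.\<close>

definition raw_kernel :: "real^'n::finite \<Rightarrow> real" where
  "raw_kernel x = (\<Prod>i\<in>UNIV. sinc_deriv 0 (x $ i) * sinc_deriv 0 (x $ i))"

lemma raw_kernel_decaying: "(raw_kernel :: real^'n::finite \<Rightarrow> real) \<in> decaying_kernels"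
proof -
  define w where "w i x = 1 / sqrt (1 + (x $ i)\<^sup>2)" for i and x :: "real^'n"
  have w: "w i x \<ge> 0" for i x by (simp add: w_def)
  have "exp_type (sqrt 2) 2 (w i) (\<lambda>x::real^'n. sinc_deriv 0 (x $ i))" for i
    unfolding exp_type_def
  proof (intro conjI allI)
    show "smooth (\<lambda>x::real^'n. sinc_deriv 0 (x $ i))"
      by (rule coordinate_function(1)) (rule sinc_deriv_DERIV)
    fix js and x :: "real^'n"
    show "\<bar>iter_partial js (\<lambda>x::real^'n. sinc_deriv 0 (x $ i)) x\<bar> \<le> sqrt 2 * 2 ^ length js * w i x"
      using coordinate_function(2)[of sinc_deriv js 0 i] sinc_deriv_DERIV sinc_deriv_decay[of "length js" "x $ i"] w[of i x]
      by (auto simp: w_def)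
  qed
  then have "exp_type (sqrt 2 * sqrt 2) (2 + 2) (\<lambda>x. w i x * w i x) (\<lambda>x::real^'n. sinc_deriv 0 (x $ i) * sinc_deriv 0 (x $ i))" for i
    by (intro exp_type_mult) (auto simp: w)
  then have "exp_type ((sqrt 2 * sqrt 2) ^ card (UNIV :: 'n set)) ((2 + 2) * real (card (UNIV :: 'n set))) (\<lambda>x. \<Prod>i\<in>UNIV. w i x * w i x)
      (\<lambda>x::real^'n. \<Prod>i\<in>UNIV. sinc_deriv 0 (x $ i) * sinc_deriv 0 (x $ i))"
    by (intro exp_type_prod) (auto simp: w)
  moreover have "(\<lambda>x. \<Prod>i\<in>UNIV. w i x * w i x) = decay"
    by (rule ext) (simp add: decay_def w_def real_sqrt_mult[symmetric] less_imp_le[OF one_plus_sq_pos])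
  ultimately have "exp_type ((sqrt 2 * sqrt 2) ^ card (UNIV :: 'n set)) ((2 + 2) * real (card (UNIV :: 'n set))) decay (raw_kernel :: real^'n \<Rightarrow> real)"
    by (simp add: raw_kernel_def[abs_def])
  then show ?thesis unfolding decaying_kernels_def
    by (intro CollectI exI[of _ "(sqrt 2 * sqrt 2) ^ card (UNIV :: 'n set)"] conjI exI[of _ "(2 + 2) * real (card (UNIV :: 'n set))"]) auto
qed

text \<open>With zero integral the kernel would vanish off a null set, but the set where it is
  nonzero is open and contains the origin.\<close>

lemma raw_kernel_integral_pos: "(LINT x|lborel. raw_kernel (x :: real^'n::finite)) > 0"
proof (rule ccontr)
  have nn: "raw_kernel x \<ge> 0" for x :: "real^'n" by (auto simp: raw_kernel_def intro!: prod_nonneg)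
  assume "\<not> ?thesis"
  moreover have "(LINT x|lborel. raw_kernel (x :: real^'n)) \<ge> 0" using nn by simp
  ultimately have "(LINT x|lborel. raw_kernel (x :: real^'n)) = 0" by linarith
  then have "AE x in lborel. raw_kernel (x :: real^'n) = 0"
    using integral_nonneg_eq_0_iff_AE[OF decaying_kernels_integrable(1)[OF raw_kernel_decaying]] nn by auto
  moreover have s: "smooth (raw_kernel :: real^'n \<Rightarrow> real)"
    by (rule decaying_kernels_smooth[OF raw_kernel_decaying])
  ultimately have "{x :: real^'n. raw_kernel x \<noteq> 0} \<in> null_sets lborel"
    using smooth_borel[OF s] AE_iff_null_sets[of "{x :: real^'n. raw_kernel x \<noteq> 0}" lborel] by auto
  then have "negligible {x :: real^'n. raw_kernel x \<noteq> 0}"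
    by (simp add: negligible_iff_null_sets null_sets_completionI)
  moreover have "open {x :: real^'n. raw_kernel x \<noteq> 0}"
    by (rule open_Collect_neq) (use smooth_continuous[OF s] in auto)
  moreover have "raw_kernel (0 :: real^'n) \<noteq> 0" by (simp add: raw_kernel_def sinc_0)
  ultimately show False using open_not_negligible by blast
qed

definition sinc_kernel :: "real^'n::finite \<Rightarrow> real" where
  "sinc_kernel x = (1 / (LINT x|lborel. raw_kernel (x :: real^'n))) * raw_kernel x"

lemma sinc_kernel_decaying: "(sinc_kernel :: real^'n::finite \<Rightarrow> real) \<in> decaying_kernels"
proof -
  define c where "c = 1 / (LINT x|lborel. raw_kernel (x :: real^'n))"
  have c: "c > 0" using raw_kernel_integral_pos by (simp add: c_def)
  obtain C K where ck: "C \<ge> 0" "K \<ge> 0" "exp_type C K decay (raw_kernel :: real^'n \<Rightarrow> real)"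
    using raw_kernel_decaying by (auto simp: decaying_kernels_def)
  have "exp_type (c * C) K decay (\<lambda>x :: real^'n. c * raw_kernel x)"
    using ck(3) c by (auto simp: exp_type_def iter_partial_cmult abs_mult mult.assoc)
  moreover have "c * C \<ge> 0" using c ck by simp
  ultimately show ?thesis using ck(2)
    unfolding decaying_kernels_def sinc_kernel_def[abs_def] c_def[symmetric] by blast
qed

lemma sinc_kernel_integral: "(LINT x|lborel. sinc_kernel (x :: real^'n::finite)) = 1"
  using raw_kernel_integral_pos[where 'n = 'n] by (simp add: sinc_kernel_def)

text \<open>The kernel of mass one at scale 1 / (n + 1). The summand 0 brings the argument into the
  form of the affine substitution lemmas.\<close>

definition mollifier :: "nat \<Rightarrow> real^'n::finite \<Rightarrow> real" where
  "mollifier n x = real (Suc n) ^ CARD('n) * sinc_kernel (real (Suc n) *\<^sub>R x + 0)"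

lemma mollifier_decaying: "(mollifier n :: real^'n::finite \<Rightarrow> real) \<in> decaying_kernels"
proof -
  define c where "c = real (Suc n)"
  have c: "c \<ge> 1" by (simp add: c_def)
  obtain C K where ck: "C \<ge> 0" "K \<ge> 0" "exp_type C K decay (sinc_kernel :: real^'n \<Rightarrow> real)"
    using sinc_kernel_decaying by (auto simp: decaying_kernels_def)
  have s: "smooth (sinc_kernel :: real^'n \<Rightarrow> real)" by (rule decaying_kernels_smooth[OF sinc_kernel_decaying])
  have "exp_type (c ^ CARD('n) * C) (c * K) decay (mollifier n :: real^'n \<Rightarrow> real)"
    unfolding exp_type_def
  proof (intro conjI allI)
    show "smooth (mollifier n :: real^'n \<Rightarrow> real)"
      unfolding mollifier_def[abs_def] by (intro smooth_cmult smooth_affine s)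
    fix js and x :: "real^'n"
    have "\<bar>iter_partial js sinc_kernel (c *\<^sub>R x + 0)\<bar> \<le> C * K ^ length js * decay (c *\<^sub>R x + 0)"
      using ck(3) unfolding exp_type_def by blast
    also have "\<dots> \<le> C * K ^ length js * decay x"
      by (rule mult_left_mono) (use decay_scale[OF c, of x] ck in auto)
    finally have k: "\<bar>iter_partial js sinc_kernel (c *\<^sub>R x + 0)\<bar> \<le> C * K ^ length js * decay x" .
    have "iter_partial js (mollifier n) x = c ^ CARD('n) * (c ^ length js * iter_partial js sinc_kernel (c *\<^sub>R x + 0))"
      unfolding mollifier_def[abs_def] c_def[symmetric]
      by (simp only: iter_partial_cmult[OF smooth_affine[OF s]] iter_partial_affine[OF s])
    then have "\<bar>iter_partial js (mollifier n) x\<bar> = c ^ CARD('n) * (c ^ length js * \<bar>iter_partial js sinc_kernel (c *\<^sub>R x + 0)\<bar>)"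
      using c by (simp add: abs_mult)
    also have "\<dots> \<le> c ^ CARD('n) * (c ^ length js * (C * K ^ length js * decay x))"
      using k c by (intro mult_left_mono) auto
    finally show "\<bar>iter_partial js (mollifier n) x\<bar> \<le> c ^ CARD('n) * C * (c * K) ^ length js * decay x"
      by (simp add: power_mult_distrib mult_ac)
  qed
  moreover have "c ^ CARD('n) * C \<ge> 0" "c * K \<ge> 0" using c ck by auto
  ultimately show ?thesis unfolding decaying_kernels_def by blast
qed

definition mollify :: "nat \<Rightarrow> (real^'n::finite \<Rightarrow> real) \<Rightarrow> real^'n \<Rightarrow> real" where
  "mollify n g = convolve g (mollifier n)"

text \<open>The substitution moves the scale into the argument of g and leaves a fixed kernel, as
  needed for dominated convergence.\<close>

lemma mollify_eq:
  fixes g :: "real^'n::finite \<Rightarrow> real"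
  assumes "g \<in> L2"
  shows "mollify n g x = (LINT y|lborel. g (x + (- inverse (real (Suc n))) *\<^sub>R y) * sinc_kernel y)"
proof -
  define c where "c = real (Suc n)"
  have c: "c > 0" by (simp add: c_def)
  have [measurable]: "g \<in> borel_measurable borel" "(sinc_kernel :: real^'n \<Rightarrow> real) \<in> borel_measurable borel"
    using L2_measurable[OF assms] smooth_borel[OF decaying_kernels_smooth[OF sinc_kernel_decaying]] by auto
  have "mollify n g x = (LINT y|lborel. g (x - y) * mollifier n y)"
    unfolding mollify_def
    by (rule convolve_commute) (use smooth_borel[OF decaying_kernels_smooth[OF mollifier_decaying]] in auto)
  also have "\<dots> = c ^ CARD('n) * (LINT y|lborel. g (x - y) * sinc_kernel (c *\<^sub>R y))"
    by (subst integral_mult_right_zero[symmetric]) (simp add: mollifier_def c_def[symmetric] mult_ac del: of_nat_Suc)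
  also have "(LINT y|lborel. g (x - y) * sinc_kernel (c *\<^sub>R y)) =
      (LINT y|lborel. (\<lambda>z. g (x + (- inverse c) *\<^sub>R z) * sinc_kernel z) (0 + c *\<^sub>R y))"
    using c by simp
  also have "\<dots> = (LINT z|lborel. g (x + (- inverse c) *\<^sub>R z) * sinc_kernel z) / \<bar>c\<bar> ^ CARD('n)"
    by (rule integral_lborel_affine(1)) (use c in auto)
  finally show ?thesis using c by (simp add: c_def[symmetric] del: of_nat_Suc)
qed

lemma mollify_L2: "g \<in> L2 \<Longrightarrow> mollify n g \<in> L2"
  unfolding mollify_def by (rule Young_inequality(1)[OF _ mollifier_decaying])

lemma mollify_bandlimited: "g \<in> L2 \<Longrightarrow> mollify n g \<in> bandlimited"
  unfolding mollify_def by (rule convolve_bandlimited[OF _ mollifier_decaying])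

text \<open>The deviation is an average of translation differences of g against the fixed kernel.
  For each y these tend to zero in \<open>L\<^sup>2\<close>, and their squared norms are at most 4
  times that of g.\<close>

lemma mollify_tendsto:
  fixes g :: "real^'n::finite \<Rightarrow> real"
  assumes g: "g \<in> L2"
  shows "(\<lambda>n. l2_norm (\<lambda>x. mollify n g x - g x)) \<longlonglongrightarrow> 0"
proof -
  define c where "c n = - inverse (real (Suc n))" for n
  have "c = (\<lambda>n. - inverse (real (Suc n)))" by (rule ext) (simp only: c_def)
  then have c0: "c \<longlonglongrightarrow> 0"
    using tendsto_minus[OF LIMSEQ_inverse_real_of_nat] by (simp only: minus_zero)
  have c: "c n \<noteq> 0" for n by (simp add: c_def)
  let ?k = "sinc_kernel :: real^'n \<Rightarrow> real"
  have gm[measurable]: "g \<in> borel_measurable borel" using L2_measurable[OF g] .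
  have km[measurable]: "?k \<in> borel_measurable borel"
    using smooth_borel[OF decaying_kernels_smooth[OF sinc_kernel_decaying]] .
  note ki = decaying_kernels_integrable(1)[OF sinc_kernel_decaying] and kL2 = decaying_kernels_integrable(2)[OF sinc_kernel_decaying]
  define G where "G n x y = g (x + c n *\<^sub>R y) - g x" for n x y
  define \<theta> where "\<theta> n y = (LINT x|lborel. (G n x y)\<^sup>2)" for n y
  have GL2: "(\<lambda>x. G n x y) \<in> L2" for n y
    unfolding G_def by (intro L2_diff translate_L2 g)
  have \<theta>nn: "\<theta> n y \<ge> 0" for n y by (simp add: \<theta>_def)
  have \<theta>le: "\<theta> n y \<le> 4 * (l2_norm g)\<^sup>2" for n y
  proof -
    have "l2_norm (\<lambda>x. G n x y) \<le> l2_norm (\<lambda>x. g (x + c n *\<^sub>R y)) + l2_norm g"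
      unfolding G_def by (intro l2_norm_triangle_diff translate_L2 g)
    also have "l2_norm (\<lambda>x. g (x + c n *\<^sub>R y)) = l2_norm g"
      unfolding l2_norm_def by (subst translate_integral(1)[of "\<lambda>x. (g x)\<^sup>2"]) auto
    finally have "(l2_norm (\<lambda>x. G n x y))\<^sup>2 \<le> (2 * l2_norm g)\<^sup>2" by (intro power_mono) auto
    then show ?thesis by (simp add: \<theta>_def l2_norm_sq[symmetric] power_mult_distrib)
  qed
  have Gm: "case_prod (G n) \<in> borel_measurable borel" for n
    unfolding borel_prod[symmetric] G_def[abs_def] by measurable
  then have Gm2: "case_prod (G n) \<in> borel_measurable (lborel \<Otimes>\<^sub>M lborel)" for n
    by (simp add: lborel_prod)
  have "(\<lambda>y. LINT x|lborel. (\<lambda>(y, x). (G n x y)\<^sup>2) (y, x)) \<in> borel_measurable lborel" for n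
  proof (rule lborel.borel_measurable_lebesgue_integral)
    have "(\<lambda>p. (case_prod (G n) (snd p, fst p))\<^sup>2) \<in> borel_measurable (lborel \<Otimes>\<^sub>M lborel)"
      using Gm2[of n] by measurable
    then show "(\<lambda>(x, y). (\<lambda>(y, x). (G n x y)\<^sup>2) (x, y)) \<in> borel_measurable (lborel \<Otimes>\<^sub>M lborel)"
      by (simp add: split_beta')
  qed
  then have \<theta>m[measurable]: "\<theta> n \<in> borel_measurable borel" for n by (simp add: \<theta>_def[abs_def])
  have i1: "integrable lborel (\<lambda>y. \<bar>?k y\<bar> * \<theta> n y)" for n
    by (rule Bochner_Integration.integrable_bound[OF integrable_mult_left[OF integrable_abs[OF ki], of "4 * (l2_norm g)\<^sup>2"]])
      (use \<theta>nn \<theta>le in \<open>auto simp: abs_mult intro!: mult_left_mono\<close>)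
  have diff: "mollify n g x - g x = (LINT y|lborel. G n x y * ?k y)" for n x
  proof -
    have "integrable lborel (\<lambda>y. g (x + c n *\<^sub>R y) * ?k y)"
      by (rule L2_integrable_mult[OF L2_affine[OF c g] kL2])
    then have "(LINT y|lborel. G n x y * ?k y) = (LINT y|lborel. g (x + c n *\<^sub>R y) * ?k y) - (LINT y|lborel. g x * ?k y)"
      unfolding G_def left_diff_distrib by (rule Bochner_Integration.integral_diff) (intro integrable_mult_right ki)
    then show ?thesis using mollify_eq[OF g, of n x] by (simp add: c_def sinc_kernel_integral)
  qed
  have bnd: "(LINT x|lborel. (mollify n g x - g x)\<^sup>2) \<le> (LINT y|lborel. \<bar>?k y\<bar>) * (LINT y|lborel. \<bar>?k y\<bar> * \<theta> n y)" for n
    unfolding diff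
  proof (rule Minkowski_weighted(2)[OF Gm ki])
    show "(\<integral>\<^sup>+x. ennreal ((G n x y)\<^sup>2) \<partial>lborel) = ennreal (\<theta> n y)" for y
      unfolding \<theta>_def using L2_integrable_sq[OF GL2] by (intro nn_integral_eq_integral) auto
    show "(\<lambda>x. LINT y|lborel. G n x y * ?k y) \<in> borel_measurable borel"
      unfolding diff[symmetric] using L2_measurable[OF mollify_L2[OF g, of n]] by auto
  qed (use \<theta>nn i1 in auto)
  have "(\<lambda>n. LINT y|lborel. \<bar>?k y\<bar> * \<theta> n y) \<longlonglongrightarrow> (LINT y|(lborel :: (real^'n) measure). 0)"
  proof (rule integral_dominated_convergence[where w = "\<lambda>y. \<bar>?k y\<bar> * (4 * (l2_norm g)\<^sup>2)"])
    show "AE y in lborel. (\<lambda>n. \<bar>?k y\<bar> * \<theta> n y) \<longlonglongrightarrow> 0"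
    proof (intro AE_I2)
      fix y :: "real^'n"
      have "(\<lambda>n. c n *\<^sub>R y) \<longlonglongrightarrow> 0 *\<^sub>R y" by (intro tendsto_intros c0)
      then have "(\<lambda>n. \<theta> n y) \<longlonglongrightarrow> 0"
        unfolding \<theta>_def G_def by (intro L2_translation_continuous g) simp
      then show "(\<lambda>n. \<bar>?k y\<bar> * \<theta> n y) \<longlonglongrightarrow> 0" by (rule tendsto_mult_right_zero)
    qed
    show "AE y in lborel. norm (\<bar>?k y\<bar> * \<theta> n y) \<le> \<bar>?k y\<bar> * (4 * (l2_norm g)\<^sup>2)" for n
      using \<theta>nn \<theta>le by (auto simp: abs_mult intro!: mult_left_mono)
    show "integrable lborel (\<lambda>y. \<bar>?k y\<bar> * (4 * (l2_norm g)\<^sup>2))"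
      by (intro integrable_mult_left integrable_abs ki)
  qed measurable
  then have "(\<lambda>n. (LINT y|lborel. \<bar>?k y\<bar>) * (LINT y|lborel. \<bar>?k y\<bar> * \<theta> n y)) \<longlonglongrightarrow> 0"
    by (intro tendsto_mult_right_zero) simp
  then have "(\<lambda>n. LINT x|lborel. (mollify n g x - g x)\<^sup>2) \<longlonglongrightarrow> 0"
    by (rule Lim_null_comparison[rotated]) (use bnd in auto)
  then have "(\<lambda>n. sqrt (LINT x|lborel. (mollify n g x - g x)\<^sup>2)) \<longlonglongrightarrow> sqrt 0" by (rule tendsto_real_sqrt)
  then show ?thesis by (simp add: l2_norm_def)
qed

section \<open>Weak derivatives and Sobolev norms\<close>

lemma smooth_L2_by_parts:
  fixes f g :: "real^'n::finite \<Rightarrow> real"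
  assumes "f \<in> smooth_L2" "g \<in> smooth_L2"
  shows "(LINT x|lborel. f x * partial_deriv i g x) = - (LINT x|lborel. partial_deriv i f x * g x)"
proof -
  note s = smooth_L2_smooth[OF assms(1)] smooth_L2_smooth[OF assms(2)]
  note l = smooth_L2_L2[OF assms(1)] smooth_L2_L2[OF assms(2)]
    smooth_L2_L2[OF smooth_L2_partial[OF assms(1)], of i] smooth_L2_L2[OF smooth_L2_partial[OF assms(2)], of i]
  note i = L2_integrable_mult[OF l(3) l(2)] L2_integrable_mult[OF l(1) l(4)]
  have "(LINT x|lborel. partial_deriv i (\<lambda>x. f x * g x) x) = 0"
    by (rule integral_partial_deriv_zero)
      (use i L2_integrable_mult[OF l(1,2)] s in \<open>auto simp: partial_deriv_mult_smooth intro: smooth_mult\<close>)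
  then show ?thesis using i by (simp add: partial_deriv_mult_smooth[OF s])
qed

lemma smooth_L2_iter_by_parts:
  fixes f g :: "real^'n::finite \<Rightarrow> real"
  assumes "f \<in> smooth_L2" "g \<in> smooth_L2"
  shows "(LINT x|lborel. f x * iter_partial js g x) = (-1) ^ length js * (LINT x|lborel. iter_partial js f x * g x)"
  using assms(1)
proof (induction js arbitrary: f)
  case (Cons i js)
  have "(LINT x|lborel. f x * iter_partial (i # js) g x) = - (LINT x|lborel. partial_deriv i f x * iter_partial js g x)"
    unfolding iter_partial_Cons
    by (rule smooth_L2_by_parts[OF Cons.prems smooth_L2_iter_partial[OF assms(2)]])
  also have "\<dots> = - ((-1) ^ length js * (LINT x|lborel. iter_partial js (partial_deriv i f) x * g x))"
    using Cons.IH[OF smooth_L2_partial[OF Cons.prems]] by simp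
  finally show ?case
    using iter_partial_partial_commute[OF smooth_L2_smooth[OF Cons.prems]] by (simp add: iter_partial_Cons)
qed simp

lemma mi_order_count_list: "mi_order (count_list js) = length (js :: 'n::finite list)"
  unfolding mi_order_def by (rule sum_count_set) auto

lemma multi_index_list: "\<exists>js :: 'n::finite list. count_list js = \<beta>"
proof -
  obtain js :: "'n list" where "mset js = (\<Sum>i\<in>UNIV. replicate_mset (\<beta> i) i)" using ex_mset by blast
  then have "count (mset js) i = \<beta> i" for i by (simp add: count_sum)
  then show ?thesis by (intro exI[of _ js] ext) (simp add: count_mset)
qed

lemma has_weak_deriv_smooth_L2:
  assumes "f \<in> smooth_L2"
  shows "has_weak_deriv (count_list js) f (iter_partial js f)"
  unfolding has_weak_deriv_def
proof (intro ballI allI impI)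
  fix \<phi> :: "real^'a \<Rightarrow> real" and ks assume "\<phi> \<in> test_functions" and ks: "\<forall>i. count_list ks i = count_list js i"
  \<comment> \<open>The definition quantifies over all orderings of the multi-index; symmetry of
    derivatives identifies them.\<close>
  have "mset ks = mset js" using ks by (intro multiset_eqI) (simp add: count_mset)
  then have "iter_partial ks f = iter_partial js f" "length ks = length js"
    using iter_partial_mset_eq[OF smooth_L2_smooth[OF assms]] mset_eq_length by blast+
  then show "(LINT x|lborel. f x * iter_partial ks \<phi> x) = (- 1) ^ mi_order (count_list js) * (LINT x|lborel. iter_partial js f x * \<phi> x)"
    using smooth_L2_iter_by_parts[OF assms test_functions_smooth_L2[OF \<open>\<phi> \<in> test_functions\<close>], of ks]
    by (simp add: mi_order_count_list)
qed

lemma L2_inner_tendsto: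
  assumes "f \<in> L2" "\<And>n::nat. a n \<in> L2" "b \<in> L2" "(\<lambda>n. l2_norm (\<lambda>x. a n x - b x)) \<longlonglongrightarrow> 0"
  shows "(\<lambda>n. LINT x|lborel. f x * a n x) \<longlonglongrightarrow> (LINT x|lborel. f x * b x)"
proof (rule LIM_zero_cancel, rule Lim_null_comparison)
  show "(\<lambda>n. l2_norm f * l2_norm (\<lambda>x. a n x - b x)) \<longlonglongrightarrow> 0" using tendsto_mult_right_zero[OF assms(4)] .
  show "\<forall>\<^sub>F n in sequentially. norm ((LINT x|lborel. f x * a n x) - (LINT x|lborel. f x * b x)) \<le> l2_norm f * l2_norm (\<lambda>x. a n x - b x)"
  proof (intro always_eventually allI)
    fix n
    have "(LINT x|lborel. f x * a n x) - (LINT x|lborel. f x * b x) = (LINT x|lborel. f x * (a n x - b x))"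
      unfolding right_diff_distrib
      by (intro Bochner_Integration.integral_diff[symmetric] L2_integrable_mult assms)
    then show "norm ((LINT x|lborel. f x * a n x) - (LINT x|lborel. f x * b x)) \<le> l2_norm f * l2_norm (\<lambda>x. a n x - b x)"
      using L2_Cauchy_Schwarz[OF assms(1) L2_diff[OF assms(2,3)]] by simp
  qed
qed

text \<open>Cutoff enlarges the class of admissible test functions, as is required for testing with
  mollifiers, which do not have compact support.\<close>

lemma has_weak_deriv_tested_smooth_L2:
  fixes f g \<kappa> :: "real^'n::finite \<Rightarrow> real"
  assumes "f \<in> L2" "g \<in> L2" "has_weak_deriv (count_list js) f g" "\<kappa> \<in> smooth_L2"
  shows "(LINT x|lborel. f x * iter_partial js \<kappa> x) = (-1) ^ length js * (LINT x|lborel. g x * \<kappa> x)"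
proof -
  obtain \<phi> where \<phi>: "\<And>n. \<phi> n \<in> test_functions"
    "\<And>js. (\<lambda>n. l2_norm (\<lambda>x. iter_partial js (\<phi> n) x - iter_partial js \<kappa> x)) \<longlonglongrightarrow> 0"
    using test_functions_dense_smooth_L2[OF assms(4)] by blast
  have w: "(LINT x|lborel. f x * iter_partial js (\<phi> n) x) = (-1) ^ length js * (LINT x|lborel. g x * \<phi> n x)" for n
    using assms(3) \<phi>(1)[of n] unfolding has_weak_deriv_def mi_order_count_list by blast
  have 1: "(\<lambda>n. LINT x|lborel. f x * iter_partial js (\<phi> n) x) \<longlonglongrightarrow> (LINT x|lborel. f x * iter_partial js \<kappa> x)"
    by (rule L2_inner_tendsto[OF assms(1) _ _ \<phi>(2)])
      (use test_functions_L2 test_functions_iter_partial \<phi>(1) smooth_L2_iter_L2[OF assms(4)] in auto)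
  have "(\<lambda>n. LINT x|lborel. g x * \<phi> n x) \<longlonglongrightarrow> (LINT x|lborel. g x * \<kappa> x)"
    by (rule L2_inner_tendsto[OF assms(2)])
      (use test_functions_L2 \<phi>(1) \<phi>(2)[of "[]"] smooth_L2_L2[OF assms(4)] in auto)
  then have 2: "(\<lambda>n. (-1) ^ length js * (LINT x|lborel. g x * \<phi> n x)) \<longlonglongrightarrow> (-1) ^ length js * (LINT x|lborel. g x * \<kappa> x)"
    by (rule tendsto_mult_left)
  show ?thesis by (rule LIMSEQ_unique[OF 1]) (use 2 in \<open>simp add: w\<close>)
qed

text \<open>The weak derivative is tested with the reflected kernel y |->
  \<open>mollifier n (x - y)\<close>; the sign produced by the reflection cancels the one in the
  definition of weak derivatives.\<close>

lemma mollify_weak_deriv: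
  fixes f g :: "real^'n::finite \<Rightarrow> real"
  assumes "f \<in> L2" "g \<in> L2" "has_weak_deriv (count_list js) f g"
  shows "iter_partial js (mollify n f) = mollify n g"
proof
  fix x
  let ?k = "mollifier n :: real^'n \<Rightarrow> real"
  have k: "?k \<in> smooth_L2" by (rule decaying_kernels_smooth_L2[OF mollifier_decaying])
  define \<kappa> where "\<kappa> = (\<lambda>y. ?k (-1 *\<^sub>R y + x))"
  have ip: "iter_partial ks \<kappa> = (\<lambda>y. (-1) ^ length ks * iter_partial ks ?k (-1 *\<^sub>R y + x))" for ks
    unfolding \<kappa>_def by (rule iter_partial_affine[OF smooth_L2_smooth[OF k]])
  have "\<kappa> \<in> smooth_L2"
    unfolding smooth_L2_def
  proof (intro CollectI conjI allI)
    show "smooth \<kappa>" unfolding \<kappa>_def by (rule smooth_affine[OF smooth_L2_smooth[OF k]])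
    show "iter_partial ks \<kappa> \<in> L2" for ks
      unfolding ip using L2_cmult[OF reflect_L2[OF smooth_L2_iter_L2[OF k, of ks], of x]] by simp
  qed
  from has_weak_deriv_tested_smooth_L2[OF assms this]
  have eq: "(LINT y|lborel. f y * ((-1) ^ length js * iter_partial js ?k (-1 *\<^sub>R y + x))) = (-1) ^ length js * (LINT y|lborel. g y * \<kappa> y)"
    by (simp only: ip)
  have "(LINT y|lborel. f y * ((-1) ^ length js * iter_partial js ?k (-1 *\<^sub>R y + x)))
    = (-1) ^ length js * (LINT y|lborel. f y * iter_partial js ?k (x - y))"
    by (subst integral_mult_right_zero[symmetric]) (simp add: mult.left_commute)
  with eq have "(LINT y|lborel. f y * iter_partial js ?k (x - y)) = (LINT y|lborel. g y * ?k (x - y))"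
    by (simp add: \<kappa>_def)
  then show "iter_partial js (mollify n f) x = mollify n g x"
    unfolding mollify_def convolve_iter_partial[OF assms(1) mollifier_decaying] by (simp add: convolve_def)
qed

lemma mollify_iter_partial:
  assumes "f \<in> smooth_L2"
  shows "iter_partial js (mollify n f) = mollify n (iter_partial js f)"
  by (rule mollify_weak_deriv[OF smooth_L2_L2[OF assms] smooth_L2_iter_L2[OF assms] has_weak_deriv_smooth_L2[OF assms]])

text \<open>Both candidates have the same mollifications, and these converge to each of them.
  Equality of norms suffices to make Sobolev norms independent of the choice in
  \<open>weak_deriv\<close>.\<close>

lemma weak_deriv_unique:
  fixes f g h :: "real^'n::finite \<Rightarrow> real"
  assumes "f \<in> L2" "g \<in> L2" "h \<in> L2" "has_weak_deriv \<beta> f g" "has_weak_deriv \<beta> f h"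
  shows "l2_norm g = l2_norm h"
proof -
  obtain js :: "'n list" where js: "count_list js = \<beta>" using multi_index_list by blast
  have eq: "mollify n g = mollify n h" for n
    using mollify_weak_deriv[OF assms(1,2), of js n] mollify_weak_deriv[OF assms(1,3), of js n] assms(4,5) js by simp
  have lim: "(\<lambda>n. l2_norm (mollify n u)) \<longlonglongrightarrow> l2_norm u" if u: "u \<in> L2" for u :: "real^'n \<Rightarrow> real"
  proof (rule LIM_zero_cancel, rule Lim_null_comparison[OF _ mollify_tendsto[OF u]])
    have "\<bar>l2_norm (mollify n u) - l2_norm u\<bar> \<le> l2_norm (\<lambda>x. mollify n u x - u x)" for n
    proof -
      have d: "(\<lambda>x. mollify n u x - u x) \<in> L2" by (intro L2_diff mollify_L2 u)
      have "l2_norm (\<lambda>x. (mollify n u x - u x) + u x) \<le> l2_norm (\<lambda>x. mollify n u x - u x) + l2_norm u"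
        by (rule l2_norm_triangle[OF d u])
      moreover have "l2_norm (\<lambda>x. mollify n u x - (mollify n u x - u x)) \<le> l2_norm (mollify n u) + l2_norm (\<lambda>x. mollify n u x - u x)"
        by (rule l2_norm_triangle_diff[OF mollify_L2[OF u] d])
      ultimately show ?thesis by simp
    qed
    then show "\<forall>\<^sub>F n in sequentially. norm (l2_norm (mollify n u) - l2_norm u) \<le> l2_norm (\<lambda>x. mollify n u x - u x)"
      by simp
  qed
  show ?thesis using LIMSEQ_unique[OF lim[OF assms(2), unfolded eq] lim[OF assms(3)]] .
qed

section \<open>Sobolev spaces and their norms\<close>

lemma sobolev_L2: "f \<in> sobolev m \<Longrightarrow> f \<in> L2"
  by (simp add: sobolev_def)

lemma weak_deriv_sobolev:
  assumes "f \<in> sobolev m" "mi_order \<beta> \<le> m"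
  shows "weak_deriv \<beta> f \<in> L2" "has_weak_deriv \<beta> f (weak_deriv \<beta> f)"
proof -
  have "\<exists>g. g \<in> L2 \<and> has_weak_deriv \<beta> f g" using assms by (auto simp: sobolev_def)
  then have "weak_deriv \<beta> f \<in> L2 \<and> has_weak_deriv \<beta> f (weak_deriv \<beta> f)"
    unfolding weak_deriv_def by (rule someI_ex)
  then show "weak_deriv \<beta> f \<in> L2" "has_weak_deriv \<beta> f (weak_deriv \<beta> f)" by auto
qed

lemma l2_norm_weak_deriv:
  assumes "f \<in> L2" "g \<in> L2" "has_weak_deriv \<beta> f g"
  shows "l2_norm (weak_deriv \<beta> f) = l2_norm g"
proof -
  have "\<exists>g. g \<in> L2 \<and> has_weak_deriv \<beta> f g" using assms by auto
  then have "weak_deriv \<beta> f \<in> L2 \<and> has_weak_deriv \<beta> f (weak_deriv \<beta> f)"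
    unfolding weak_deriv_def by (rule someI_ex)
  then show ?thesis using weak_deriv_unique assms by blast
qed

lemma has_weak_deriv_add:
  assumes "f \<in> L2" "f' \<in> L2" "g \<in> L2" "g' \<in> L2" "has_weak_deriv \<beta> f g" "has_weak_deriv \<beta> f' g'"
  shows "has_weak_deriv \<beta> (\<lambda>x. f x + f' x) (\<lambda>x. g x + g' x)"
  unfolding has_weak_deriv_def
proof (intro ballI allI impI)
  fix \<phi> :: "real^'a \<Rightarrow> real" and js assume p: "\<phi> \<in> test_functions" and js: "\<forall>i. count_list js i = \<beta> i"
  note l = test_functions_L2[OF p] test_functions_L2[OF test_functions_iter_partial[OF p, of js]]
  have "(LINT x|lborel. (f x + f' x) * iter_partial js \<phi> x) = (LINT x|lborel. f x * iter_partial js \<phi> x) + (LINT x|lborel. f' x * iter_partial js \<phi> x)"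
    unfolding distrib_right by (intro Bochner_Integration.integral_add L2_integrable_mult assms l)
  moreover have "(LINT x|lborel. (g x + g' x) * \<phi> x) = (LINT x|lborel. g x * \<phi> x) + (LINT x|lborel. g' x * \<phi> x)"
    unfolding distrib_right by (intro Bochner_Integration.integral_add L2_integrable_mult assms l)
  moreover have "(LINT x|lborel. f x * iter_partial js \<phi> x) = (- 1) ^ mi_order \<beta> * (LINT x|lborel. g x * \<phi> x)"
    "(LINT x|lborel. f' x * iter_partial js \<phi> x) = (- 1) ^ mi_order \<beta> * (LINT x|lborel. g' x * \<phi> x)"
    using assms(5,6) p js unfolding has_weak_deriv_def by blast+
  ultimately show "(LINT x|lborel. (f x + f' x) * iter_partial js \<phi> x) = (- 1) ^ mi_order \<beta> * (LINT x|lborel. (g x + g' x) * \<phi> x)"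
    by (simp add: distrib_left)
qed

lemma has_weak_deriv_cmult:
  assumes "has_weak_deriv \<beta> f g"
  shows "has_weak_deriv \<beta> (\<lambda>x. c * f x) (\<lambda>x. c * g x)"
  using assms unfolding has_weak_deriv_def by (simp add: mult.assoc)

lemma sobolev_add:
  assumes "f \<in> sobolev m" "g \<in> sobolev m"
  shows "(\<lambda>x. f x + g x) \<in> sobolev m"
proof -
  have "\<exists>h\<in>L2. has_weak_deriv \<beta> (\<lambda>x. f x + g x) h" if "mi_order \<beta> \<le> m" for \<beta>
    using has_weak_deriv_add[OF sobolev_L2[OF assms(1)] sobolev_L2[OF assms(2)]] weak_deriv_sobolev[OF assms(1) that]
      weak_deriv_sobolev[OF assms(2) that] L2_add by blast
  then show ?thesis using assms by (auto simp: sobolev_def intro: L2_add)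
qed

lemma sobolev_cmult:
  assumes "f \<in> sobolev m" shows "(\<lambda>x. c * f x) \<in> sobolev m"
proof -
  have "\<exists>h\<in>L2. has_weak_deriv \<beta> (\<lambda>x. c * f x) h" if "mi_order \<beta> \<le> m" for \<beta>
    using has_weak_deriv_cmult weak_deriv_sobolev[OF assms(1) that] L2_cmult by blast
  then show ?thesis using assms by (auto simp: sobolev_def intro: L2_cmult)
qed

lemma sobolev_diff:
  assumes "f \<in> sobolev m" "g \<in> sobolev m"
  shows "(\<lambda>x. f x - g x) \<in> sobolev m"
  using sobolev_add[OF assms(1) sobolev_cmult[OF assms(2), of "-1"]] by simp

lemma smooth_L2_sobolev:
  assumes "f \<in> smooth_L2" shows "f \<in> sobolev m"
proof -
  have "\<exists>g\<in>L2. has_weak_deriv \<beta> f g" for \<beta>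
  proof -
    obtain js :: "'a list" where "count_list js = \<beta>" using multi_index_list by blast
    then show ?thesis using has_weak_deriv_smooth_L2[OF assms, of js] smooth_L2_iter_L2[OF assms, of js] by auto
  qed
  then show ?thesis using smooth_L2_L2[OF assms] by (auto simp: sobolev_def)
qed

lemma finite_multi_indices: "finite {\<beta> :: 'n::finite \<Rightarrow> nat. mi_order \<beta> \<le> m}"
proof (rule finite_subset)
  show "{\<beta> :: 'n \<Rightarrow> nat. mi_order \<beta> \<le> m} \<subseteq> PiE UNIV (\<lambda>_. {..m})"
  proof
    fix \<beta> :: "'n \<Rightarrow> nat" assume "\<beta> \<in> {\<beta>. mi_order \<beta> \<le> m}"
    then have "sum \<beta> UNIV \<le> m" by (simp add: mi_order_def)
    moreover have "\<beta> i \<le> sum \<beta> UNIV" for i by (rule member_le_sum) auto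
    ultimately show "\<beta> \<in> PiE UNIV (\<lambda>_. {..m})" by (auto intro: order_trans)
  qed
  show "finite (PiE (UNIV :: 'n set) (\<lambda>_. {..m}))" by (rule finite_PiE) auto
qed

lemma sobolev_norm_L2_set:
  "sobolev_norm m f = L2_set (\<lambda>\<beta>. l2_norm (weak_deriv \<beta> f)) {\<beta>. mi_order \<beta> \<le> m}"
  by (simp add: sobolev_norm_def L2_set_def)

lemma sobolev_norm_nonneg [simp]: "sobolev_norm m f \<ge> 0"
  by (simp add: sobolev_norm_L2_set L2_set_nonneg)

lemma l2_norm_weak_deriv_le:
  assumes "mi_order \<beta> \<le> m"
  shows "l2_norm (weak_deriv \<beta> f) \<le> sobolev_norm m f"
  unfolding sobolev_norm_L2_set
  by (rule member_le_L2_set[OF finite_multi_indices]) (use assms in auto)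

lemma l2_norm_iter_partial_le:
  assumes "f \<in> smooth_L2" "length js \<le> m"
  shows "l2_norm (iter_partial js f) \<le> sobolev_norm m f"
  using l2_norm_weak_deriv_le[of "count_list js" m f] assms
    l2_norm_weak_deriv[OF smooth_L2_L2[OF assms(1)] smooth_L2_iter_L2[OF assms(1)] has_weak_deriv_smooth_L2[OF assms(1)], of js]
  by (simp add: mi_order_count_list)

lemma sobolev_norm_triangle:
  assumes "f \<in> sobolev m" "g \<in> sobolev m"
  shows "sobolev_norm m (\<lambda>x. f x + g x) \<le> sobolev_norm m f + sobolev_norm m g"
proof -
  have "l2_norm (weak_deriv \<beta> (\<lambda>x. f x + g x)) \<le> l2_norm (weak_deriv \<beta> f) + l2_norm (weak_deriv \<beta> g)"
    if "\<beta> \<in> {\<beta>. mi_order \<beta> \<le> m}" for \<beta>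
  proof -
    have b: "mi_order \<beta> \<le> m" using that by simp
    note 1 = weak_deriv_sobolev[OF assms(1) b] weak_deriv_sobolev[OF assms(2) b]
    note 2 = sobolev_L2[OF assms(1)] sobolev_L2[OF assms(2)]
    have "l2_norm (weak_deriv \<beta> (\<lambda>x. f x + g x)) = l2_norm (\<lambda>x. weak_deriv \<beta> f x + weak_deriv \<beta> g x)"
      by (rule l2_norm_weak_deriv[OF L2_add[OF 2] L2_add[OF 1(1,3)] has_weak_deriv_add[OF 2 1(1,3) 1(2,4)]])
    also have "\<dots> \<le> l2_norm (weak_deriv \<beta> f) + l2_norm (weak_deriv \<beta> g)"
      by (rule l2_norm_triangle[OF 1(1,3)])
    finally show ?thesis .
  qed
  then have "sobolev_norm m (\<lambda>x. f x + g x) \<le> L2_set (\<lambda>\<beta>. l2_norm (weak_deriv \<beta> f) + l2_norm (weak_deriv \<beta> g)) {\<beta>. mi_order \<beta> \<le> m}"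
    unfolding sobolev_norm_L2_set by (intro L2_set_mono) auto
  also have "\<dots> \<le> sobolev_norm m f + sobolev_norm m g"
    unfolding sobolev_norm_L2_set by (rule L2_set_triangle_ineq)
  finally show ?thesis .
qed

text \<open>Arbitrary weak derivatives may be inserted in place of the chosen ones, and the
  Euclidean norm over multi-indices is relaxed to a sum, which is easier to send to zero.\<close>

lemma sobolev_norm_le_sum:
  assumes "f \<in> L2" "\<And>\<beta>. mi_order \<beta> \<le> m \<Longrightarrow> g \<beta> \<in> L2 \<and> has_weak_deriv \<beta> f (g \<beta>)"
  shows "sobolev_norm m f \<le> (\<Sum>\<beta> | mi_order \<beta> \<le> m. l2_norm (g \<beta>))"
proof -
  have "sobolev_norm m f \<le> (\<Sum>\<beta> | mi_order \<beta> \<le> m. l2_norm (weak_deriv \<beta> f))"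
    unfolding sobolev_norm_L2_set by (rule L2_set_le_sum) simp
  also have "\<dots> = (\<Sum>\<beta> | mi_order \<beta> \<le> m. l2_norm (g \<beta>))"
    by (intro sum.cong refl l2_norm_weak_deriv) (use assms in auto)
  finally show ?thesis .
qed

lemma sobolev_norm_cmult:
  assumes "f \<in> sobolev m"
  shows "sobolev_norm m (\<lambda>x. c * f x) = \<bar>c\<bar> * sobolev_norm m f"
proof -
  have "l2_norm (weak_deriv \<beta> (\<lambda>x. c * f x)) = \<bar>c\<bar> * l2_norm (weak_deriv \<beta> f)"
    if "\<beta> \<in> {\<beta>. mi_order \<beta> \<le> m}" for \<beta>
  proof -
    have b: "mi_order \<beta> \<le> m" using that by simp
    note 1 = weak_deriv_sobolev[OF assms(1) b]
    have "l2_norm (weak_deriv \<beta> (\<lambda>x. c * f x)) = l2_norm (\<lambda>x. c * weak_deriv \<beta> f x)"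
      by (rule l2_norm_weak_deriv[OF L2_cmult[OF sobolev_L2[OF assms]] L2_cmult[OF 1(1)] has_weak_deriv_cmult[OF 1(2)]])
    then show ?thesis by (simp add: l2_norm_cmult)
  qed
  then have "sobolev_norm m (\<lambda>x. c * f x) = L2_set (\<lambda>\<beta>. \<bar>c\<bar> * l2_norm (weak_deriv \<beta> f)) {\<beta>. mi_order \<beta> \<le> m}"
    unfolding sobolev_norm_L2_set by (intro L2_set_cong) auto
  then show ?thesis by (simp add: sobolev_norm_L2_set L2_set_right_distrib)
qed

text \<open>Mollification commutes with weak derivatives, so this is \<open>mollify_tendsto\<close>
  for finitely many functions.\<close>

lemma mollify_tendsto_sobolev:
  fixes f :: "real^'n::finite \<Rightarrow> real"
  assumes f: "f \<in> sobolev m"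
  shows "(\<lambda>n. sobolev_norm m (\<lambda>x. mollify n f x - f x)) \<longlonglongrightarrow> 0"
proof (rule Lim_null_comparison)
  have "(\<lambda>n. \<Sum>\<beta> | mi_order \<beta> \<le> m. l2_norm (\<lambda>x. mollify n (weak_deriv \<beta> f) x - weak_deriv \<beta> f x)) \<longlonglongrightarrow> (\<Sum>\<beta> :: 'n \<Rightarrow> nat | mi_order \<beta> \<le> m. 0)"
    by (intro tendsto_sum mollify_tendsto weak_deriv_sobolev(1)[OF f]) auto
  then show "(\<lambda>n. \<Sum>\<beta> | mi_order \<beta> \<le> m. l2_norm (\<lambda>x. mollify n (weak_deriv \<beta> f) x - weak_deriv \<beta> f x)) \<longlonglongrightarrow> 0" by simp
  note fL = sobolev_L2[OF f]
  show "\<forall>\<^sub>F n in sequentially. norm (sobolev_norm m (\<lambda>x. mollify n f x - f x)) \<le> 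
     (\<Sum>\<beta> | mi_order \<beta> \<le> m. l2_norm (\<lambda>x. mollify n (weak_deriv \<beta> f) x - weak_deriv \<beta> f x))"
  proof (intro always_eventually allI)
    fix n
    have "sobolev_norm m (\<lambda>x. mollify n f x - f x) \<le> 
     (\<Sum>\<beta> | mi_order \<beta> \<le> m. l2_norm (\<lambda>x. mollify n (weak_deriv \<beta> f) x - weak_deriv \<beta> f x))"
    proof (rule sobolev_norm_le_sum, goal_cases)
      case 1
      show ?case by (intro L2_diff mollify_L2 fL)
    next
      case (2 \<beta>)
      note w = weak_deriv_sobolev[OF f 2]
      obtain js :: "'n list" where js: "count_list js = \<beta>" using multi_index_list by blast
      have "has_weak_deriv \<beta> (mollify n f) (mollify n (weak_deriv \<beta> f))"
        using has_weak_deriv_smooth_L2[OF bandlimited_smooth_L2[OF mollify_bandlimited[OF fL]], of js n]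
          mollify_weak_deriv[OF fL w(1), of js n] w(2) by (simp add: js)
      from has_weak_deriv_add[OF mollify_L2[OF fL] L2_cmult[OF fL] mollify_L2[OF w(1)] L2_cmult[OF w(1)] this has_weak_deriv_cmult[OF w(2)], of "-1"]
      show ?case using w(1) by (auto intro!: L2_diff mollify_L2)
    qed
    then show "norm (sobolev_norm m (\<lambda>x. mollify n f x - f x)) \<le> 
     (\<Sum>\<beta> | mi_order \<beta> \<le> m. l2_norm (\<lambda>x. mollify n (weak_deriv \<beta> f) x - weak_deriv \<beta> f x))" by simp
  qed
qed

lemma smooth_L2_tendsto_sobolev:
  fixes h :: "nat \<Rightarrow> real^'n::finite \<Rightarrow> real"
  assumes "\<And>n. h n \<in> smooth_L2" "\<And>js. (\<lambda>n. l2_norm (iter_partial js (h n))) \<longlonglongrightarrow> 0"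
  shows "(\<lambda>n. sobolev_norm m (h n)) \<longlonglongrightarrow> 0"
proof (rule Lim_null_comparison)
  \<comment> \<open>A multi-index has many orderings; one is fixed for each.\<close>
  define J where "J \<beta> = (SOME js :: 'n list. count_list js = \<beta>)" for \<beta>
  have J: "count_list (J \<beta>) = \<beta>" for \<beta>
    unfolding J_def by (rule someI_ex) (rule multi_index_list)
  have "(\<lambda>n. \<Sum>\<beta> | mi_order \<beta> \<le> m. l2_norm (iter_partial (J \<beta>) (h n))) \<longlonglongrightarrow> (\<Sum>\<beta> :: 'n \<Rightarrow> nat | mi_order \<beta> \<le> m. 0)"
    by (intro tendsto_sum assms)
  then show "(\<lambda>n. \<Sum>\<beta> | mi_order \<beta> \<le> m. l2_norm (iter_partial (J \<beta>) (h n))) \<longlonglongrightarrow> 0" by simp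
  have "sobolev_norm m (h n) \<le> (\<Sum>\<beta> | mi_order \<beta> \<le> m. l2_norm (iter_partial (J \<beta>) (h n)))" for n
    by (rule sobolev_norm_le_sum)
      (use assms(1)[of n] smooth_L2_L2 smooth_L2_iter_L2 has_weak_deriv_smooth_L2[OF assms(1)] J in \<open>auto\<close>, metis J)
  then show "\<forall>\<^sub>F n in sequentially. norm (sobolev_norm m (h n)) \<le> (\<Sum>\<beta> | mi_order \<beta> \<le> m. l2_norm (iter_partial (J \<beta>) (h n)))"
    by simp
qed

section \<open>Functionals in the dual space\<close>

lemma sobolev_dual_bound:
  assumes "v \<in> sobolev_dual m" "f \<in> sobolev m"
  shows "\<bar>v f\<bar> \<le> sobolev_dual_norm m v * sobolev_norm m f"
proof -
  obtain C where "\<forall>f\<in>sobolev m. \<bar>v f\<bar> \<le> C * sobolev_norm m f"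
    using assms(1) by (auto simp: sobolev_dual_def)
  then have C: "\<bar>v f\<bar> \<le> C * sobolev_norm m f" if "f \<in> sobolev m" for f using that by blast
  show ?thesis
  proof (cases "sobolev_norm m f = 0")
    case True
    \<comment> \<open>The supremum leaves out functions of norm zero; on these, boundedness forces
      \<open>v f = 0\<close>.\<close>
    then show ?thesis using C[OF assms(2)] by simp
  next
    case False
    then have p: "sobolev_norm m f > 0" by (metis less_eq_real_def sobolev_norm_nonneg)
    have "\<bar>v f\<bar> / sobolev_norm m f \<le> sobolev_dual_norm m v"
      unfolding sobolev_dual_norm_def
    proof (rule cSUP_upper)
      show "bdd_above ((\<lambda>f. \<bar>v f\<bar> / sobolev_norm m f) ` {f \<in> sobolev m. sobolev_norm m f \<noteq> 0})"
      proof (rule bdd_aboveI[of _ C], safe)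
        fix f :: "real^'a \<Rightarrow> real" assume f: "f \<in> sobolev m" "sobolev_norm m f \<noteq> 0"
        then have "sobolev_norm m f > 0" by (metis less_eq_real_def sobolev_norm_nonneg)
        then show "\<bar>v f\<bar> / sobolev_norm m f \<le> C" using C[OF f(1)] by (simp add: divide_le_eq)
      qed
    qed (use assms False in auto)
    then show ?thesis using p by (simp add: divide_le_eq)
  qed
qed

section \<open>The Sobolev inequality at the origin\<close>

text \<open>Averaging \<open>f 0\<close> over the unit cube, \<open>r \<mapsto> \<integral> f (r y) dy\<close> is expanded by Taylor's formula at
  \<open>r = 1\<close>. Its derivative of order \<open>k\<close> is a sum of the integrals \<open>cube_mean f js r\<close> with
  \<open>length js = k\<close>, which are at most \<open>r\<^sup>-\<^sup>N\<^sup>/\<^sup>2\<close> times an \<open>L\<^sup>2\<close> norm. The remainder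
  integral \<open>\<integral>\<^sub>0\<^sup>1 r\<^sup>m\<^sup>-\<^sup>1 r\<^sup>-\<^sup>N\<^sup>/\<^sup>2 dr\<close> converges exactly when \<open>m > N/2\<close>.\<close>

definition monomial :: "'n::finite list \<Rightarrow> real^'n \<Rightarrow> real" where
  "monomial js y = prod_list (map (\<lambda>j. y $ j) js)"

definition cube_mean :: "(real^'n::finite \<Rightarrow> real) \<Rightarrow> 'n list \<Rightarrow> real \<Rightarrow> real" where
  "cube_mean f js r = integral (cbox 0 1) (\<lambda>y. monomial js y * iter_partial js f (r *\<^sub>R y))"

lemma continuous_monomial [continuous_intros]: "continuous_on A (monomial js)"
  by (induction js) (auto simp: monomial_def intro!: continuous_intros)

lemma monomial_le_1:
  assumes "y \<in> cbox 0 1" shows "\<bar>monomial js y\<bar> \<le> 1"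
  using assms by (induction js) (auto simp: monomial_def abs_mult mem_box_cart intro!: mult_le_one)

text \<open>Each derivative in r yields one more coordinate factor and one more partial derivative;
  prefixing i to the list records both.\<close>

lemma cube_mean_DERIV:
  fixes f :: "real^'n::finite \<Rightarrow> real"
  assumes s: "smooth f"
  shows "(cube_mean f js has_real_derivative (\<Sum>i\<in>UNIV. cube_mean f (i # js) r)) (at r)"
proof -
  have sj: "smooth (iter_partial ks f)" for ks by (rule smooth_iter_partial[OF s])
  have c: "continuous_on A (\<lambda>x. iter_partial ks f (g x))" if "continuous_on A g" for A and g :: "'b::topological_space \<Rightarrow> real^'n" and ks
    by (rule continuous_on_compose2[OF smooth_continuous[OF sj, of UNIV] that]) auto
  have cm: "continuous_on A (\<lambda>x. monomial ks (g x))" if "continuous_on A g" for A and g :: "'b::topological_space \<Rightarrow> real^'n" and ks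
    by (rule continuous_on_compose2[OF continuous_monomial[of UNIV] that]) auto
  have "((\<lambda>r. integral (cbox 0 1) (\<lambda>y. monomial js y * iter_partial js f (r *\<^sub>R y))) has_real_derivative
     integral (cbox 0 1) (\<lambda>y. \<Sum>i\<in>UNIV. monomial (i # js) y * iter_partial (i # js) f (r *\<^sub>R y))) (at r within UNIV)"
  proof (rule leibniz_rule_field_derivative)
    fix r and y :: "real^'n"
    have "((\<lambda>r. iter_partial js f (0 + r *\<^sub>R y)) has_real_derivative (\<Sum>i\<in>UNIV. y $ i * partial_deriv i (iter_partial js f) (0 + r *\<^sub>R y))) (at r)"
      by (rule DERIV_line) (rule smooth_differentiable[OF sj])
    then have "((\<lambda>r. monomial js y * iter_partial js f (r *\<^sub>R y)) has_real_derivative monomial js y * (\<Sum>i\<in>UNIV. y $ i * partial_deriv i (iter_partial js f) (r *\<^sub>R y))) (at r)"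
      by (intro DERIV_cmult) simp
    then show "((\<lambda>r. monomial js y * iter_partial js f (r *\<^sub>R y)) has_real_derivative (\<Sum>i\<in>UNIV. monomial (i # js) y * iter_partial (i # js) f (r *\<^sub>R y))) (at r within UNIV)"
      by (simp add: monomial_def iter_partial_Cons sum_distrib_left mult_ac)
  next
    show "(\<lambda>y. monomial js y * iter_partial js f (r *\<^sub>R y)) integrable_on cbox 0 1" for r
      by (intro integrable_continuous continuous_intros c)
    show "continuous_on (UNIV \<times> cbox 0 1) (\<lambda>(r, y). \<Sum>i\<in>UNIV. monomial (i # js) y * iter_partial (i # js) f (r *\<^sub>R y))"
      unfolding split_beta by (intro continuous_intros c cm)
  qed auto
  moreover have "integral (cbox 0 1) (\<lambda>y. \<Sum>i\<in>UNIV. monomial (i # js) y * iter_partial (i # js) f (r *\<^sub>R y)) = (\<Sum>i\<in>UNIV. cube_mean f (i # js) r)"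
    unfolding cube_mean_def
    by (intro integral_sum integrable_continuous continuous_intros c) auto
  ultimately show ?thesis unfolding cube_mean_def[abs_def] by simp
qed

lemma measure_unit_cube: "measure lborel (cbox 0 (1 :: real^'n::finite)) = 1"
proof -
  have "(0 :: real^'n) \<in> cbox 0 1" by (simp add: mem_box_cart)
  then have "cbox 0 (1 :: real^'n) \<noteq> {}" by blast
  from content_cbox_cart[OF this] show ?thesis by simp
qed

text \<open>Cauchy-Schwarz on a cube of volume one; the substitution x = r y accounts for the power
  of r.\<close>

lemma cube_mean_bound:
  fixes f :: "real^'n::finite \<Rightarrow> real"
  assumes f: "f \<in> smooth_L2" and r: "r > 0"
  shows "\<bar>cube_mean f js r\<bar> \<le> r powr (- (CARD('n) / 2)) * l2_norm (iter_partial js f)"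
proof -
  let ?Q = "cbox 0 1 :: (real^'n) set"
  define g where "g = iter_partial js f"
  have g: "g \<in> L2" "smooth g" using smooth_L2_iter_L2[OF f] smooth_iter_partial[OF smooth_L2_smooth[OF f]] by (auto simp: g_def)
  have gm[measurable]: "g \<in> borel_measurable borel" by (rule L2_measurable[OF g(1)])
  have mm[measurable]: "monomial js \<in> borel_measurable borel"
    by (rule borel_measurable_continuous_onI) (rule continuous_monomial)
  have cont: "continuous_on ?Q (\<lambda>y. monomial js y * g (r *\<^sub>R y))"
    by (intro continuous_intros continuous_on_compose2[OF smooth_continuous[OF g(2), of UNIV]]) auto
  have "cube_mean f js r = (LINT y:?Q|lborel. monomial js y * g (r *\<^sub>R y))"
    unfolding cube_mean_def g_def[symmetric]
    by (rule set_borel_integral_eq_integral(2)[symmetric])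
      (use borel_integrable_compact[OF compact_cbox cont] in \<open>simp add: set_integrable_def\<close>)
  also have "\<dots> = (LINT y|lborel. (indicator ?Q y * monomial js y) * g (0 + r *\<^sub>R y))"
    by (simp add: set_lebesgue_integral_def mult.assoc)
  finally have eq: "cube_mean f js r = (LINT y|lborel. (indicator ?Q y * monomial js y) * g (0 + r *\<^sub>R y))" .
  have iQ: "integrable lborel (indicator ?Q :: _ \<Rightarrow> real)"
    by (intro integrable_real_indicator) (auto simp: emeasure_lborel_cbox_eq)
  have "(indicator ?Q y * monomial js y)\<^sup>2 \<le> (indicator ?Q y :: real)" for y
    using monomial_le_1[of y js] by (auto simp: indicator_def abs_square_le_1)
  then have le: "norm ((indicator ?Q y * monomial js y)\<^sup>2) \<le> norm (indicator ?Q y :: real)" for y by auto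
  have i2: "integrable lborel (\<lambda>y. (indicator ?Q y * monomial js y)\<^sup>2)"
    by (rule Bochner_Integration.integrable_bound[OF iQ]) (use le in auto)
  then have a: "(\<lambda>y. indicator ?Q y * monomial js y) \<in> L2" by (simp add: L2_alt)
  have "(LINT y|lborel. (indicator ?Q y * monomial js y)\<^sup>2) \<le> (LINT y|lborel. indicator ?Q y)"
    by (rule integral_mono[OF i2 iQ]) (use le in auto)
  also have "\<dots> = 1"
    by (simp add: measure_unit_cube)
  finally have a1: "l2_norm (\<lambda>y. indicator ?Q y * monomial js y) \<le> 1"
    unfolding l2_norm_def by simp
  have "l2_norm (\<lambda>y. g (0 + r *\<^sub>R y)) = sqrt ((LINT x|lborel. (g x)\<^sup>2) / \<bar>r\<bar> ^ CARD('n))"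
    unfolding l2_norm_def using integral_lborel_affine(1)[of r "\<lambda>x. (g x)\<^sup>2" 0] r by simp
  also have "\<dots> = r powr (- (CARD('n) / 2)) * l2_norm g"
  proof -
    have "sqrt (r ^ CARD('n)) = (r powr real CARD('n)) powr (1 / 2)"
      using r by (simp only: powr_half_sqrt powr_realpow powr_ge_zero zero_le_power less_imp_le)
    also have "\<dots> = r powr (CARD('n) / 2)" by (simp only: powr_powr) simp
    finally have sq: "sqrt (r ^ CARD('n)) = r powr (CARD('n) / 2)" .
    have "\<bar>r\<bar> = r" using r by simp
    then show ?thesis
      unfolding l2_norm_def real_sqrt_divide powr_minus divide_inverse sq[unfolded divide_inverse, symmetric]
      by (simp only: real_sqrt_mult real_sqrt_inverse mult.commute)
  qed
  finally have b: "l2_norm (\<lambda>y. g (0 + r *\<^sub>R y)) = r powr (- (CARD('n) / 2)) * l2_norm g" .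
  have "\<bar>cube_mean f js r\<bar> \<le> l2_norm (\<lambda>y. indicator ?Q y * monomial js y) * l2_norm (\<lambda>y. g (0 + r *\<^sub>R y))"
    unfolding eq using r by (intro L2_Cauchy_Schwarz a L2_affine g(1)) simp
  also have "\<dots> \<le> 1 * l2_norm (\<lambda>y. g (0 + r *\<^sub>R y))"
    by (rule mult_right_mono[OF a1]) simp
  finally show ?thesis unfolding b by (simp add: g_def)
qed

definition lists_of_length :: "nat \<Rightarrow> 'n::finite list set" where
  "lists_of_length k = {js. length js = k}"

lemma finite_lists_of_length [simp]: "finite (lists_of_length k :: 'n::finite list set)"
  unfolding lists_of_length_def using finite_lists_length_eq[of "UNIV :: 'n set" k] by simp

lemma sum_lists_Suc: "(\<Sum>js\<in>lists_of_length k. \<Sum>i\<in>UNIV. F (i # js)) = (\<Sum>js\<in>lists_of_length (Suc k). F js)"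
  for F :: "'n::finite list \<Rightarrow> real"
proof -
  have "(\<Sum>js\<in>lists_of_length k. \<Sum>i\<in>UNIV. F (i # js)) = (\<Sum>(js, i)\<in>lists_of_length k \<times> UNIV. F (i # js))"
    by (rule sum.cartesian_product)
  also have "\<dots> = (\<Sum>js\<in>lists_of_length (Suc k). F js)"
    by (rule sum.reindex_bij_witness[where i = "\<lambda>ks. (tl ks, hd ks)" and j = "\<lambda>(js, i). i # js"])
      (auto simp: lists_of_length_def length_Suc_conv)
  finally show ?thesis .
qed

lemma sobolev_inequality_sum:
  fixes f :: "real^'n::finite \<Rightarrow> real"
  assumes m: "real m > CARD('n) / 2" and f: "f \<in> smooth_L2"
  shows "\<bar>f 0\<bar> \<le> (1 + 1 / (real m - CARD('n) / 2)) * (\<Sum>k\<le>m. \<Sum>js\<in>lists_of_length k. l2_norm (iter_partial js f))"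
proof -
  define q where "q = real m - CARD('n) / 2"
  have q: "q > 0" using m by (simp add: q_def)
  have "m > 0" using m by (cases m) auto
  \<comment> \<open>M = m - 1 is the degree of the Taylor polynomial, m the order of the
    remainder.\<close>
  then obtain M where M: "m = Suc M" by (cases m) auto
  define P where "P k r = (\<Sum>js\<in>lists_of_length k. cube_mean f js r)" for k r
  define S where "S = (\<Sum>k\<le>m. \<Sum>js\<in>lists_of_length k. l2_norm (iter_partial js f))"
  have S: "S \<ge> 0" unfolding S_def by (intro sum_nonneg) auto
  have dP: "(P k has_real_derivative P (Suc k) r) (at r)" for k r
    unfolding P_def[abs_def] sum_lists_Suc[symmetric]
    by (intro DERIV_sum cube_mean_DERIV smooth_L2_smooth f)
  have Pb: "\<bar>P k r\<bar> \<le> r powr (- (CARD('n) / 2)) * (\<Sum>js\<in>lists_of_length k. l2_norm (iter_partial js f))" if "r > 0" for k r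
    unfolding P_def sum_distrib_left
    by (rule order_trans[OF sum_abs]) (intro sum_mono cube_mean_bound f that)
  \<comment> \<open>The Taylor polynomial of \<open>P 0\<close> about r, evaluated at 0. Its
    derivative in r telescopes to a single term, and at r = 0 it is f 0.\<close>
  define G where "G n r = (\<Sum>k\<le>n. (- r) ^ k / fact k * P k r)" for n r
  have dG: "(G n has_real_derivative (- r) ^ n / fact n * P (Suc n) r) (at r)" for n r
  proof (induction n)
    case 0
    then show ?case using dP[of 0 r] by (simp add: G_def[abs_def])
  next
    case (Suc n)
    have "((\<lambda>r. (- r) ^ Suc n) has_real_derivative - (real (Suc n) * (- r) ^ n)) (at r)"
      by (auto intro!: derivative_eq_intros simp del: power_Suc)
    from DERIV_cdivide[OF this, of "fact (Suc n)"]
    have d: "((\<lambda>r. (- r) ^ Suc n / fact (Suc n)) has_real_derivative - ((- r) ^ n / fact n)) (at r)"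
      by (simp add: fact_Suc del: power_Suc of_nat_Suc)
    have "((\<lambda>r. (- r) ^ Suc n / fact (Suc n) * P (Suc n) r) has_real_derivative
       (- ((- r) ^ n / fact n * P (Suc n) r) + (- r) ^ Suc n / fact (Suc n) * P (Suc (Suc n)) r)) (at r)"
      using DERIV_mult[OF d dP] by (simp add: mult.commute del: power_Suc fact_Suc)
    from DERIV_add[OF Suc this] show ?case by (simp add: G_def[abs_def])
  qed
  \<comment> \<open>A primitive of the bound for the derivative of \<open>G M\<close>. The bound may
    be singular at 0; instead of integrating it, the sum and the difference of H and
    \<open>G M\<close> are shown to increase. Continuity of H at 0 uses q > 0.\<close>
  define H where "H r = S / q * r powr q" for r
  have dH: "(H has_real_derivative S * r powr (q - 1)) (at r)" if "r > 0" for r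
    unfolding H_def[abs_def] using that q by (auto intro!: derivative_eq_intros)
  have cG: "continuous_on A (G n)" for A n
    using dG by (meson DERIV_isCont continuous_at_imp_continuous_on)
  have cH: "continuous_on {0..1} H"
    unfolding H_def[abs_def] using q by (intro continuous_intros continuous_on_powr') auto
  have dGb: "\<bar>(- r) ^ M / fact M * P (Suc M) r\<bar> \<le> S * r powr (q - 1)" if r: "0 < r" "r < 1" for r
  proof -
    have "\<bar>P (Suc M) r\<bar> \<le> r powr (- (CARD('n) / 2)) * (\<Sum>js\<in>lists_of_length (Suc M). l2_norm (iter_partial js f))"
      by (rule Pb[OF r(1)])
    also have "\<dots> \<le> r powr (- (CARD('n) / 2)) * S"
      unfolding S_def M
      by (intro mult_left_mono member_le_sum[of "Suc M" _ "\<lambda>k. \<Sum>js\<in>lists_of_length k. l2_norm (iter_partial js f)"]) (auto intro: sum_nonneg)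
    finally have 1: "\<bar>P (Suc M) r\<bar> \<le> r powr (- (CARD('n) / 2)) * S" .
    have "\<bar>(- r) ^ M / fact M\<bar> \<le> r ^ M"
      using r by (simp add: abs_mult power_abs divide_le_eq mult_le_cancel_left1)
    then have "\<bar>(- r) ^ M / fact M * P (Suc M) r\<bar> \<le> r ^ M * (r powr (- (CARD('n) / 2)) * S)"
      unfolding abs_mult using 1 r by (intro mult_mono) auto
    also have "\<dots> = S * r powr (q - 1)"
      using r by (simp add: q_def M powr_realpow[symmetric] powr_add[symmetric] algebra_simps)
    finally show ?thesis .
  qed
  have up: "H 0 + G M 0 \<le> H 1 + G M 1"
  proof (rule DERIV_nonneg_imp_increasing_open[where f = "\<lambda>r. H r + G M r"])
    fix r :: real assume r: "0 < r" "r < 1"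
    show "\<exists>y. ((\<lambda>r. H r + G M r) has_real_derivative y) (at r) \<and> y \<ge> 0"
      by (rule exI[of _ "S * r powr (q - 1) + (- r) ^ M / fact M * P (Suc M) r"], rule conjI, rule DERIV_add[OF dH[OF r(1)] dG])
        (use dGb[OF r] in linarith)
  qed (auto intro: continuous_on_add cG cH)
  have down: "H 0 - G M 0 \<le> H 1 - G M 1"
  proof (rule DERIV_nonneg_imp_increasing_open[where f = "\<lambda>r. H r - G M r"])
    fix r :: real assume r: "0 < r" "r < 1"
    show "\<exists>y. ((\<lambda>r. H r - G M r) has_real_derivative y) (at r) \<and> y \<ge> 0"
      by (rule exI[of _ "S * r powr (q - 1) - (- r) ^ M / fact M * P (Suc M) r"], rule conjI, rule DERIV_diff[OF dH[OF r(1)] dG])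
        (use dGb[OF r] in linarith)
  qed (auto intro: continuous_on_diff cG cH)
  have H: "H 0 = 0" "H 1 = S / q" using q by (auto simp: H_def)
  have "G M 0 = P 0 0"
    unfolding G_def by (subst sum.remove[of _ 0]) (auto intro!: sum.neutral)
  also have "\<dots> = f 0"
    by (simp add: P_def lists_of_length_def cube_mean_def monomial_def measure_unit_cube)
  finally have G0: "G M 0 = f 0" .
  have "\<bar>G M 1\<bar> \<le> (\<Sum>k\<le>M. \<Sum>js\<in>lists_of_length k. l2_norm (iter_partial js f))"
    unfolding G_def
  proof (rule order_trans[OF sum_abs], rule sum_mono)
    fix k
    have "\<bar>(- 1) ^ k / fact k * P k 1\<bar> \<le> 1 * \<bar>P k 1\<bar>"
      unfolding abs_mult by (intro mult_right_mono) (auto simp: power_abs divide_le_eq)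
    also have "\<dots> \<le> (\<Sum>js\<in>lists_of_length k. l2_norm (iter_partial js f))"
      using Pb[of 1 k] by simp
    finally show "\<bar>(- 1) ^ k / fact k * P k 1\<bar> \<le> (\<Sum>js\<in>lists_of_length k. l2_norm (iter_partial js f))" .
  qed
  also have "\<dots> \<le> S" unfolding S_def M by (intro sum_mono2) (auto intro: sum_nonneg)
  finally have "\<bar>G M 1\<bar> \<le> S" .
  \<comment> \<open>The endpoint r = 1 contributes S and the remainder contributes
    \<open>H 1 = S / q\<close>, whence the constant 1 + 1/q.\<close>
  with up down H G0 have "\<bar>f 0\<bar> \<le> S + S / q" by linarith
  then show ?thesis by (simp add: S_def[symmetric] q_def[symmetric] algebra_simps)
qed

lemma sum_l2_norm_le_sobolev:
  fixes f :: "real^'n::finite \<Rightarrow> real"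
  assumes "f \<in> smooth_L2"
  shows "(\<Sum>k\<le>m. \<Sum>js\<in>lists_of_length k. l2_norm (iter_partial js f)) \<le>
    (\<Sum>k\<le>m. real (card (lists_of_length k :: 'n list set))) * sobolev_norm m f"
proof -
  have "(\<Sum>k\<le>m. \<Sum>js\<in>lists_of_length k. l2_norm (iter_partial js f)) \<le>
     (\<Sum>k\<le>m. \<Sum>js\<in>(lists_of_length k :: 'n list set). sobolev_norm m f)"
    by (intro sum_mono l2_norm_iter_partial_le assms) (auto simp: lists_of_length_def)
  then show ?thesis by (simp add: sum_distrib_right)
qed

section \<open>A maximum principle for the Caputo derivative\<close>

lemma has_integral_fractional_kernel:
  fixes t \<beta> \<alpha> :: real
  assumes "t > 0" "\<beta> > -1" "\<alpha> > 0"
  shows "((\<lambda>s. s powr \<beta> * (t - s) powr (\<alpha> - 1)) has_integral t powr (\<beta> + \<alpha>) * Beta (\<beta> + 1) \<alpha>) {0..t}"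
proof -
  have "((\<lambda>x. x powr \<beta> * (1 - x) powr (\<alpha> - 1)) has_integral Beta (\<beta> + 1) \<alpha>) (cbox 0 1)"
    using has_integral_Beta_real[of "\<beta> + 1" \<alpha>] assms by simp
  from has_integral_affinity[OF this, of "1 / t" 0]
  have "((\<lambda>x. (x / t) powr \<beta> * (1 - x / t) powr (\<alpha> - 1)) has_integral t * Beta (\<beta> + 1) \<alpha>) ((\<lambda>x. t * x) ` {0..1})"
    using assms(1) by (simp add: divide_inverse mult.commute)
  also have "(\<lambda>x. t * x) ` {0..1} = {0..t}"
    using assms(1) by (simp add: image_mult_atLeastAtMost)
  finally have "((\<lambda>x. t powr (\<beta> + \<alpha> - 1) * ((x / t) powr \<beta> * (1 - x / t) powr (\<alpha> - 1))) has_integral t powr (\<beta> + \<alpha> - 1) * (t * Beta (\<beta> + 1) \<alpha>)) {0..t}"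
    by (rule has_integral_mult_right)
  moreover have "t powr (\<beta> + \<alpha> - 1) * ((x / t) powr \<beta> * (1 - x / t) powr (\<alpha> - 1)) = x powr \<beta> * (t - x) powr (\<alpha> - 1)"
    if "x \<in> {0..t}" for x
  proof -
    have "1 - x / t = (t - x) / t" using assms(1) by (simp add: diff_divide_distrib)
    then have "(1 - x / t) powr (\<alpha> - 1) = (t - x) powr (\<alpha> - 1) / t powr (\<alpha> - 1)"
      using that assms(1) by (simp add: powr_divide)
    moreover have "(x / t) powr \<beta> = x powr \<beta> / t powr \<beta>"
      using that assms(1) by (simp add: powr_divide)
    moreover have "t powr (\<beta> + \<alpha> - 1) = t powr \<beta> * t powr (\<alpha> - 1)"
      by (simp add: powr_add[symmetric] algebra_simps)
    ultimately show ?thesis using assms(1) by simp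
  qed
  ultimately have "((\<lambda>s. s powr \<beta> * (t - s) powr (\<alpha> - 1)) has_integral t powr (\<beta> + \<alpha> - 1) * (t * Beta (\<beta> + 1) \<alpha>)) {0..t}"
    by (rule has_integral_eq[rotated])
  moreover have "t powr (\<beta> + \<alpha> - 1) * t = t powr (\<beta> + \<alpha>)"
    using assms(1) powr_add[of t "\<beta> + \<alpha> - 1" 1] by simp
  ultimately show ?thesis by (simp add: mult.assoc[symmetric])
qed

lemma fractional_kernel_integrable:
  fixes t \<beta> \<alpha> :: real
  assumes "t \<ge> 0" "\<beta> > -1" "\<alpha> > 0"
  shows "set_integrable lebesgue {0..t} (\<lambda>s. s powr \<beta> / (t - s) powr (1 - \<alpha>))"
    and "(LINT s:{0..t}|lebesgue. s powr \<beta> / (t - s) powr (1 - \<alpha>)) = t powr (\<beta> + \<alpha>) * Beta (\<beta> + 1) \<alpha>"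
proof -
  have eq: "s powr \<beta> / (t - s) powr (1 - \<alpha>) = s powr \<beta> * (t - s) powr (\<alpha> - 1)" for s
    using powr_minus_divide[of "t - s" "1 - \<alpha>"] by (simp add: divide_inverse)
  have hi: "((\<lambda>s. s powr \<beta> * (t - s) powr (\<alpha> - 1)) has_integral t powr (\<beta> + \<alpha>) * Beta (\<beta> + 1) \<alpha>) {0..t}"
  proof (cases "t = 0")
    \<comment> \<open>Both sides vanish for t = 0, since \<open>0 powr x = 0\<close>.\<close>
    case True
    then show ?thesis using has_integral_refl(1)[of "\<lambda>s. s powr \<beta> * (t - s) powr (\<alpha> - 1)" t] by simp
  next
    case False
    then show ?thesis using has_integral_fractional_kernel assms by simp
  qed
  have "(\<lambda>s. s powr \<beta> * (t - s) powr (\<alpha> - 1)) absolutely_integrable_on {0..t}"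
    by (rule nonnegative_absolutely_integrable_1) (use hi in \<open>auto intro: has_integral_integrable\<close>)
  then show "set_integrable lebesgue {0..t} (\<lambda>s. s powr \<beta> / (t - s) powr (1 - \<alpha>))"
    by (simp add: eq)
  then show "(LINT s:{0..t}|lebesgue. s powr \<beta> / (t - s) powr (1 - \<alpha>)) = t powr (\<beta> + \<alpha>) * Beta (\<beta> + 1) \<alpha>"
    unfolding eq using hi by (subst set_lebesgue_integral_eq_integral(2)) (auto simp: integral_unique)
qed

text \<open>Euler's integral restricted to [R, R + 1]. As R is free, Gamma outgrows every geometric
  sequence.\<close>

lemma Gamma_lower_bound:
  fixes x R :: real
  assumes "x \<ge> 1" "R > 0"
  shows "R powr (x - 1) * exp (- (R + 1)) \<le> Gamma x"
proof -
  have "R powr (x - 1) * exp (- (R + 1)) \<le> Gamma x"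
  proof (rule has_integral_le)
    show "((\<lambda>t. if t \<in> {R..R + 1} then R powr (x - 1) * exp (- (R + 1)) else 0) has_integral R powr (x - 1) * exp (- (R + 1))) {0..}"
      using has_integral_const_real[of "R powr (x - 1) * exp (- (R + 1))" R "R + 1"] assms
      by (subst has_integral_restrict) (auto simp: mult.commute)
    show "((\<lambda>t. t powr (x - 1) / exp t) has_integral Gamma x) {0..}"
      using Gamma_integral_real[of x] assms by simp
    fix t :: real assume "t \<in> {0..}"
    show "(if t \<in> {R..R + 1} then R powr (x - 1) * exp (- (R + 1)) else 0) \<le> t powr (x - 1) / exp t"
    proof (cases "t \<in> {R..R + 1}")
      case True
      have "R powr (x - 1) * exp (- (R + 1)) \<le> t powr (x - 1) * exp (- t)"
        using True assms by (intro mult_mono powr_mono2) auto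
      then show ?thesis using True by (simp add: exp_minus divide_inverse)
    next
      case False
      then show ?thesis by (simp only: if_False) simp
    qed
  qed
  then show ?thesis by simp
qed

lemma summable_power_over_Gamma:
  fixes \<alpha> c K :: real
  assumes "\<alpha> > 0" "K \<ge> 0"
  shows "summable (\<lambda>n. K ^ n / Gamma (\<alpha> * real n + c))"
proof -
  \<comment> \<open>With this R the n-th term is at most a multiple of (K / (2 K + 1))^n, and the
    ratio does not exceed 1/2.\<close>
  define R where "R = (2 * K + 1) powr (1 / \<alpha>)"
  have R: "R > 0" using assms by (simp add: R_def)
  have R\<alpha>: "R powr \<alpha> = 2 * K + 1" using assms by (simp add: R_def powr_powr)
  define A where "A = R powr (1 - c) * exp (R + 1)"
  \<comment> \<open>As c is arbitrary, the lower bound for Gamma, and even its sign, is available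
    only once the argument has reached 1.\<close>
  have "\<forall>\<^sub>F n in sequentially. real n \<ge> (1 - c) / \<alpha>"
    by (rule eventually_sequentiallyI[of "nat \<lceil>(1 - c) / \<alpha>\<rceil>"]) linarith
  then have ev: "\<forall>\<^sub>F n in sequentially. norm (K ^ n / Gamma (\<alpha> * real n + c)) \<le> A * (1 / 2) ^ n"
  proof (rule eventually_mono)
    fix n assume "real n \<ge> (1 - c) / \<alpha>"
    then have n: "\<alpha> * real n + c \<ge> 1" using assms by (simp add: field_simps)
    define x where "x = \<alpha> * real n + c"
    have g: "0 < R powr (x - 1) * exp (- (R + 1))" using R by simp
    have G: "R powr (x - 1) * exp (- (R + 1)) \<le> Gamma x" using Gamma_lower_bound[of x R] n R by (simp add: x_def)
    have "K ^ n / Gamma x \<le> K ^ n / (R powr (x - 1) * exp (- (R + 1)))"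
      using G g assms by (intro divide_left_mono) auto
    also have "R powr (x - 1) = (2 * K + 1) ^ n * R powr (c - 1)"
    proof -
      have "R powr (x - 1) = (R powr \<alpha>) powr real n * R powr (c - 1)"
        by (simp add: x_def powr_powr powr_add[symmetric] algebra_simps)
      then show ?thesis using assms by (simp add: R\<alpha> powr_realpow)
    qed
    also have "K ^ n / ((2 * K + 1) ^ n * R powr (c - 1) * exp (- (R + 1))) = A * (K / (2 * K + 1)) ^ n"
    proof -
      have "R powr (1 - c) = inverse (R powr (c - 1))" using powr_minus[of R "c - 1"] by simp
      then show ?thesis
        unfolding A_def power_divide divide_inverse exp_minus[of "R + 1"]
        by (simp only: inverse_mult_distrib inverse_inverse_eq power_mult_distrib power_inverse mult_ac)
    qed
    also have "\<dots> \<le> A * (1 / 2) ^ n"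
      using assms R by (intro mult_left_mono power_mono) (auto simp: A_def divide_le_eq)
    finally have "K ^ n / Gamma x \<le> A * (1 / 2) ^ n" .
    moreover have "0 \<le> K ^ n / Gamma x" using assms G g by (intro divide_nonneg_nonneg) auto
    ultimately show "norm (K ^ n / Gamma (\<alpha> * real n + c)) \<le> A * (1 / 2) ^ n" by (simp add: x_def)
  qed
  show ?thesis
    by (rule summable_comparison_test_ev[OF ev]) (intro summable_mult summable_geometric, simp)
qed

text \<open>The powers in the Mittag-Leffler series. Because \<open>0 powr 0 = 0\<close>, the form
  \<open>t powr (\<alpha> * real k)\<close> would give 0 at t = 0, k = 0, whereas
  \<open>(t powr \<alpha>) ^ k\<close> gives 1.\<close>

definition frac_power :: "real \<Rightarrow> nat \<Rightarrow> real \<Rightarrow> real" where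
  "frac_power \<alpha> k t = (t powr \<alpha>) ^ k / Gamma (\<alpha> * real k + 1)"

lemma frac_power_0 [simp]: "frac_power \<alpha> 0 t = 1"
  by (simp add: frac_power_def)

lemma frac_power_at_0 [simp]: "frac_power \<alpha> (Suc k) 0 = 0"
  by (simp add: frac_power_def)

lemma frac_power_powr:
  assumes "s \<ge> 0" "k > 0" shows "frac_power \<alpha> k s = s powr (\<alpha> * real k) / Gamma (\<alpha> * real k + 1)"
proof (cases "s = 0")
  case False
  then have "(s powr \<alpha>) ^ k = s powr (\<alpha> * real k)"
    using assms by (simp add: powr_realpow[symmetric] powr_powr)
  then show ?thesis by (simp add: frac_power_def)
qed (use assms in \<open>simp add: frac_power_def\<close>)

lemma Gamma_frac_pos: "\<alpha> > 0 \<Longrightarrow> Gamma (\<alpha> * real k + 1) > 0"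
  by (intro Gamma_real_pos) (simp add: add_nonneg_pos)

lemma frac_power_nonneg: "\<alpha> > 0 \<Longrightarrow> frac_power \<alpha> k t \<ge> 0"
  unfolding frac_power_def using Gamma_frac_pos[of \<alpha> k] by simp

lemma frac_power_mono: "\<alpha> > 0 \<Longrightarrow> 0 \<le> s \<Longrightarrow> s \<le> t \<Longrightarrow> frac_power \<alpha> k s \<le> frac_power \<alpha> k t"
  unfolding frac_power_def using Gamma_frac_pos[of \<alpha> k]
  by (intro divide_right_mono power_mono powr_mono2) auto

lemma frac_power_continuous: "\<alpha> > 0 \<Longrightarrow> continuous_on {0..} (frac_power \<alpha> k)"
  unfolding frac_power_def[abs_def]
  using Gamma_frac_pos[of \<alpha> k] by (intro continuous_intros continuous_on_powr') auto

lemma frac_power_summable: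
  assumes "\<alpha> > 0" "K \<ge> 0" shows "summable (\<lambda>k. K ^ k * frac_power \<alpha> k t)"
  using summable_power_over_Gamma[OF assms(1), of "K * t powr \<alpha>" 1] assms(2)
  by (simp add: frac_power_def power_mult_distrib)

text \<open>Fractional integration of order \<alpha> raises the index by one: the Beta integral
  supplies exactly the missing quotient of Gamma values.\<close>

lemma frac_power_integral:
  assumes \<alpha>: "\<alpha> > 0" and t: "t \<ge> 0"
  shows "set_integrable lebesgue {0..t} (\<lambda>s. frac_power \<alpha> k s / (t - s) powr (1 - \<alpha>))"
    and "1 / Gamma \<alpha> * (LINT s:{0..t}|lebesgue. frac_power \<alpha> k s / (t - s) powr (1 - \<alpha>)) = frac_power \<alpha> (Suc k) t"
proof -
  define \<beta> where "\<beta> = \<alpha> * real k"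
  define G where "G = Gamma (\<beta> + 1)"
  have \<beta>: "\<beta> > -1" using \<alpha> by (simp add: \<beta>_def add.commute less_le_trans[of _ 0])
  note f = fractional_kernel_integrable[OF t \<beta> \<alpha>]
  have pos: "G > 0" "Gamma \<alpha> > 0" "Gamma (\<beta> + 1 + \<alpha>) > 0" using \<alpha> \<beta> by (auto simp: G_def intro!: Gamma_real_pos)
  \<comment> \<open>For k = 0 the two integrands differ at the point s = 0.\<close>
  have AE: "AE s in lebesgue. indicator {0..t} s *\<^sub>R (frac_power \<alpha> k s / (t - s) powr (1 - \<alpha>)) = (1 / G) * (indicator {0..t} s *\<^sub>R (s powr \<beta> / (t - s) powr (1 - \<alpha>)))"
  proof (rule AE_mp[OF AE_completion[OF AE_lborel_singleton[of 0]]], intro AE_I2 impI)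
    fix s :: real assume s: "s \<noteq> 0"
    show "indicator {0..t} s *\<^sub>R (frac_power \<alpha> k s / (t - s) powr (1 - \<alpha>)) = (1 / G) * (indicator {0..t} s *\<^sub>R (s powr \<beta> / (t - s) powr (1 - \<alpha>)))"
    proof (cases "s \<in> {0..t}")
      case True
      then have "frac_power \<alpha> k s = s powr \<beta> / G"
        using s frac_power_powr[of s k \<alpha>] by (cases "k = 0") (auto simp: \<beta>_def G_def)
      then show ?thesis using True by simp
    qed simp
  qed
  have m: "(\<lambda>s. indicator {0..t} s *\<^sub>R (frac_power \<alpha> k s / (t - s) powr (1 - \<alpha>))) \<in> borel_measurable lebesgue"
    by (intro measurable_completion) (simp add: frac_power_def[abs_def])
  have i: "integrable lebesgue (\<lambda>s. (1 / G) * (indicator {0..t} s *\<^sub>R (s powr \<beta> / (t - s) powr (1 - \<alpha>))))"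
    using f(1) unfolding set_integrable_def by (intro integrable_mult_right)
  show "set_integrable lebesgue {0..t} (\<lambda>s. frac_power \<alpha> k s / (t - s) powr (1 - \<alpha>))"
    unfolding set_integrable_def
    by (subst integrable_cong_AE[OF m borel_measurable_integrable[OF i] AE]) (rule i)
  have "(LINT s:{0..t}|lebesgue. frac_power \<alpha> k s / (t - s) powr (1 - \<alpha>)) = 
     (LINT s|lebesgue. (1 / G) * (indicator {0..t} s *\<^sub>R (s powr \<beta> / (t - s) powr (1 - \<alpha>))))"
    unfolding set_lebesgue_integral_def
    by (rule integral_cong_AE[OF m borel_measurable_integrable[OF i] AE])
  also have "\<dots> = (1 / G) * (t powr (\<beta> + \<alpha>) * Beta (\<beta> + 1) \<alpha>)"
    using f(2) unfolding set_lebesgue_integral_def by (subst integral_mult_right_zero) simp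
  also have "\<dots> = t powr (\<beta> + \<alpha>) * (Gamma \<alpha> / Gamma (\<beta> + 1 + \<alpha>))"
    using pos by (simp add: Beta_def G_def[symmetric])
  finally have "1 / Gamma \<alpha> * (LINT s:{0..t}|lebesgue. frac_power \<alpha> k s / (t - s) powr (1 - \<alpha>)) = t powr (\<beta> + \<alpha>) / Gamma (\<beta> + 1 + \<alpha>)"
    using pos by simp
  then show "1 / Gamma \<alpha> * (LINT s:{0..t}|lebesgue. frac_power \<alpha> k s / (t - s) powr (1 - \<alpha>)) = frac_power \<alpha> (Suc k) t"
    using frac_power_powr[OF t, of "Suc k" \<alpha>] by (simp add: \<beta>_def algebra_simps)
qed

text \<open>Marchaud's form of the Caputo derivative of \<open>s\<^sup>\<beta>\<close>, obtained by integrating the derivative of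
  \<open>(t\<^sup>\<beta> - s\<^sup>\<beta>) (t - s)\<^sup>-\<^sup>\<alpha>\<close>.\<close>

lemma Marchaud_power:
  fixes t \<beta> \<alpha> :: real
  assumes t: "t > 0" and \<beta>: "\<beta> > 0" and \<alpha>: "0 < \<alpha>" "\<alpha> < 1"
  shows "((\<lambda>s. \<alpha> * (t powr \<beta> - s powr \<beta>) * (t - s) powr (- \<alpha> - 1)) has_integral
    t powr (\<beta> - \<alpha>) * (Gamma (\<beta> + 1) * Gamma (1 - \<alpha>) / Gamma (\<beta> + 1 - \<alpha>) - 1)) {0..t}"
proof -
  define F where "F s = (t powr \<beta> - s powr \<beta>) * (t - s) powr (- \<alpha>)" for s
  have cont: "continuous_on {0..t} F"
    unfolding continuous_on_def
  proof
    fix x assume x: "x \<in> {0..t}"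
    show "(F \<longlongrightarrow> F x) (at x within {0..t})"
    proof (cases "x = t")
      case False
      then have "t - x \<noteq> 0" by simp
      moreover have "x \<noteq> 0 \<or> 0 < \<beta> \<and> (\<forall>\<^sub>F s in at x within {0..t}. 0 \<le> s)"
        using \<beta> by (auto simp: eventually_at_filter)
      ultimately show ?thesis
        unfolding F_def
        by (intro tendsto_mult tendsto_diff tendsto_const tendsto_powr' tendsto_ident_at) auto
    next
      case True
      \<comment> \<open>Near s = t, F is a difference quotient of \<open>s powr \<beta>\<close>
        times \<open>(t - s) powr (1 - \<alpha>)\<close>, and the second factor tends to 0 because
        \<alpha> < 1.\<close>
      have "((\<lambda>s. s powr \<beta>) has_real_derivative \<beta> * t powr (\<beta> - 1)) (at t)"
        using t by (auto intro!: derivative_eq_intros)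
      from has_field_derivative_at_within[OF this, of "{0..t}"]
      have "((\<lambda>s. (s powr \<beta> - t powr \<beta>) / (s - t)) \<longlongrightarrow> \<beta> * t powr (\<beta> - 1)) (at t within {0..t})"
        by (simp only: has_field_derivative_iff)
      moreover have "((\<lambda>s. (t - s) powr (1 - \<alpha>)) \<longlongrightarrow> (t - t) powr (1 - \<alpha>)) (at t within {0..t})"
      proof (rule tendsto_powr'[OF tendsto_diff[OF tendsto_const tendsto_ident_at] tendsto_const])
        show "t - t \<noteq> 0 \<or> 0 < 1 - \<alpha> \<and> (\<forall>\<^sub>F s in at t within {0..t}. 0 \<le> t - s)"
          using \<alpha> by (auto simp: eventually_at_filter)
      qed
      ultimately have "((\<lambda>s. (s powr \<beta> - t powr \<beta>) / (s - t) * (t - s) powr (1 - \<alpha>)) \<longlongrightarrow> \<beta> * t powr (\<beta> - 1) * (t - t) powr (1 - \<alpha>)) (at t within {0..t})"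
        by (rule tendsto_mult)
      then have lim: "((\<lambda>s. (s powr \<beta> - t powr \<beta>) / (s - t) * (t - s) powr (1 - \<alpha>)) \<longlongrightarrow> F t) (at t within {0..t})"
        by (simp add: F_def)
      have e: "(s powr \<beta> - t powr \<beta>) / (s - t) * (t - s) powr (1 - \<alpha>) = F s" if "s \<in> {0..t}" "s \<noteq> t" for s
      proof -
        have "(t - s) powr (1 - \<alpha>) = (t - s) * (t - s) powr (- \<alpha>)"
          using that powr_add[of "t - s" 1 "- \<alpha>"] by simp
        moreover have "(s powr \<beta> - t powr \<beta>) / (s - t) = (t powr \<beta> - s powr \<beta>) / (t - s)"
          by (metis minus_diff_eq minus_divide_divide)
        ultimately show ?thesis using that by (simp add: F_def)
      qed
      show ?thesis unfolding True
        by (rule Lim_transform_eventually[OF lim]) (use e in \<open>auto simp: eventually_at_filter\<close>)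
    qed
  qed
  have der: "(F has_vector_derivative (- \<beta> * (s powr (\<beta> - 1) * (t - s) powr (1 - \<alpha> - 1)) + \<alpha> * (t powr \<beta> - s powr \<beta>) * (t - s) powr (- \<alpha> - 1))) (at s)"
    if "s \<in> {0<..<t}" for s
    unfolding F_def[abs_def] has_real_derivative_iff_has_vector_derivative[symmetric] using that
    by (auto intro!: derivative_eq_intros simp: algebra_simps)
  have "((\<lambda>s. - \<beta> * (s powr (\<beta> - 1) * (t - s) powr (1 - \<alpha> - 1)) + \<alpha> * (t powr \<beta> - s powr \<beta>) * (t - s) powr (- \<alpha> - 1)) has_integral F t - F 0) {0..t}"
    by (rule fundamental_theorem_of_calculus_interior) (use t cont der in auto)
  moreover have "((\<lambda>s. \<beta> * (s powr (\<beta> - 1) * (t - s) powr (1 - \<alpha> - 1))) has_integral \<beta> * (t powr (\<beta> - 1 + (1 - \<alpha>)) * Beta (\<beta> - 1 + 1) (1 - \<alpha>))) {0..t}"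
    by (intro has_integral_mult_right has_integral_fractional_kernel) (use assms in auto)
  ultimately have "((\<lambda>s. (- \<beta> * (s powr (\<beta> - 1) * (t - s) powr (1 - \<alpha> - 1)) + \<alpha> * (t powr \<beta> - s powr \<beta>) * (t - s) powr (- \<alpha> - 1)) + \<beta> * (s powr (\<beta> - 1) * (t - s) powr (1 - \<alpha> - 1)))
     has_integral (F t - F 0) + \<beta> * (t powr (\<beta> - 1 + (1 - \<alpha>)) * Beta (\<beta> - 1 + 1) (1 - \<alpha>))) {0..t}"
    by (rule has_integral_add)
  moreover have "(F t - F 0) + \<beta> * (t powr (\<beta> - 1 + (1 - \<alpha>)) * Beta (\<beta> - 1 + 1) (1 - \<alpha>)) = t powr (\<beta> - \<alpha>) * (Gamma (\<beta> + 1) * Gamma (1 - \<alpha>) / Gamma (\<beta> + 1 - \<alpha>) - 1)"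
  proof -
    \<comment> \<open>The endpoint s = 0 contributes the -1 of the formula.\<close>
    have "F 0 = t powr (\<beta> - \<alpha>)" using t \<beta> by (simp add: F_def powr_add[symmetric])
    moreover have "F t = 0" by (simp add: F_def)
    moreover have "Gamma (\<beta> + 1) = \<beta> * Gamma \<beta>" using \<beta> by (intro Gamma_plus1) (auto elim!: nonpos_Ints_cases)
    ultimately show ?thesis by (simp add: Beta_def algebra_simps)
  qed
  ultimately show ?thesis by simp
qed

text \<open>Marchaud's formula expresses Gamma(1 - \<alpha>) times the Caputo derivative at t as
  t^(-\<alpha>) times the increment since time 0, plus an integral of q(t) - q(s) against the
  positive weight w. At a maximum the integral is nonnegative. The sum on the right is the Caputo
  derivative itself, which lowers the index of \<open>frac_power\<close>.\<close>

lemma Caputo_maximum_principle: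
  fixes b :: "nat \<Rightarrow> real"
  assumes \<alpha>: "0 < \<alpha>" "\<alpha> < 1" and t: "t > 0"
    and max: "\<And>s. 0 \<le> s \<Longrightarrow> s \<le> t \<Longrightarrow> (\<Sum>k\<le>n. b k * frac_power \<alpha> k s) \<le> (\<Sum>k\<le>n. b k * frac_power \<alpha> k t)"
  shows "(\<Sum>k\<le>n. b k * frac_power \<alpha> k t) - b 0 \<le> Gamma (1 - \<alpha>) * t powr \<alpha> * (\<Sum>k<n. b (Suc k) * frac_power \<alpha> k t)"
proof -
  define w where "w s = \<alpha> * (t - s) powr (- \<alpha> - 1)" for s
  have w: "w s \<ge> 0" for s using \<alpha> by (simp add: w_def)
  have int1: "((\<lambda>s. w s * (frac_power \<alpha> (Suc k) t - frac_power \<alpha> (Suc k) s)) has_integral (frac_power \<alpha> k t * Gamma (1 - \<alpha>) - t powr (- \<alpha>) * frac_power \<alpha> (Suc k) t)) {0..t}" for k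
  proof -
    define \<beta> where "\<beta> = \<alpha> * real (Suc k)"
    have \<beta>: "\<beta> > 0" using \<alpha> by (simp add: \<beta>_def)
    have G: "Gamma (\<beta> + 1) > 0" using \<beta> by simp
    have g: "\<beta> + 1 - \<alpha> = \<alpha> * real k + 1" by (simp add: \<beta>_def algebra_simps)
    have fp: "frac_power \<alpha> (Suc k) s = s powr \<beta> / Gamma (\<beta> + 1)" if "s \<ge> 0" for s
      using frac_power_powr[OF that, of "Suc k" \<alpha>] by (simp add: \<beta>_def)
    have fk: "t powr (\<beta> - \<alpha>) = (t powr \<alpha>) ^ k"
      using t by (simp add: \<beta>_def powr_realpow[symmetric] powr_powr algebra_simps)
    from has_integral_mult_right[OF Marchaud_power[OF t \<beta> \<alpha>], of "1 / Gamma (\<beta> + 1)"]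
    have "((\<lambda>s. 1 / Gamma (\<beta> + 1) * (\<alpha> * (t powr \<beta> - s powr \<beta>) * (t - s) powr (- \<alpha> - 1))) has_integral
      1 / Gamma (\<beta> + 1) * (t powr (\<beta> - \<alpha>) * (Gamma (\<beta> + 1) * Gamma (1 - \<alpha>) / Gamma (\<beta> + 1 - \<alpha>) - 1))) {0..t}" .
    moreover have "1 / Gamma (\<beta> + 1) * (\<alpha> * (t powr \<beta> - s powr \<beta>) * (t - s) powr (- \<alpha> - 1)) = w s * (frac_power \<alpha> (Suc k) t - frac_power \<alpha> (Suc k) s)"
      if "s \<in> {0..t}" for s
    proof -
      have "frac_power \<alpha> (Suc k) t - frac_power \<alpha> (Suc k) s = (t powr \<beta> - s powr \<beta>) / Gamma (\<beta> + 1)"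
        using that t by (simp only: fp atLeastAtMost_iff less_imp_le diff_divide_distrib)
      then show ?thesis by (simp only: w_def) simp
    qed
    ultimately have "((\<lambda>s. w s * (frac_power \<alpha> (Suc k) t - frac_power \<alpha> (Suc k) s)) has_integral
      1 / Gamma (\<beta> + 1) * (t powr (\<beta> - \<alpha>) * (Gamma (\<beta> + 1) * Gamma (1 - \<alpha>) / Gamma (\<beta> + 1 - \<alpha>) - 1))) {0..t}"
      by (rule has_integral_eq[rotated])
    moreover have "1 / Gamma (\<beta> + 1) * (t powr (\<beta> - \<alpha>) * (Gamma (\<beta> + 1) * Gamma (1 - \<alpha>) / Gamma (\<beta> + 1 - \<alpha>) - 1))
      = frac_power \<alpha> k t * Gamma (1 - \<alpha>) - t powr (- \<alpha>) * frac_power \<alpha> (Suc k) t"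
    proof -
      have "t powr (- \<alpha>) * frac_power \<alpha> (Suc k) t = t powr (\<beta> - \<alpha>) / Gamma (\<beta> + 1)"
        using t fp[of t] by (simp add: powr_add[symmetric] add.commute)
      moreover have "frac_power \<alpha> k t = t powr (\<beta> - \<alpha>) / Gamma (\<beta> + 1 - \<alpha>)"
        by (simp only: frac_power_def fk g)
      ultimately show ?thesis using G by (simp add: right_diff_distrib)
    qed
    ultimately show ?thesis by simp
  qed
  define q where "q s = (\<Sum>k\<le>n. b k * frac_power \<alpha> k s)" for s
  have q: "q s = b 0 + (\<Sum>k<n. b (Suc k) * frac_power \<alpha> (Suc k) s)" for s
    unfolding q_def using sum.atMost_shift[of "\<lambda>k. b k * frac_power \<alpha> k s" n] by simp
  have "((\<lambda>s. \<Sum>k<n. b (Suc k) * (w s * (frac_power \<alpha> (Suc k) t - frac_power \<alpha> (Suc k) s))) has_integral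
     (\<Sum>k<n. b (Suc k) * (frac_power \<alpha> k t * Gamma (1 - \<alpha>) - t powr (- \<alpha>) * frac_power \<alpha> (Suc k) t))) {0..t}"
    by (intro has_integral_sum has_integral_mult_right int1) simp
  moreover have "(\<Sum>k<n. b (Suc k) * (w s * (frac_power \<alpha> (Suc k) t - frac_power \<alpha> (Suc k) s))) = w s * (q t - q s)" for s
  proof -
    have "q t - q s = (\<Sum>k<n. b (Suc k) * (frac_power \<alpha> (Suc k) t - frac_power \<alpha> (Suc k) s))"
      by (simp only: q add_diff_cancel_left sum_subtractf[symmetric] right_diff_distrib[symmetric])
    then show ?thesis by (simp only: sum_distrib_left mult.left_commute)
  qed
  moreover have "(\<Sum>k<n. b (Suc k) * (frac_power \<alpha> k t * Gamma (1 - \<alpha>) - t powr (- \<alpha>) * frac_power \<alpha> (Suc k) t)) =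
     Gamma (1 - \<alpha>) * (\<Sum>k<n. b (Suc k) * frac_power \<alpha> k t) - t powr (- \<alpha>) * (q t - b 0)"
  proof -
    have "q t - b 0 = (\<Sum>k<n. b (Suc k) * frac_power \<alpha> (Suc k) t)" by (simp only: q add_diff_cancel_left')
    then have "Gamma (1 - \<alpha>) * (\<Sum>k<n. b (Suc k) * frac_power \<alpha> k t) - t powr (- \<alpha>) * (q t - b 0)
       = (\<Sum>k<n. Gamma (1 - \<alpha>) * (b (Suc k) * frac_power \<alpha> k t) - t powr (- \<alpha>) * (b (Suc k) * frac_power \<alpha> (Suc k) t))"
      by (simp only: sum_distrib_left sum_subtractf)
    also have "\<dots> = (\<Sum>k<n. b (Suc k) * (frac_power \<alpha> k t * Gamma (1 - \<alpha>) - t powr (- \<alpha>) * frac_power \<alpha> (Suc k) t))"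
      by (intro sum.cong refl) (simp only: right_diff_distrib mult_ac)
    finally show ?thesis by simp
  qed
  ultimately have "((\<lambda>s. w s * (q t - q s)) has_integral Gamma (1 - \<alpha>) * (\<Sum>k<n. b (Suc k) * frac_power \<alpha> k t) - t powr (- \<alpha>) * (q t - b 0)) {0..t}"
    by simp
  from has_integral_nonneg[OF this]
  have "t powr (- \<alpha>) * (q t - b 0) \<le> Gamma (1 - \<alpha>) * (\<Sum>k<n. b (Suc k) * frac_power \<alpha> k t)"
    using max w by (simp add: q_def)
  then have le: "t powr \<alpha> * (t powr (- \<alpha>) * (q t - b 0)) \<le> t powr \<alpha> * (Gamma (1 - \<alpha>) * (\<Sum>k<n. b (Suc k) * frac_power \<alpha> k t))"
    by (intro mult_left_mono) auto
  have "t powr \<alpha> * t powr (- \<alpha>) = 1" using t by (simp add: powr_add[symmetric])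
  then have e: "t powr \<alpha> * (t powr (- \<alpha>) * (q t - b 0)) = q t - b 0"
    by (simp only: mult.assoc[symmetric] mult_1)
  have "q t - b 0 \<le> Gamma (1 - \<alpha>) * t powr \<alpha> * (\<Sum>k<n. b (Suc k) * frac_power \<alpha> k t)"
    using le unfolding e by (simp only: mult.assoc mult.left_commute)
  then show ?thesis by (simp only: q_def)
qed

section \<open>The energy estimate\<close>

definition ellop :: "real \<Rightarrow> real \<Rightarrow> (real^'n::finite \<Rightarrow> real) \<Rightarrow> real^'n \<Rightarrow> real" where
  "ellop d a f = (\<lambda>x. d * laplacian f x + a * f x)"

lemma smooth_laplacian: "smooth f \<Longrightarrow> smooth (laplacian f)"
  unfolding laplacian_eq by (intro smooth_sum smooth_iter_partial)

lemma iter_partial_laplacian: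
  assumes "smooth f" shows "iter_partial js (laplacian f) = laplacian (iter_partial js f)"
  unfolding laplacian_eq
  by (simp only: iter_partial_sum smooth_iter_partial[OF assms] iter_partial_swap[OF assms, of js])

lemma iter_partial_ellop:
  assumes "smooth f" shows "iter_partial js (ellop d a f) = ellop d a (iter_partial js f)"
  unfolding ellop_def
  by (simp only: iter_partial_add iter_partial_cmult smooth_cmult smooth_laplacian iter_partial_laplacian assms)

lemma smooth_L2_laplacian: "f \<in> smooth_L2 \<Longrightarrow> laplacian f \<in> smooth_L2"
  unfolding laplacian_eq by (intro smooth_L2_sum smooth_L2_iter_partial)

lemma smooth_L2_ellop: "f \<in> smooth_L2 \<Longrightarrow> ellop d a f \<in> smooth_L2"
  unfolding ellop_def by (intro smooth_L2_add smooth_L2_cmult smooth_L2_laplacian)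

lemma laplacian_add: "smooth f \<Longrightarrow> smooth g \<Longrightarrow> laplacian (\<lambda>x. f x + g x) = (\<lambda>x. laplacian f x + laplacian g x)"
  by (simp only: laplacian_eq iter_partial_add sum.distrib)

lemma laplacian_cmult: "smooth f \<Longrightarrow> laplacian (\<lambda>x. c * f x) = (\<lambda>x. c * laplacian f x)"
  by (simp only: laplacian_eq iter_partial_cmult sum_distrib_left)

lemma ellop_add: "smooth f \<Longrightarrow> smooth g \<Longrightarrow> ellop d a (\<lambda>x. f x + g x) = (\<lambda>x. ellop d a f x + ellop d a g x)"
  by (simp only: ellop_def laplacian_add distrib_left add_ac)

lemma ellop_cmult: "smooth f \<Longrightarrow> ellop d a (\<lambda>x. c * f x) = (\<lambda>x. c * ellop d a f x)"
  by (simp only: ellop_def laplacian_cmult distrib_left mult.left_commute[of c])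

lemma smooth_L2_ellop_pow: "f \<in> smooth_L2 \<Longrightarrow> (ellop d a ^^ k) f \<in> smooth_L2"
  by (induction k) (auto simp: smooth_L2_ellop)

lemma iter_partial_ellop_pow:
  assumes "f \<in> smooth_L2" shows "iter_partial js ((ellop d a ^^ k) f) = (ellop d a ^^ k) (iter_partial js f)"
  by (induction k) (use iter_partial_ellop[OF smooth_L2_smooth[OF smooth_L2_ellop_pow[OF assms]]] in auto)

lemma ellop_pow_add:
  assumes "f \<in> smooth_L2" "g \<in> smooth_L2"
  shows "(ellop d a ^^ k) (\<lambda>x. f x + g x) = (\<lambda>x. (ellop d a ^^ k) f x + (ellop d a ^^ k) g x)"
  by (induction k) (auto simp: ellop_add assms smooth_L2_smooth smooth_L2_ellop_pow)

lemma ellop_pow_cmult: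
  assumes "f \<in> smooth_L2"
  shows "(ellop d a ^^ k) (\<lambda>x. c * f x) = (\<lambda>x. c * (ellop d a ^^ k) f x)"
  by (induction k) (auto simp: ellop_cmult assms smooth_L2_smooth smooth_L2_ellop_pow)

text \<open>After integration by parts each second derivative contributes minus the squared norm of
  a first derivative.\<close>

lemma ellop_dissipative:
  fixes f :: "real^'n::finite \<Rightarrow> real"
  assumes f: "f \<in> smooth_L2" and d: "d \<ge> 0"
  shows "(LINT x|lborel. f x * ellop d a f x) \<le> a * (l2_norm f)\<^sup>2"
proof -
  have ii: "(LINT x|lborel. f x * iter_partial [i, i] f x) \<le> 0" for i
  proof -
    have "(LINT x|lborel. f x * iter_partial [i, i] f x) = - (LINT x|lborel. partial_deriv i f x * partial_deriv i f x)"
      unfolding iter_partial_Cons iter_partial_Nil by (rule smooth_L2_by_parts[OF f smooth_L2_partial[OF f]])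
    then show ?thesis by simp
  qed
  note i = L2_integrable_mult[OF smooth_L2_L2[OF f] smooth_L2_iter_L2[OF f]]
  have "(LINT x|lborel. f x * ellop d a f x) = (LINT x|lborel. (\<Sum>i\<in>UNIV. d * (f x * iter_partial [i, i] f x)) + a * (f x)\<^sup>2)"
    by (intro Bochner_Integration.integral_cong refl)
      (simp only: ellop_def laplacian_eq distrib_left sum_distrib_left mult.left_commute power2_eq_square)
  also have "\<dots> = (LINT x|lborel. (\<Sum>i\<in>UNIV. d * (f x * iter_partial [i, i] f x))) + (LINT x|lborel. a * (f x)\<^sup>2)"
    by (intro Bochner_Integration.integral_add Bochner_Integration.integrable_sum integrable_mult_right i L2_integrable_sq smooth_L2_L2 f)
  also have "(LINT x|lborel. (\<Sum>i\<in>UNIV. d * (f x * iter_partial [i, i] f x))) = (\<Sum>i\<in>UNIV. (LINT x|lborel. d * (f x * iter_partial [i, i] f x)))"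
    by (intro Bochner_Integration.integral_sum integrable_mult_right i)
  also have "\<dots> = (\<Sum>i\<in>UNIV. d * (LINT x|lborel. f x * iter_partial [i, i] f x))"
    by (simp only: integral_mult_right_zero)
  also have "(LINT x|lborel. a * (f x)\<^sup>2) = a * (l2_norm f)\<^sup>2"
    by (simp only: integral_mult_right_zero l2_norm_sq)
  also have "(\<Sum>i\<in>UNIV. d * (LINT x|lborel. f x * iter_partial [i, i] f x)) \<le> 0"
    by (intro sum_nonpos mult_nonneg_nonpos d ii)
  finally show ?thesis by simp
qed

text \<open>The constants are uniform in k and js: each application of \<open>ellop\<close> costs a
  fixed factor and leaves the bandwidth unchanged.\<close>

lemma bandlimited_ellop_pow:
  fixes f :: "real^'n::finite \<Rightarrow> real"
  assumes "f \<in> bandlimited"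
  obtains C \<kappa> K where "C \<ge> 0" "\<kappa> \<ge> 0" "K \<ge> 0"
    "\<And>k js. l2_norm (iter_partial js ((ellop d a ^^ k) f)) \<le> C * \<kappa> ^ k * K ^ length js"
proof -
  obtain C K where ck: "C \<ge> 0" "K \<ge> 0" "\<And>js. l2_norm (iter_partial js f) \<le> C * K ^ length js"
    using assms unfolding bandlimited_def by blast
  note f = bandlimited_smooth_L2[OF assms]
  \<comment> \<open>Each of the \<open>CARD('n)\<close> pure second derivatives costs K^2.\<close>
  define \<kappa> where "\<kappa> = \<bar>d\<bar> * (real CARD('n) * K\<^sup>2) + \<bar>a\<bar>"
  have \<kappa>: "\<kappa> \<ge> 0" by (simp add: \<kappa>_def)
  have "l2_norm (iter_partial js ((ellop d a ^^ k) f)) \<le> C * \<kappa> ^ k * K ^ length js" for k js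
  proof (induction k arbitrary: js)
    case 0
    then show ?case using ck by simp
  next
    case (Suc k)
    define g where "g = (ellop d a ^^ k) f"
    have g: "g \<in> smooth_L2" unfolding g_def by (rule smooth_L2_ellop_pow[OF f])
    note gi = smooth_L2_iter_L2[OF g]
    have e: "iter_partial js ((ellop d a ^^ Suc k) f) = (\<lambda>x. d * (\<Sum>i\<in>UNIV. iter_partial ([i, i] @ js) g x) + a * iter_partial js g x)"
      using iter_partial_ellop[OF smooth_L2_smooth[OF g], of js d a]
      unfolding ellop_def[of d a "iter_partial js g"] laplacian_eq iter_partial_append
      by (simp only: g_def funpow.simps comp_apply)
    have "l2_norm (iter_partial js ((ellop d a ^^ Suc k) f)) \<le>
        l2_norm (\<lambda>x. d * (\<Sum>i\<in>UNIV. iter_partial ([i, i] @ js) g x)) + l2_norm (\<lambda>x. a * iter_partial js g x)"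
      unfolding e by (intro l2_norm_triangle L2_cmult L2_sum gi)
    also have "\<dots> \<le> \<bar>d\<bar> * (\<Sum>i\<in>(UNIV :: 'n set). C * \<kappa> ^ k * K ^ length ([i, i] @ js)) + \<bar>a\<bar> * (C * \<kappa> ^ k * K ^ length js)"
      unfolding l2_norm_cmult
      by (intro add_mono mult_left_mono order_trans[OF l2_norm_sum_le] sum_mono gi) (use Suc.IH in \<open>auto simp only: g_def abs_ge_zero\<close>)
    also have "\<dots> = C * \<kappa> ^ Suc k * K ^ length js"
      by (simp add: \<kappa>_def power2_eq_square algebra_simps)
    finally show ?case .
  qed
  with ck \<kappa> that show ?thesis by blast
qed

lemma bandlimited_add:
  assumes "f \<in> bandlimited" "g \<in> bandlimited" shows "(\<lambda>x. f x + g x) \<in> bandlimited"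
proof -
  obtain C K where ck: "C \<ge> 0" "K \<ge> 0" "\<And>js. l2_norm (iter_partial js f) \<le> C * K ^ length js"
    using assms(1) unfolding bandlimited_def by blast
  obtain C' K' where ck': "C' \<ge> 0" "K' \<ge> 0" "\<And>js. l2_norm (iter_partial js g) \<le> C' * K' ^ length js"
    using assms(2) unfolding bandlimited_def by blast
  note fg = bandlimited_smooth_L2[OF assms(1)] bandlimited_smooth_L2[OF assms(2)]
  have "l2_norm (iter_partial js (\<lambda>x. f x + g x)) \<le> (C + C') * (max K K') ^ length js" for js
  proof -
    have "l2_norm (iter_partial js (\<lambda>x. f x + g x)) \<le> l2_norm (iter_partial js f) + l2_norm (iter_partial js g)"
      unfolding iter_partial_add[OF fg[THEN smooth_L2_smooth]]
      by (rule l2_norm_triangle[OF fg[THEN smooth_L2_iter_L2]])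
    also have "\<dots> \<le> C * (max K K') ^ length js + C' * (max K K') ^ length js"
      using ck ck' by (intro add_mono order_trans[OF ck(3)] order_trans[OF ck'(3)] mult_left_mono power_mono) auto
    finally show ?thesis by (simp add: algebra_simps)
  qed
  moreover have "C + C' \<ge> 0" "max K K' \<ge> 0" using ck ck' by auto
  moreover have "(\<lambda>x. f x + g x) \<in> smooth_L2" by (rule smooth_L2_add[OF fg])
  ultimately show ?thesis unfolding bandlimited_def smooth_L2_def by blast
qed

lemma bandlimited_cmult:
  assumes "f \<in> bandlimited" shows "(\<lambda>x. c * f x) \<in> bandlimited"
proof -
  obtain C K where ck: "C \<ge> 0" "K \<ge> 0" "\<And>js. l2_norm (iter_partial js f) \<le> C * K ^ length js"
    using assms(1) unfolding bandlimited_def by blast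
  note f = bandlimited_smooth_L2[OF assms(1)]
  have "l2_norm (iter_partial js (\<lambda>x. c * f x)) \<le> (\<bar>c\<bar> * C) * K ^ length js" for js
    unfolding iter_partial_cmult[OF smooth_L2_smooth[OF f]] l2_norm_cmult
    using mult_left_mono[OF ck(3), of "\<bar>c\<bar>"] by (simp add: mult.assoc)
  moreover have "\<bar>c\<bar> * C \<ge> 0" using ck by auto
  moreover have "(\<lambda>x. c * f x) \<in> smooth_L2" by (rule smooth_L2_cmult[OF f])
  ultimately show ?thesis using ck(2) unfolding bandlimited_def smooth_L2_def by blast
qed

lemma bandlimited_diff:
  assumes "f \<in> bandlimited" "g \<in> bandlimited" shows "(\<lambda>x. f x - g x) \<in> bandlimited"
  using bandlimited_add[OF assms(1) bandlimited_cmult[OF assms(2), of "-1"]] by simp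

lemma bandlimited_iter_partial:
  assumes "f \<in> bandlimited" shows "iter_partial js f \<in> bandlimited"
proof -
  obtain C K where ck: "C \<ge> 0" "K \<ge> 0" "\<And>js. l2_norm (iter_partial js f) \<le> C * K ^ length js"
    using assms unfolding bandlimited_def by blast
  have "l2_norm (iter_partial ks (iter_partial js f)) \<le> (C * K ^ length js) * K ^ length ks" for ks
    using ck(3)[of "ks @ js"] by (simp add: iter_partial_append power_add mult_ac)
  moreover have "C * K ^ length js \<ge> 0" using ck by simp
  ultimately show ?thesis
    using ck(2) smooth_L2_iter_partial[OF bandlimited_smooth_L2[OF assms], of js] unfolding bandlimited_def smooth_L2_def by blast
qed

lemma bandlimited_ellop: "f \<in> bandlimited \<Longrightarrow> ellop d a f \<in> bandlimited"
proof -
  have s: "(\<lambda>x. \<Sum>i\<in>I. g i x) \<in> bandlimited" if "\<And>i. g i \<in> bandlimited" "finite I" for g :: "'k \<Rightarrow> real^'a \<Rightarrow> real" and I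
    using that(2)
  proof (induction I rule: finite_induct)
    case empty
    then show ?case using bandlimited_cmult[OF that(1), of 0] by simp
  next
    case (insert i I)
    then show ?case using bandlimited_add[OF that(1) insert.IH] by simp
  qed
  assume "f \<in> bandlimited"
  then show ?thesis unfolding ellop_def laplacian_eq
    by (intro bandlimited_add bandlimited_cmult s bandlimited_iter_partial) auto
qed

section \<open>Truncated Mittag-Leffler series\<close>

definition ml_sum :: "real \<Rightarrow> real \<Rightarrow> real \<Rightarrow> nat \<Rightarrow> real \<Rightarrow> (real^'n::finite \<Rightarrow> real) \<Rightarrow> real^'n \<Rightarrow> real" where
  "ml_sum \<alpha> d a n t f = (\<lambda>x. \<Sum>k\<le>n. frac_power \<alpha> k t * (ellop d a ^^ k) f x)"

lemma ml_sum_smooth_L2: "f \<in> smooth_L2 \<Longrightarrow> ml_sum \<alpha> d a n t f \<in> smooth_L2"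
  unfolding ml_sum_def by (intro smooth_L2_sum smooth_L2_cmult smooth_L2_ellop_pow)

lemma iter_partial_ml_sum:
  assumes "f \<in> smooth_L2" shows "iter_partial js (ml_sum \<alpha> d a n t f) = ml_sum \<alpha> d a n t (iter_partial js f)"
  unfolding ml_sum_def
  by (simp only: iter_partial_sum iter_partial_cmult iter_partial_ellop_pow[OF assms] smooth_cmult smooth_L2_smooth smooth_L2_ellop_pow[OF assms])

lemma L2_inner_sum:
  assumes "v \<in> L2" "\<And>k. k \<in> I \<Longrightarrow> f k \<in> L2"
  shows "(LINT x|lborel. v x * (\<Sum>k\<in>I. c k * f k x)) = (\<Sum>k\<in>I. c k * (LINT x|lborel. v x * f k x))"
proof -
  have "(LINT x|lborel. v x * (\<Sum>k\<in>I. c k * f k x)) = (LINT x|lborel. (\<Sum>k\<in>I. c k * (v x * f k x)))"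
    by (intro Bochner_Integration.integral_cong refl) (simp only: sum_distrib_left mult.left_commute)
  also have "\<dots> = (\<Sum>k\<in>I. (LINT x|lborel. c k * (v x * f k x)))"
    by (intro Bochner_Integration.integral_sum integrable_mult_right L2_integrable_mult assms)
  finally show ?thesis by (simp only: integral_mult_right_zero)
qed

text \<open>The squared norm is a quadratic form in the values
  \<open>frac_power \<alpha> k s\<close>; its coefficients, the scalar products of the powers, do
  not depend on s.\<close>

lemma ml_sum_norm_continuous:
  assumes f: "f \<in> smooth_L2" and \<alpha>: "\<alpha> > 0"
  shows "continuous_on {0..T} (\<lambda>s. l2_norm (ml_sum \<alpha> d a n s f))"
proof -
  let ?L = "\<lambda>k. (ellop d a ^^ k) f"
  have L: "?L k \<in> L2" for k by (rule smooth_L2_L2[OF smooth_L2_ellop_pow[OF f]])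
  have F: "ml_sum \<alpha> d a n s f \<in> L2" for s by (rule smooth_L2_L2[OF ml_sum_smooth_L2[OF f]])
  have "(l2_norm (ml_sum \<alpha> d a n s f))\<^sup>2 = (\<Sum>k\<le>n. frac_power \<alpha> k s * (\<Sum>j\<le>n. frac_power \<alpha> j s * (LINT x|lborel. ?L k x * ?L j x)))" for s
  proof -
    have "(l2_norm (ml_sum \<alpha> d a n s f))\<^sup>2 = (LINT x|lborel. ml_sum \<alpha> d a n s f x * (\<Sum>k\<le>n. frac_power \<alpha> k s * ?L k x))"
      unfolding l2_norm_sq by (simp only: power2_eq_square ml_sum_def)
    also have "\<dots> = (\<Sum>k\<le>n. frac_power \<alpha> k s * (LINT x|lborel. ml_sum \<alpha> d a n s f x * ?L k x))"
      by (rule L2_inner_sum[OF F L])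
    also have "\<dots> = (\<Sum>k\<le>n. frac_power \<alpha> k s * (LINT x|lborel. ?L k x * (\<Sum>j\<le>n. frac_power \<alpha> j s * ?L j x)))"
      by (simp only: ml_sum_def mult.commute)
    also have "\<dots> = (\<Sum>k\<le>n. frac_power \<alpha> k s * (\<Sum>j\<le>n. frac_power \<alpha> j s * (LINT x|lborel. ?L k x * ?L j x)))"
      by (simp only: L2_inner_sum[OF L L])
    finally show ?thesis .
  qed
  then have eq: "l2_norm (ml_sum \<alpha> d a n s f) = sqrt (\<Sum>k\<le>n. frac_power \<alpha> k s * (\<Sum>j\<le>n. frac_power \<alpha> j s * (LINT x|lborel. ?L k x * ?L j x)))" for s
    by (metis l2_norm_nonneg real_sqrt_unique)
  have c: "continuous_on {0..T} (frac_power \<alpha> k)" for k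
    by (rule continuous_on_subset[OF frac_power_continuous[OF \<alpha>]]) auto
  show ?thesis unfolding eq by (intro continuous_intros c)
qed

text \<open>At a maximum \<open>t\<^sub>0\<close> of \<open>\<parallel>F s\<parallel> / g s\<close>, where \<open>F = ml_sum\<close> and \<open>g\<close> solves the scalar
  equation with the larger coefficient \<open>a + 1\<close>, the function \<open>s \<mapsto> \<langle>F t\<^sub>0, F s\<rangle> - \<rho> \<parallel>F t\<^sub>0\<parallel> g s\<close> is
  maximal, so that the maximum principle applies. The extra growth of \<open>g\<close> absorbs its truncation.\<close>

lemma ml_sum_energy:
  fixes f :: "real^'n::finite \<Rightarrow> real"
  assumes \<alpha>: "0 < \<alpha>" "\<alpha> < 1" and d: "d \<ge> 0" and a: "a \<ge> 0" and T: "T \<ge> 0" and f: "f \<in> smooth_L2"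
    and n: "(a + 1) * ((a + 1) ^ n * frac_power \<alpha> n T) \<le> 1" and t: "t \<in> {0..T}"
  shows "l2_norm (ml_sum \<alpha> d a n t f) \<le> (\<Sum>k\<le>n. (a + 1) ^ k * frac_power \<alpha> k T) *
    (l2_norm f + Gamma (1 - \<alpha>) * T powr \<alpha> * (frac_power \<alpha> n T * l2_norm ((ellop d a ^^ Suc n) f)))"
proof -
  define A where "A = a + 1"
  have A: "A \<ge> 1" "A = a + 1" using a by (auto simp: A_def)
  let ?L = "\<lambda>k. (ellop d a ^^ k) f"
  let ?F = "\<lambda>s. ml_sum \<alpha> d a n s f"
  define g where "g s = (\<Sum>k\<le>n. A ^ k * frac_power \<alpha> k s)" for s
  \<comment> \<open>The truncated sum solves the differential equation up to a defect in its last
    term; \<epsilon> bounds that defect.\<close>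
  define \<epsilon> where "\<epsilon> = frac_power \<alpha> n T * l2_norm (?L (Suc n))"
  define R where "R = l2_norm f + Gamma (1 - \<alpha>) * T powr \<alpha> * \<epsilon>"
  have G1: "Gamma (1 - \<alpha>) > 0" using \<alpha> by simp
  have \<epsilon>: "\<epsilon> \<ge> 0" using frac_power_nonneg[OF \<alpha>(1)] by (simp add: \<epsilon>_def)
  have R: "R \<ge> 0" "l2_norm f \<le> R" using G1 \<epsilon> by (auto simp: R_def)
  have L: "?L k \<in> L2" for k by (rule smooth_L2_L2[OF smooth_L2_ellop_pow[OF f]])
  have Fs: "?F s \<in> smooth_L2" for s by (rule ml_sum_smooth_L2[OF f])
  have F: "?F s \<in> L2" for s by (rule smooth_L2_L2[OF Fs])
  have g1: "g s \<ge> 1" for s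
  proof -
    have "(\<Sum>k\<in>{0}. A ^ k * frac_power \<alpha> k s) \<le> g s"
      unfolding g_def using A frac_power_nonneg[OF \<alpha>(1)] by (intro sum_mono2) auto
    then show ?thesis by simp
  qed
  then have gpos: "g s > 0" for s by (rule less_le_trans[OF zero_less_one])
  have gmono: "g s \<le> g T" if "s \<in> {0..T}" for s
    unfolding g_def using that A frac_power_mono[OF \<alpha>(1)] by (intro sum_mono mult_left_mono) auto
  have gc: "continuous_on {0..T} g"
    unfolding g_def by (intro continuous_intros continuous_on_subset[OF frac_power_continuous[OF \<alpha>(1)]]) auto
  have ratio_c: "continuous_on {0..T} (\<lambda>s. l2_norm (?F s) / g s)"
    using gpos by (intro continuous_on_divide ml_sum_norm_continuous[OF f \<alpha>(1)] gc) (metis less_irrefl)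
  obtain t0 where t0: "t0 \<in> {0..T}" "\<And>s. s \<in> {0..T} \<Longrightarrow> l2_norm (?F s) / g s \<le> l2_norm (?F t0) / g t0"
    using continuous_attains_sup[OF compact_Icc _ ratio_c] T by auto
  define v where "v = ?F t0"
  define \<rho> where "\<rho> = l2_norm v / g t0"
  have vg: "\<rho> * g t0 = l2_norm v" using gpos[of t0] by (simp add: \<rho>_def)
  have \<rho>0: "\<rho> \<ge> 0" using gpos[of t0] by (simp add: \<rho>_def)
  have Fle: "l2_norm (?F s) \<le> \<rho> * g s" if "s \<in> {0..T}" for s
    using t0(2)[OF that] gpos[of s] by (simp add: \<rho>_def v_def pos_divide_le_eq)
  have "\<rho> \<le> R"
  proof -
    \<comment> \<open>The maximum principle requires a positive time and the final step cancels the
      norm of v. In the other cases \<rho> is the norm of f or zero.\<close>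
    consider "t0 = 0" | "l2_norm v = 0" | "t0 > 0" "l2_norm v > 0"
      using t0(1) by (metis atLeastAtMost_iff l2_norm_nonneg less_eq_real_def)
    then show ?thesis
    proof cases
      case 1
      have "?F 0 = f"
        unfolding ml_sum_def using sum.atMost_shift[of "\<lambda>k. frac_power \<alpha> k 0 * ?L k _" n] by simp
      moreover have "g 0 = 1"
        unfolding g_def using sum.atMost_shift[of "\<lambda>k. A ^ k * frac_power \<alpha> k 0" n] by simp
      ultimately show ?thesis using R 1 by (simp add: \<rho>_def v_def)
    next
      case 2
      then show ?thesis using R by (simp add: \<rho>_def)
    next
      case 3
      note vL = F[of t0, folded v_def]
      \<comment> \<open>The \<open>frac_power\<close> coefficients of the function whose maximum at
        t0 is exploited; the scalar comparison solution enters through A^k.\<close>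
      define b where "b k = (LINT x|lborel. v x * ?L k x) - \<rho> * l2_norm v * A ^ k" for k
      have q: "(\<Sum>k\<le>n. b k * frac_power \<alpha> k s) = (LINT x|lborel. v x * ?F s x) - \<rho> * l2_norm v * g s" for s
      proof -
        have "(LINT x|lborel. v x * ?F s x) = (\<Sum>k\<le>n. frac_power \<alpha> k s * (LINT x|lborel. v x * ?L k x))"
          unfolding ml_sum_def by (rule L2_inner_sum[OF vL L])
        then show ?thesis
          unfolding b_def g_def left_diff_distrib sum_subtractf sum_distrib_left
          by (simp only: mult_ac)
      qed
      have q0: "(\<Sum>k\<le>n. b k * frac_power \<alpha> k t0) = 0"
      proof -
        have "(LINT x|lborel. v x * ?F t0 x) = l2_norm v * l2_norm v"
          unfolding v_def[symmetric] power2_eq_square[symmetric] l2_norm_sq by simp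
        moreover have "\<rho> * l2_norm v * g t0 = l2_norm v * l2_norm v"
          using vg by (metis mult.assoc mult.commute)
        ultimately show ?thesis unfolding q by linarith
      qed
      have max: "(\<Sum>k\<le>n. b k * frac_power \<alpha> k s) \<le> (\<Sum>k\<le>n. b k * frac_power \<alpha> k t0)" if "0 \<le> s" "s \<le> t0" for s
      proof -
        have s: "s \<in> {0..T}" using that t0(1) by auto
        have "(LINT x|lborel. v x * ?F s x) \<le> l2_norm v * l2_norm (?F s)"
          using L2_Cauchy_Schwarz[OF vL F[of s]] by linarith
        also have "\<dots> \<le> l2_norm v * (\<rho> * g s)" by (rule mult_left_mono[OF Fle[OF s]]) simp
        finally show ?thesis unfolding q0 q by (simp add: mult_ac)
      qed
      have C: "- b 0 \<le> Gamma (1 - \<alpha>) * t0 powr \<alpha> * (\<Sum>k<n. b (Suc k) * frac_power \<alpha> k t0)"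
        using Caputo_maximum_principle[OF \<alpha> 3(1) max] unfolding q0 by simp
      define r where "r = frac_power \<alpha> n t0"
      have r: "0 \<le> r" "r \<le> frac_power \<alpha> n T"
        unfolding r_def using t0(1) by (auto intro: frac_power_nonneg frac_power_mono \<alpha>(1))
      \<comment> \<open>The sum stops one term short of the scalar product of v with
        \<open>ellop d a v\<close>, which dissipativity bounds; the missing term is the
        defect.\<close>
      have S1: "(\<Sum>k<n. frac_power \<alpha> k t0 * (LINT x|lborel. v x * ?L (Suc k) x)) \<le> a * (l2_norm v)\<^sup>2 + l2_norm v * \<epsilon>"
      proof -
        have "ellop d a v = (\<lambda>x. \<Sum>k\<le>n. frac_power \<alpha> k t0 * ?L (Suc k) x)"
        proof -
          have lin: "ellop d a (\<lambda>x. \<Sum>k\<in>I. c k * ?L k x) = (\<lambda>x. \<Sum>k\<in>I. c k * ?L (Suc k) x)" if "finite I" for c I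
            using that
          proof (induction I rule: finite_induct)
            case empty
            then show ?case using ellop_cmult[OF smooth_L2_smooth[OF f], of d a 0] by simp
          next
            case (insert k I)
            have "smooth (\<lambda>x. \<Sum>k\<in>I. c k * ?L k x)" "smooth (\<lambda>x. c k * ?L k x)" "smooth (?L k)"
              by (intro smooth_sum smooth_cmult smooth_L2_smooth smooth_L2_ellop_pow f)+
            then show ?case using insert by (simp add: ellop_add ellop_cmult)
          qed
          show ?thesis unfolding v_def ml_sum_def by (rule lin) simp
        qed
        then have "(LINT x|lborel. v x * ellop d a v x) = (\<Sum>k\<le>n. frac_power \<alpha> k t0 * (LINT x|lborel. v x * ?L (Suc k) x))"
          by (simp only: L2_inner_sum[OF vL L])
        also have "\<dots> = (\<Sum>k<n. frac_power \<alpha> k t0 * (LINT x|lborel. v x * ?L (Suc k) x)) + r * (LINT x|lborel. v x * ?L (Suc n) x)"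
          by (simp only: lessThan_Suc_atMost[symmetric] sum.lessThan_Suc r_def)
        finally have "(\<Sum>k<n. frac_power \<alpha> k t0 * (LINT x|lborel. v x * ?L (Suc k) x)) = (LINT x|lborel. v x * ellop d a v x) - r * (LINT x|lborel. v x * ?L (Suc n) x)"
          by simp
        moreover have "(LINT x|lborel. v x * ellop d a v x) \<le> a * (l2_norm v)\<^sup>2"
          using ellop_dissipative[OF Fs d] by (simp add: v_def)
        moreover have "- (r * (LINT x|lborel. v x * ?L (Suc n) x)) \<le> l2_norm v * \<epsilon>"
        proof -
          have "- (r * (LINT x|lborel. v x * ?L (Suc n) x)) \<le> r * \<bar>LINT x|lborel. v x * ?L (Suc n) x\<bar>"
            using mult_left_mono[OF abs_ge_minus_self r(1), of "LINT x|lborel. v x * ?L (Suc n) x"] by (simp only: mult_minus_right)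
          also have "\<dots> \<le> frac_power \<alpha> n T * (l2_norm v * l2_norm (?L (Suc n)))"
            using r by (intro mult_mono L2_Cauchy_Schwarz vL L) auto
          finally show ?thesis by (simp only: \<epsilon>_def mult.left_commute)
        qed
        ultimately show ?thesis by linarith
      qed
      \<comment> \<open>\<open>A * g t0\<close> exceeds the shifted sum only by its last term, which
        the hypothesis on n keeps below 1 \<le> \<open>g t0\<close>. This is what the surplus A - a
        = 1 pays for.\<close>
      have S2: "a * l2_norm v \<le> \<rho> * (\<Sum>k<n. A ^ Suc k * frac_power \<alpha> k t0)"
      proof -
        have "(\<Sum>k<n. A ^ Suc k * frac_power \<alpha> k t0) + A * (A ^ n * r) = A * g t0"
          unfolding g_def lessThan_Suc_atMost[symmetric] sum.lessThan_Suc r_def distrib_left sum_distrib_left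
          by (simp add: mult.assoc)
        moreover have "A * (A ^ n * r) \<le> A * (A ^ n * frac_power \<alpha> n T)"
          using r A by (intro mult_left_mono) auto
        moreover have "A * (A ^ n * frac_power \<alpha> n T) \<le> 1" using n by (simp add: A_def)
        moreover have "A * g t0 = a * g t0 + g t0" by (simp add: A_def algebra_simps)
        ultimately have "a * g t0 \<le> (\<Sum>k<n. A ^ Suc k * frac_power \<alpha> k t0)" using g1[of t0] by linarith
        then have "\<rho> * (a * g t0) \<le> \<rho> * (\<Sum>k<n. A ^ Suc k * frac_power \<alpha> k t0)" by (rule mult_left_mono[OF _ \<rho>0])
        moreover have "\<rho> * (a * g t0) = a * l2_norm v" using vg by (metis mult.left_commute)
        ultimately show ?thesis by simp
      qed
      have S3: "(\<Sum>k<n. b (Suc k) * frac_power \<alpha> k t0) \<le> l2_norm v * \<epsilon>"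
      proof -
        have "(\<Sum>k<n. b (Suc k) * frac_power \<alpha> k t0) = (\<Sum>k<n. frac_power \<alpha> k t0 * (LINT x|lborel. v x * ?L (Suc k) x))
           - l2_norm v * (\<rho> * (\<Sum>k<n. A ^ Suc k * frac_power \<alpha> k t0))"
          unfolding b_def left_diff_distrib sum_subtractf sum_distrib_left
          by (intro arg_cong2[where f = minus] sum.cong refl) (simp_all only: mult_ac)
        moreover have "l2_norm v * (a * l2_norm v) \<le> l2_norm v * (\<rho> * (\<Sum>k<n. A ^ Suc k * frac_power \<alpha> k t0))"
          by (rule mult_left_mono[OF S2]) simp
        moreover have "l2_norm v * (a * l2_norm v) = a * (l2_norm v)\<^sup>2" by (simp add: power2_eq_square)
        ultimately show ?thesis using S1 by linarith
      qed
      \<comment> \<open>Since A^0 = 1, \<open>- b 0\<close> is \<rho> times the norm of v minus the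
        scalar product of v and f; cancelling the norm of v at the end gives \<rho> \<le> R.\<close>
      have "l2_norm v * \<rho> - l2_norm v * l2_norm f \<le> - b 0"
        using L2_Cauchy_Schwarz[OF vL smooth_L2_L2[OF f]] by (simp add: b_def mult.commute)
      also note C
      also have "Gamma (1 - \<alpha>) * t0 powr \<alpha> * (\<Sum>k<n. b (Suc k) * frac_power \<alpha> k t0) \<le> Gamma (1 - \<alpha>) * t0 powr \<alpha> * (l2_norm v * \<epsilon>)"
        using G1 by (intro mult_left_mono S3) auto
      also have "\<dots> \<le> Gamma (1 - \<alpha>) * T powr \<alpha> * (l2_norm v * \<epsilon>)"
        using G1 \<epsilon> t0(1) \<alpha> by (intro mult_right_mono mult_left_mono powr_mono2) auto
      finally have "l2_norm v * \<rho> \<le> l2_norm v * R" by (simp add: R_def distrib_left mult_ac)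
      then show ?thesis using 3(2) by simp
    qed
  qed
  have "l2_norm (?F t) \<le> \<rho> * g t" by (rule Fle[OF t])
  also have "\<dots> \<le> R * g T"
    using \<open>\<rho> \<le> R\<close> gmono[OF t] R(1) gpos[of t] by (intro mult_mono) auto
  finally show ?thesis unfolding R_def \<epsilon>_def g_def A(2)[symmetric] by (simp only: mult.commute)
qed

section \<open>The series at the origin\<close>

definition ml_value :: "real \<Rightarrow> real \<Rightarrow> real \<Rightarrow> real \<Rightarrow> (real^'n::finite \<Rightarrow> real) \<Rightarrow> real" where
  "ml_value \<alpha> d a t f = (\<Sum>k. frac_power \<alpha> k t * (ellop d a ^^ k) f 0)"

text \<open>The Sobolev inequality uses a fixed number of derivatives, so the geometric growth in k
  passes from norms to point values.\<close>

lemma pointwise_growth: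
  fixes f :: "real^'n::finite \<Rightarrow> real"
  assumes m: "real m > CARD('n) / 2" and f: "f \<in> bandlimited"
  obtains C \<kappa> where "C \<ge> 0" "\<kappa> \<ge> 0" "\<And>k. \<bar>(ellop d a ^^ k) f 0\<bar> \<le> C * \<kappa> ^ k"
proof -
  obtain C \<kappa> K where ck: "C \<ge> 0" "\<kappa> \<ge> 0" "K \<ge> 0"
    "\<And>k js. l2_norm (iter_partial js ((ellop d a ^^ k) f)) \<le> C * \<kappa> ^ k * K ^ length js"
    using bandlimited_ellop_pow[OF f, of d a] by metis
  note f' = bandlimited_smooth_L2[OF f]
  define S where "S = 1 + 1 / (real m - CARD('n) / 2)"
  have S: "S \<ge> 0" using m by (simp add: S_def)
  define B where "B = (\<Sum>k\<le>m. \<Sum>js\<in>(lists_of_length k :: 'n list set). C * K ^ length js)"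
  have B: "B \<ge> 0" unfolding B_def using ck by (intro sum_nonneg) auto
  have "\<bar>(ellop d a ^^ k) f 0\<bar> \<le> (S * B) * \<kappa> ^ k" for k
  proof -
    have "\<bar>(ellop d a ^^ k) f 0\<bar> \<le> S * (\<Sum>l\<le>m. \<Sum>js\<in>lists_of_length l. l2_norm (iter_partial js ((ellop d a ^^ k) f)))"
      unfolding S_def by (rule sobolev_inequality_sum[OF m smooth_L2_ellop_pow[OF f']])
    also have "\<dots> \<le> S * (\<Sum>l\<le>m. \<Sum>js\<in>(lists_of_length l :: 'n list set). C * \<kappa> ^ k * K ^ length js)"
      by (intro mult_left_mono sum_mono ck(4) S)
    also have "\<dots> = (S * B) * \<kappa> ^ k"
      by (simp only: B_def sum_distrib_left sum_distrib_right mult_ac)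
    finally show ?thesis .
  qed
  with S B ck(2) that show ?thesis by (metis mult_nonneg_nonneg)
qed

lemma ml_value_summable:
  fixes f :: "real^'n::finite \<Rightarrow> real"
  assumes m: "real m > CARD('n) / 2" and f: "f \<in> bandlimited" and \<alpha>: "\<alpha> > 0"
  shows "summable (\<lambda>k. \<bar>(ellop d a ^^ k) f 0\<bar> * frac_power \<alpha> k t)"
    and "summable (\<lambda>k. frac_power \<alpha> k t * (ellop d a ^^ k) f 0)"
proof -
  obtain C \<kappa> where ck: "C \<ge> 0" "\<kappa> \<ge> 0" "\<And>k. \<bar>(ellop d a ^^ k) f 0\<bar> \<le> C * \<kappa> ^ k"
    using pointwise_growth[OF m f] by metis
  have s: "summable (\<lambda>k. C * (\<kappa> ^ k * frac_power \<alpha> k t))"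
    by (intro summable_mult frac_power_summable \<alpha> ck(2))
  show 1: "summable (\<lambda>k. \<bar>(ellop d a ^^ k) f 0\<bar> * frac_power \<alpha> k t)"
    by (rule summable_comparison_test'[OF s, of 0])
      (use mult_right_mono[OF ck(3) frac_power_nonneg[OF \<alpha>]] frac_power_nonneg[OF \<alpha>] in \<open>auto simp: abs_mult mult.assoc\<close>)
  show "summable (\<lambda>k. frac_power \<alpha> k t * (ellop d a ^^ k) f 0)"
    by (rule summable_comparison_test'[OF 1, of 0])
      (use frac_power_nonneg[OF \<alpha>] in \<open>auto simp: abs_mult\<close>)
qed

lemma ml_value_limit:
  fixes f :: "real^'n::finite \<Rightarrow> real"
  assumes m: "real m > CARD('n) / 2" and f: "f \<in> bandlimited" and \<alpha>: "\<alpha> > 0"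
  shows "(\<lambda>n. ml_sum \<alpha> d a n t f 0) \<longlonglongrightarrow> ml_value \<alpha> d a t f"
proof -
  have "(\<lambda>n. \<Sum>k<n. frac_power \<alpha> k t * (ellop d a ^^ k) f 0) \<longlonglongrightarrow> ml_value \<alpha> d a t f"
    unfolding ml_value_def using summable_LIMSEQ[OF ml_value_summable(2)[OF m f \<alpha>]] .
  then have "(\<lambda>n. \<Sum>k<Suc n. frac_power \<alpha> k t * (ellop d a ^^ k) f 0) \<longlonglongrightarrow> ml_value \<alpha> d a t f"
    by (rule LIMSEQ_Suc)
  then show ?thesis by (simp only: ml_sum_def lessThan_Suc_atMost)
qed

lemma ml_value_add:
  fixes f g :: "real^'n::finite \<Rightarrow> real"
  assumes m: "real m > CARD('n) / 2" and f: "f \<in> bandlimited" and g: "g \<in> bandlimited" and \<alpha>: "\<alpha> > 0"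
  shows "ml_value \<alpha> d a t (\<lambda>x. f x + g x) = ml_value \<alpha> d a t f + ml_value \<alpha> d a t g"
  unfolding ml_value_def ellop_pow_add[OF bandlimited_smooth_L2[OF f] bandlimited_smooth_L2[OF g]] distrib_left
  by (rule suminf_add[symmetric]) (intro ml_value_summable(2)[OF m _ \<alpha>] f g)+

lemma ml_value_cmult:
  fixes f :: "real^'n::finite \<Rightarrow> real"
  assumes m: "real m > CARD('n) / 2" and f: "f \<in> bandlimited" and \<alpha>: "\<alpha> > 0"
  shows "ml_value \<alpha> d a t (\<lambda>x. c * f x) = c * ml_value \<alpha> d a t f"
  unfolding ml_value_def ellop_pow_cmult[OF bandlimited_smooth_L2[OF f]] mult.left_commute[of _ c]
  by (rule suminf_mult) (rule ml_value_summable(2)[OF m f \<alpha>])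

lemma ml_value_diff:
  fixes f g :: "real^'n::finite \<Rightarrow> real"
  assumes m: "real m > CARD('n) / 2" and f: "f \<in> bandlimited" and g: "g \<in> bandlimited" and \<alpha>: "\<alpha> > 0"
  shows "ml_value \<alpha> d a t (\<lambda>x. f x - g x) = ml_value \<alpha> d a t f - ml_value \<alpha> d a t g"
  using ml_value_add[OF m f bandlimited_cmult[OF g, of "-1"] \<alpha>, of d a t] ml_value_cmult[OF m g \<alpha>, of d a t "-1"] by simp

text \<open>The energy estimate is applied to each derivative of order at most m, since these
  commute with the truncated series, and the truncation defect disappears as n grows. Only the speed
  of this limit depends on the bandwidth; the constant does not.\<close>

lemma ml_value_bound:
  assumes m: "real m > CARD('n::finite) / 2" and \<alpha>: "0 < \<alpha>" "\<alpha> < 1" and d: "d \<ge> 0" and a: "a \<ge> 0" and T: "T \<ge> 0"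
  obtains C where "C \<ge> 0" "\<And>t f. t \<in> {0..T} \<Longrightarrow> f \<in> bandlimited \<Longrightarrow>
    \<bar>ml_value \<alpha> d a t (f :: real^'n \<Rightarrow> real)\<bar> \<le> C * sobolev_norm m f"
proof -
  define S where "S = 1 + 1 / (real m - CARD('n) / 2)"
  have S: "S \<ge> 0" using m by (simp add: S_def)
  define E where "E = (\<Sum>k. (a + 1) ^ k * frac_power \<alpha> k T)"
  have sE: "summable (\<lambda>k. (a + 1) ^ k * frac_power \<alpha> k T)" using a by (intro frac_power_summable \<alpha>) auto
  have E: "(\<Sum>k\<le>n. (a + 1) ^ k * frac_power \<alpha> k T) \<le> E" for n
    unfolding E_def using a by (intro sum_le_suminf sE) (auto intro!: mult_nonneg_nonneg frac_power_nonneg \<alpha>)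
  have E0: "E \<ge> 0" unfolding E_def using a by (intro suminf_nonneg sE) (auto intro!: mult_nonneg_nonneg frac_power_nonneg \<alpha>)
  define W where "W = (\<Sum>k\<le>m. real (card (lists_of_length k :: 'n list set)))"
  have W: "W \<ge> 0" by (simp add: W_def sum_nonneg)
  \<comment> \<open>The condition on n in \<open>ml_sum_energy\<close> holds eventually, and from an
    index independent of f and t.\<close>
  have "(\<lambda>n. (a + 1) * ((a + 1) ^ n * frac_power \<alpha> n T)) \<longlonglongrightarrow> 0"
    using tendsto_mult_right_zero[OF summable_LIMSEQ_zero[OF sE]] .
  then have ev: "\<forall>\<^sub>F n in sequentially. (a + 1) * ((a + 1) ^ n * frac_power \<alpha> n T) \<le> 1"
    by (rule eventually_mono[OF order_tendstoD(2)[of _ _ _ 1]]) auto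
  define R where "R = Gamma (1 - \<alpha>) * T powr \<alpha>"
  have "\<bar>ml_value \<alpha> d a t f\<bar> \<le> (S * E * W) * sobolev_norm m f" if t: "t \<in> {0..T}" and f: "f \<in> bandlimited" for t and f :: "real^'n \<Rightarrow> real"
  proof -
    note f' = bandlimited_smooth_L2[OF f]
    define B where "B n = S * (\<Sum>l\<le>m. \<Sum>js\<in>(lists_of_length l :: 'n list set). E * (l2_norm (iter_partial js f) +
        R * (frac_power \<alpha> n T * l2_norm ((ellop d a ^^ Suc n) (iter_partial js f)))))" for n
    have le: "\<forall>\<^sub>F n in sequentially. \<bar>ml_sum \<alpha> d a n t f 0\<bar> \<le> B n"
    proof (rule eventually_mono[OF ev])
      fix n assume n: "(a + 1) * ((a + 1) ^ n * frac_power \<alpha> n T) \<le> 1"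
      have "\<bar>ml_sum \<alpha> d a n t f 0\<bar> \<le> S * (\<Sum>l\<le>m. \<Sum>js\<in>lists_of_length l. l2_norm (iter_partial js (ml_sum \<alpha> d a n t f)))"
        unfolding S_def by (rule sobolev_inequality_sum[OF m ml_sum_smooth_L2[OF f']])
      also have "\<dots> \<le> B n"
        unfolding B_def
      proof (intro mult_left_mono sum_mono S)
        fix l and js :: "'n list"
        have R0: "R \<ge> 0" using \<alpha> by (simp add: R_def)
        have "l2_norm (iter_partial js (ml_sum \<alpha> d a n t f)) \<le> (\<Sum>k\<le>n. (a + 1) ^ k * frac_power \<alpha> k T) *
          (l2_norm (iter_partial js f) + R * (frac_power \<alpha> n T * l2_norm ((ellop d a ^^ Suc n) (iter_partial js f))))"
          unfolding iter_partial_ml_sum[OF f'] R_def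
          by (rule ml_sum_energy[OF \<alpha> d a T smooth_L2_iter_partial[OF f'] n t])
        also have "\<dots> \<le> E * (l2_norm (iter_partial js f) + R * (frac_power \<alpha> n T * l2_norm ((ellop d a ^^ Suc n) (iter_partial js f))))"
          by (intro mult_right_mono E add_nonneg_nonneg mult_nonneg_nonneg R0 frac_power_nonneg \<alpha> l2_norm_nonneg)
        finally show "l2_norm (iter_partial js (ml_sum \<alpha> d a n t f)) \<le> E * (l2_norm (iter_partial js f) +
          R * (frac_power \<alpha> n T * l2_norm ((ellop d a ^^ Suc n) (iter_partial js f))))" .
      qed
      finally show "\<bar>ml_sum \<alpha> d a n t f 0\<bar> \<le> B n" .
    qed
    \<comment> \<open>Band-limitation enters here: the powers grow geometrically and
      \<open>frac_power\<close> decays faster.\<close>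
    have z: "(\<lambda>n. frac_power \<alpha> n T * l2_norm ((ellop d a ^^ Suc n) (iter_partial js f))) \<longlonglongrightarrow> 0" for js
    proof -
      obtain C \<kappa> K where ck: "C \<ge> 0" "\<kappa> \<ge> 0" "K \<ge> 0"
        "\<And>k ks. l2_norm (iter_partial ks ((ellop d a ^^ k) (iter_partial js f))) \<le> C * \<kappa> ^ k * K ^ length ks"
        using bandlimited_ellop_pow[OF bandlimited_iter_partial[OF f], of d a] by metis
      have le: "l2_norm ((ellop d a ^^ Suc n) (iter_partial js f)) \<le> C * \<kappa> ^ Suc n" for n
        using ck(4)[of "[]" "Suc n"] by simp
      have lim: "(\<lambda>n. (C * \<kappa>) * (\<kappa> ^ n * frac_power \<alpha> n T)) \<longlonglongrightarrow> 0"
        by (intro tendsto_mult_right_zero summable_LIMSEQ_zero frac_power_summable \<alpha> ck)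
      show ?thesis
      proof (rule Lim_null_comparison[OF _ lim], intro always_eventually allI)
        fix n
        have fp: "0 \<le> frac_power \<alpha> n T" by (rule frac_power_nonneg[OF \<alpha>(1)])
        have "frac_power \<alpha> n T * l2_norm ((ellop d a ^^ Suc n) (iter_partial js f)) \<le> frac_power \<alpha> n T * (C * \<kappa> ^ Suc n)"
          by (rule mult_left_mono[OF le fp])
        also have "\<dots> = (C * \<kappa>) * (\<kappa> ^ n * frac_power \<alpha> n T)" by (simp only: power_Suc mult_ac)
        finally show "norm (frac_power \<alpha> n T * l2_norm ((ellop d a ^^ Suc n) (iter_partial js f))) \<le> (C * \<kappa>) * (\<kappa> ^ n * frac_power \<alpha> n T)"
          using fp by (simp only: real_norm_def abs_of_nonneg mult_nonneg_nonneg l2_norm_nonneg)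
      qed
    qed
    have "B \<longlonglongrightarrow> S * (\<Sum>l\<le>m. \<Sum>js\<in>(lists_of_length l :: 'n list set). E * (l2_norm (iter_partial js f) + R * 0))"
      unfolding B_def by (intro tendsto_intros z)
    then have "B \<longlonglongrightarrow> S * E * (\<Sum>l\<le>m. \<Sum>js\<in>(lists_of_length l :: 'n list set). l2_norm (iter_partial js f))"
      by (simp add: sum_distrib_left mult.assoc)
    then have "\<bar>ml_value \<alpha> d a t f\<bar> \<le> S * E * (\<Sum>l\<le>m. \<Sum>js\<in>(lists_of_length l :: 'n list set). l2_norm (iter_partial js f))"
      by (rule tendsto_le[OF sequentially_bot _ tendsto_rabs[OF ml_value_limit[OF m f \<alpha>(1)]] le])
    also have "\<dots> \<le> S * E * (W * sobolev_norm m f)"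
      unfolding W_def using S E0 by (intro mult_left_mono sum_l2_norm_le_sobolev f') auto
    finally show ?thesis by (simp only: mult.assoc)
  qed
  moreover have "S * E * W \<ge> 0" using S E0 W by simp
  ultimately show ?thesis using that by blast
qed

text \<open>At s = 0 the hypotheses say nothing, as the bounds may be singular there; the interval
  is opened at 0 and the point is restored at the end as a null set. The exponent is \<beta> = 0 for
  existence and \<beta> = \<alpha> for uniqueness.\<close>

lemma fractional_dominated_convergence:
  fixes h :: "nat \<Rightarrow> real \<Rightarrow> real"
  assumes \<alpha>: "\<alpha> > 0" and t: "t \<ge> 0" and \<beta>: "\<beta> < 1"
    and int: "\<And>n. set_integrable lebesgue {0..t} (\<lambda>s. h n s / (t - s) powr (1 - \<alpha>))"
    and lim: "\<And>s. 0 < s \<Longrightarrow> s \<le> t \<Longrightarrow> (\<lambda>n. h n s) \<longlonglongrightarrow> H s"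
    and bound: "\<And>n s. 0 < s \<Longrightarrow> s \<le> t \<Longrightarrow> \<bar>h n s\<bar> \<le> M * s powr (- \<beta>)"
  shows "set_integrable lebesgue {0..t} (\<lambda>s. H s / (t - s) powr (1 - \<alpha>))"
    and "(\<lambda>n. LINT s:{0..t}|lebesgue. h n s / (t - s) powr (1 - \<alpha>)) \<longlonglongrightarrow> (LINT s:{0..t}|lebesgue. H s / (t - s) powr (1 - \<alpha>))"
proof -
  let ?h = "\<lambda>n s. indicator {0<..t} s *\<^sub>R (h n s / (t - s) powr (1 - \<alpha>))"
  let ?H = "\<lambda>s. indicator {0<..t} s *\<^sub>R (H s / (t - s) powr (1 - \<alpha>))"
  have sub: "{0<..t} \<subseteq> {0..t}" by auto
  have int': "integrable lebesgue (?h n)" for n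
    using set_integrable_subset[OF int _ sub] by (simp add: set_integrable_def)
  have l: "(\<lambda>n. ?h n s) \<longlonglongrightarrow> ?H s" for s
    by (cases "s \<in> {0<..t}") (auto intro!: tendsto_divide_zero tendsto_intros lim simp: divide_inverse)
  have Hm: "?H \<in> borel_measurable lebesgue"
    by (rule borel_measurable_LIMSEQ_metric[OF borel_measurable_integrable[OF int'] l])
  have w: "integrable lebesgue (\<lambda>s. M * (indicator {0..t} s *\<^sub>R (s powr (- \<beta>) / (t - s) powr (1 - \<alpha>))))"
    using fractional_kernel_integrable(1)[OF t _ \<alpha>, of "- \<beta>"] \<beta> unfolding set_integrable_def
    by (intro integrable_mult_right) simp
  have bd: "AE s in lebesgue. norm (?h n s) \<le> M * (indicator {0..t} s *\<^sub>R (s powr (- \<beta>) / (t - s) powr (1 - \<alpha>)))" for n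
  proof (rule AE_mp[OF AE_completion[OF AE_lborel_singleton[of 0]]], intro AE_I2 impI)
    fix s :: real assume s: "s \<noteq> 0"
    show "norm (?h n s) \<le> M * (indicator {0..t} s *\<^sub>R (s powr (- \<beta>) / (t - s) powr (1 - \<alpha>)))"
    proof (cases "s \<in> {0<..t}")
      case True
      then have "\<bar>h n s\<bar> / (t - s) powr (1 - \<alpha>) \<le> M * s powr (- \<beta>) / (t - s) powr (1 - \<alpha>)"
        by (intro divide_right_mono bound) auto
      then show ?thesis using True by simp
    next
      case False
      then have "s \<notin> {0..t}" using s by auto
      then show ?thesis using False by simp
    qed
  qed
  have i: "integrable lebesgue ?H" 
    by (rule integrable_dominated_convergence[OF Hm borel_measurable_integrable[OF int'] w AE_I2[OF l] bd])
  have c: "(\<lambda>n. integral\<^sup>L lebesgue (?h n)) \<longlonglongrightarrow> integral\<^sup>L lebesgue ?H" 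
    by (rule integral_dominated_convergence[OF Hm borel_measurable_integrable[OF int'] w AE_I2[OF l] bd])
  have split: "(\<lambda>s. indicator {0..t} s *\<^sub>R f s) = (\<lambda>s. indicator {0<..t} s *\<^sub>R f s + indicator {0} s *\<^sub>R f 0)" for f :: "real \<Rightarrow> real"
    using t by (auto simp: indicator_def)
  have i0: "integrable lebesgue (\<lambda>s::real. indicator {0} s *\<^sub>R c)" for c :: real
    by (intro integrable_scaleR_left integrable_real_indicator) auto
  have z: "(LINT s|lebesgue. indicator {0::real} s *\<^sub>R c) = 0" for c :: real
    by (subst integral_scaleR_left) (auto intro!: integrable_real_indicator)
  show "set_integrable lebesgue {0..t} (\<lambda>s. H s / (t - s) powr (1 - \<alpha>))"
    unfolding set_integrable_def split[of "\<lambda>s. H s / (t - s) powr (1 - \<alpha>)"] by (intro Bochner_Integration.integrable_add i i0)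
  have eq: "(LINT s:{0..t}|lebesgue. f s) = (LINT s|lebesgue. indicator {0<..t} s *\<^sub>R f s)"
    if "integrable lebesgue (\<lambda>s. indicator {0<..t} s *\<^sub>R f s)" for f :: "real \<Rightarrow> real"
    unfolding set_lebesgue_integral_def split[of f] using that i0 z by (subst Bochner_Integration.integral_add) auto
  show "(\<lambda>n. LINT s:{0..t}|lebesgue. h n s / (t - s) powr (1 - \<alpha>)) \<longlonglongrightarrow> (LINT s:{0..t}|lebesgue. H s / (t - s) powr (1 - \<alpha>))"
    unfolding eq[OF int'] eq[OF i] by (rule c)
qed

lemma ml_value_equation:
  fixes f :: "real^'n::finite \<Rightarrow> real"
  assumes m: "real m > CARD('n) / 2" and f: "f \<in> bandlimited" and \<alpha>: "\<alpha> > 0" and t: "t \<ge> 0"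
  shows "set_integrable lebesgue {0..t} (\<lambda>s. ml_value \<alpha> d a s (ellop d a f) / (t - s) powr (1 - \<alpha>))"
    and "ml_value \<alpha> d a t f = f 0 + 1 / Gamma \<alpha> * (LINT s:{0..t}|lebesgue. ml_value \<alpha> d a s (ellop d a f) / (t - s) powr (1 - \<alpha>))"
proof -
  define c where "c k = (ellop d a ^^ Suc k) f 0" for k
  define h where "h n s = ml_sum \<alpha> d a n s (ellop d a f) 0" for n s
  have c: "(ellop d a ^^ k) (ellop d a f) 0 = c k" for k by (simp add: c_def funpow_swap1)
  have h: "h n s = (\<Sum>k\<le>n. c k * frac_power \<alpha> k s)" for n s
    by (simp only: h_def ml_sum_def c mult.commute)
  note Lf = bandlimited_ellop[OF f, of d a]
  have hd: "h n s / (t - s) powr (1 - \<alpha>) = (\<Sum>k\<le>n. c k * (frac_power \<alpha> k s / (t - s) powr (1 - \<alpha>)))" for n s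
    by (simp only: h sum_divide_distrib times_divide_eq_right)
  have ik: "set_integrable lebesgue {0..t} (\<lambda>s. c k * (frac_power \<alpha> k s / (t - s) powr (1 - \<alpha>)))" for k
    by (intro set_integrable_mult_right frac_power_integral(1)[OF \<alpha> t])
  have int: "set_integrable lebesgue {0..t} (\<lambda>s. h n s / (t - s) powr (1 - \<alpha>))" for n
    unfolding set_integrable_def hd scaleR_sum_right
    by (intro Bochner_Integration.integrable_sum) (use ik in \<open>simp add: set_integrable_def\<close>)
  define M where "M = (\<Sum>k. \<bar>c k\<bar> * frac_power \<alpha> k t)"
  have sM: "summable (\<lambda>k. \<bar>c k\<bar> * frac_power \<alpha> k t)"
    using ml_value_summable(1)[OF m Lf \<alpha>, of d a t] by (simp only: c)
  \<comment> \<open>By monotonicity of \<open>frac_power\<close>, the series of absolute values at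
    time t dominates all earlier times.\<close>
  have bound: "\<bar>h n s\<bar> \<le> M * s powr (- 0)" if "0 < s" "s \<le> t" for n s
  proof -
    have "\<bar>h n s\<bar> \<le> (\<Sum>k\<le>n. \<bar>c k\<bar> * frac_power \<alpha> k t)"
      unfolding h using that
      by (intro order_trans[OF sum_abs] sum_mono)
        (auto simp: abs_mult frac_power_nonneg[OF \<alpha>] intro!: mult_left_mono frac_power_mono[OF \<alpha>])
    also have "\<dots> \<le> M" unfolding M_def
      by (intro sum_le_suminf sM) (auto intro!: mult_nonneg_nonneg frac_power_nonneg \<alpha>)
    finally show ?thesis using that by simp
  qed
  have lim: "(\<lambda>n. h n s) \<longlonglongrightarrow> ml_value \<alpha> d a s (ellop d a f)" for s
    unfolding h_def by (rule ml_value_limit[OF m Lf \<alpha>])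
  note dc = fractional_dominated_convergence[OF \<alpha> t zero_less_one int lim bound]
  show "set_integrable lebesgue {0..t} (\<lambda>s. ml_value \<alpha> d a s (ellop d a f) / (t - s) powr (1 - \<alpha>))"
    by (rule dc(1))
  \<comment> \<open>Fractional integration turns the n-th partial sum for \<open>ellop d a f\<close>
    into the next partial sum for f without its first term, and that term is f 0.\<close>
  have part: "f 0 + 1 / Gamma \<alpha> * (LINT s:{0..t}|lebesgue. h n s / (t - s) powr (1 - \<alpha>)) = ml_sum \<alpha> d a (Suc n) t f 0" for n
  proof -
    have "(LINT s:{0..t}|lebesgue. h n s / (t - s) powr (1 - \<alpha>)) = (\<Sum>k\<le>n. LINT s:{0..t}|lebesgue. c k * (frac_power \<alpha> k s / (t - s) powr (1 - \<alpha>)))"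
      unfolding hd set_lebesgue_integral_def scaleR_sum_right
      by (intro Bochner_Integration.integral_sum) (use ik in \<open>simp add: set_integrable_def\<close>)
    also have "\<dots> = (\<Sum>k\<le>n. c k * (LINT s:{0..t}|lebesgue. frac_power \<alpha> k s / (t - s) powr (1 - \<alpha>)))"
      by (simp only: set_integral_mult_right)
    finally have "1 / Gamma \<alpha> * (LINT s:{0..t}|lebesgue. h n s / (t - s) powr (1 - \<alpha>)) =
      (\<Sum>k\<le>n. c k * (1 / Gamma \<alpha> * (LINT s:{0..t}|lebesgue. frac_power \<alpha> k s / (t - s) powr (1 - \<alpha>))))"
      by (simp only: sum_distrib_left mult.left_commute)
    also have "\<dots> = (\<Sum>k\<le>n. frac_power \<alpha> (Suc k) t * (ellop d a ^^ Suc k) f 0)"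
      unfolding frac_power_integral(2)[OF \<alpha> t] c_def by (simp only: mult.commute)
    finally show ?thesis
      unfolding ml_sum_def using sum.atMost_Suc_shift[of "\<lambda>k. frac_power \<alpha> k t * (ellop d a ^^ k) f 0" n] by simp
  qed
  have "(\<lambda>n. f 0 + 1 / Gamma \<alpha> * (LINT s:{0..t}|lebesgue. h n s / (t - s) powr (1 - \<alpha>))) \<longlonglongrightarrow>
     f 0 + 1 / Gamma \<alpha> * (LINT s:{0..t}|lebesgue. ml_value \<alpha> d a s (ellop d a f) / (t - s) powr (1 - \<alpha>))"
    by (intro tendsto_add tendsto_mult tendsto_const dc(2))
  moreover have "(\<lambda>n. ml_sum \<alpha> d a (Suc n) t f 0) \<longlonglongrightarrow> ml_value \<alpha> d a t f"
    by (rule LIMSEQ_Suc[OF ml_value_limit[OF m f \<alpha>]])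
  ultimately show "ml_value \<alpha> d a t f = f 0 + 1 / Gamma \<alpha> * (LINT s:{0..t}|lebesgue. ml_value \<alpha> d a s (ellop d a f) / (t - s) powr (1 - \<alpha>))"
    unfolding part by (rule LIMSEQ_unique[rotated])
qed

section \<open>Existence\<close>

lemma mollify_add:
  assumes "f \<in> L2" "g \<in> L2"
  shows "mollify j (\<lambda>x. f x + g x) = (\<lambda>x. mollify j f x + mollify j g x)"
proof
  fix x
  note i = convolve_integrable[OF assms(1) decaying_kernels_integrable(2)[OF mollifier_decaying[of j]], of x]
    convolve_integrable[OF assms(2) decaying_kernels_integrable(2)[OF mollifier_decaying[of j]], of x]
  show "mollify j (\<lambda>x. f x + g x) x = mollify j f x + mollify j g x"
    unfolding mollify_def convolve_def distrib_right by (rule Bochner_Integration.integral_add[OF i])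
qed

lemma mollify_cmult: "mollify j (\<lambda>x. c * f x) = (\<lambda>x. c * mollify j f x)"
  by (rule ext) (simp only: mollify_def convolve_def mult.assoc integral_mult_right_zero)

lemma mollify_sum:
  assumes "finite I" "\<And>k. k \<in> I \<Longrightarrow> f k \<in> L2"
  shows "mollify j (\<lambda>x. \<Sum>k\<in>I. f k x) = (\<lambda>x. \<Sum>k\<in>I. mollify j (f k) x)"
  using assms
proof (induction I rule: finite_induct)
  case empty
  show ?case using mollify_cmult[of j 0 "\<lambda>x. 0"] by simp
next
  case (insert k I)
  then show ?case by (simp add: mollify_add L2_sum)
qed

lemma mollify_ellop:
  assumes f: "f \<in> smooth_L2"
  shows "ellop d a (mollify j f) = mollify j (ellop d a f)"
proof -
  note L = smooth_L2_iter_L2[OF f]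
  have "mollify j (ellop d a f) = (\<lambda>x. d * (\<Sum>i\<in>UNIV. mollify j (iter_partial [i, i] f) x) + a * mollify j f x)"
    unfolding ellop_def laplacian_eq
    by (simp only: mollify_add L2_cmult L2_sum L smooth_L2_L2[OF f] mollify_cmult mollify_sum finite)
  also have "\<dots> = ellop d a (mollify j f)"
    unfolding ellop_def laplacian_eq by (simp only: mollify_iter_partial[OF f])
  finally show ?thesis by simp
qed

lemma mollify_sobolev: "f \<in> sobolev m \<Longrightarrow> mollify j f \<in> sobolev k"
  by (rule smooth_L2_sobolev[OF bandlimited_smooth_L2[OF mollify_bandlimited[OF sobolev_L2]]])

lemma sobolev_norm_diff_le:
  assumes "f \<in> sobolev m" "g \<in> sobolev m" "h \<in> sobolev m"
  shows "sobolev_norm m (\<lambda>x. f x - g x) \<le> sobolev_norm m (\<lambda>x. f x - h x) + sobolev_norm m (\<lambda>x. g x - h x)"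
proof -
  note gh = sobolev_diff[OF assms(2,3)]
  have "sobolev_norm m (\<lambda>x. (f x - h x) + (-1) * (g x - h x)) \<le> sobolev_norm m (\<lambda>x. f x - h x) + sobolev_norm m (\<lambda>x. (-1) * (g x - h x))"
    by (intro sobolev_norm_triangle sobolev_diff sobolev_cmult assms)
  moreover have "sobolev_norm m (\<lambda>x. (-1) * (g x - h x)) = sobolev_norm m (\<lambda>x. g x - h x)"
    unfolding sobolev_norm_cmult[OF gh] by simp
  ultimately show ?thesis by simp
qed

lemma sobolev_norm_approx_bound:
  assumes "f \<in> sobolev m" "\<And>j. g j \<in> sobolev m" "(\<lambda>j. sobolev_norm m (\<lambda>x. g j x - f x)) \<longlonglongrightarrow> 0"
  obtains B where "\<And>j. sobolev_norm m (g j) \<le> B"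
proof -
  have "Bseq (\<lambda>j. sobolev_norm m (\<lambda>x. g j x - f x))"
    by (rule convergent_imp_Bseq) (use assms(3) in \<open>auto simp: convergent_def\<close>)
  then obtain K where K: "\<And>j. norm (sobolev_norm m (\<lambda>x. g j x - f x)) \<le> K" by (meson BseqE)
  have "sobolev_norm m (g j) \<le> K + sobolev_norm m f" for j
  proof -
    have "sobolev_norm m (\<lambda>x. (g j x - f x) + f x) \<le> sobolev_norm m (\<lambda>x. g j x - f x) + sobolev_norm m f"
      by (intro sobolev_norm_triangle sobolev_diff assms)
    then show ?thesis using K[of j] by simp
  qed
  then show ?thesis using that by blast
qed

lemma sobolev_inequality:
  assumes m: "real m > CARD('n::finite) / 2"
  obtains C where "C \<ge> 0" "\<And>f :: real^'n \<Rightarrow> real. f \<in> smooth_L2 \<Longrightarrow> \<bar>f 0\<bar> \<le> C * sobolev_norm m f"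
proof -
  define S where "S = 1 + 1 / (real m - CARD('n) / 2)"
  have S: "S \<ge> 0" using m by (simp add: S_def)
  define W where "W = (\<Sum>k\<le>m. real (card (lists_of_length k :: 'n list set)))"
  have W: "W \<ge> 0" by (simp add: W_def sum_nonneg)
  have "\<bar>f 0\<bar> \<le> S * W * sobolev_norm m f" if f: "f \<in> smooth_L2" for f :: "real^'n \<Rightarrow> real"
  proof -
    have "\<bar>f 0\<bar> \<le> S * (\<Sum>k\<le>m. \<Sum>js\<in>lists_of_length k. l2_norm (iter_partial js f))"
      unfolding S_def by (rule sobolev_inequality_sum[OF m f])
    also have "\<dots> \<le> S * (W * sobolev_norm m f)"
      unfolding W_def by (rule mult_left_mono[OF sum_l2_norm_le_sobolev[OF f] S])
    finally show ?thesis by (simp only: mult.assoc)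
  qed
  then show ?thesis using that[of "S * W"] S W by simp
qed

text \<open>Guarantees that the supremum in \<open>sobolev_dual_norm\<close> runs over a nonempty
  set: a function with value 1 at the origin cannot have norm zero.\<close>

lemma sobolev_norm_nonzero:
  assumes m: "real m > CARD('n::finite) / 2"
  shows "\<exists>f :: real^'n \<Rightarrow> real. f \<in> sobolev m \<and> sobolev_norm m f \<noteq> 0"
proof -
  obtain C where C: "\<And>f :: real^'n \<Rightarrow> real. f \<in> smooth_L2 \<Longrightarrow> \<bar>f 0\<bar> \<le> C * sobolev_norm m f"
    using sobolev_inequality[OF m] by metis
  obtain \<eta> :: "real^'n \<Rightarrow> real" where \<eta>: "\<eta> \<in> test_functions" "\<eta> 0 = 1" using bump_exists by blast
  note s = test_functions_smooth_L2[OF \<eta>(1)]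
  have "sobolev_norm m \<eta> \<noteq> 0" using C[OF s] \<eta>(2) by auto
  then show ?thesis using smooth_L2_sobolev[OF s] by blast
qed

lemma solution_exists:
  fixes \<alpha> d a T :: real
  assumes \<alpha>: "0 < \<alpha>" "\<alpha> < 1" and d: "d > 0" and a: "a \<ge> 0" and T: "T > 0"
    and m: "real m > real CARD('n::finite) / 2"
  shows "\<exists>u :: real \<Rightarrow> (real^'n \<Rightarrow> real) \<Rightarrow> real. distributional_solution \<alpha> d a T m u"
proof -
  define V where "V t f = ml_value \<alpha> d a t (f :: real^'n \<Rightarrow> real)" for t f
  \<comment> \<open>The extension is the limit along one fixed sequence of mollifications; as each
    \<open>mollify j\<close> is linear, so is the limit.\<close>
  define U where "U t f = lim (\<lambda>j. V t (mollify j f))" for t f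
  obtain C where C: "C \<ge> 0" "\<And>t f. t \<in> {0..T} \<Longrightarrow> f \<in> bandlimited \<Longrightarrow> \<bar>V t f\<bar> \<le> C * sobolev_norm m f"
    unfolding V_def using ml_value_bound[OF m \<alpha> less_imp_le[OF d] a less_imp_le[OF T]] by metis
  note molb = mollify_bandlimited[OF sobolev_L2]
  note e0 = mollify_tendsto_sobolev
  have lim: "(\<lambda>j. V t (mollify j f)) \<longlonglongrightarrow> U t f" if t: "t \<in> {0..T}" and f: "f \<in> sobolev m" for t f
  proof -
    let ?e = "\<lambda>j. sobolev_norm m (\<lambda>x. mollify j f x - f x)"
    have le: "\<bar>V t (mollify i f) - V t (mollify j f)\<bar> \<le> C * (?e i + ?e j)" for i j
    proof -
      have "V t (mollify i f) - V t (mollify j f) = V t (\<lambda>x. mollify i f x - mollify j f x)"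
        unfolding V_def by (rule ml_value_diff[OF m molb[OF f] molb[OF f] \<alpha>(1), symmetric])
      also have "\<bar>\<dots>\<bar> \<le> C * sobolev_norm m (\<lambda>x. mollify i f x - mollify j f x)"
        by (intro C t bandlimited_diff molb[OF f])
      also have "\<dots> \<le> C * (?e i + ?e j)"
        by (intro mult_left_mono C sobolev_norm_diff_le mollify_sobolev[OF f] f)
      finally show ?thesis .
    qed
    have "Cauchy (\<lambda>j. V t (mollify j f))"
    proof (rule CauchyI)
      fix \<epsilon> :: real assume \<epsilon>: "\<epsilon> > 0"
      have "(\<lambda>j. C * ?e j) \<longlonglongrightarrow> 0" by (rule tendsto_mult_right_zero[OF e0[OF f]])
      from order_tendstoD(2)[OF this, of "\<epsilon> / 2"] \<epsilon> obtain J where J: "\<And>j. j \<ge> J \<Longrightarrow> C * ?e j < \<epsilon> / 2"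
        by (auto simp: eventually_sequentially)
      have "norm (V t (mollify i f) - V t (mollify j f)) < \<epsilon>" if "i \<ge> J" "j \<ge> J" for i j
        using le[of i j] J[OF that(1)] J[OF that(2)] unfolding real_norm_def distrib_left by linarith
      then show "\<exists>M. \<forall>i\<ge>M. \<forall>j\<ge>M. norm (V t (mollify i f) - V t (mollify j f)) < \<epsilon>" by blast
    qed
    then show ?thesis unfolding U_def
      using real_Cauchy_convergent convergent_LIMSEQ_iff by blast
  qed
  have Ub: "\<bar>U t f\<bar> \<le> C * sobolev_norm m f" if t: "t \<in> {0..T}" and f: "f \<in> sobolev m" for t f
  proof (rule tendsto_le[OF sequentially_bot])
    show "(\<lambda>j. \<bar>V t (mollify j f)\<bar>) \<longlonglongrightarrow> \<bar>U t f\<bar>" by (rule tendsto_rabs[OF lim[OF t f]])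
    have "(\<lambda>j. C * (sobolev_norm m (\<lambda>x. mollify j f x - f x) + sobolev_norm m f)) \<longlonglongrightarrow> C * (0 + sobolev_norm m f)"
      by (intro tendsto_intros e0[OF f])
    then show "(\<lambda>j. C * (sobolev_norm m (\<lambda>x. mollify j f x - f x) + sobolev_norm m f)) \<longlonglongrightarrow> C * sobolev_norm m f" by simp
    show "\<forall>\<^sub>F j in sequentially. \<bar>V t (mollify j f)\<bar> \<le> C * (sobolev_norm m (\<lambda>x. mollify j f x - f x) + sobolev_norm m f)"
    proof (intro always_eventually allI)
      fix j
      have "\<bar>V t (mollify j f)\<bar> \<le> C * sobolev_norm m (mollify j f)" by (rule C(2)[OF t molb[OF f]])
      moreover have "sobolev_norm m (\<lambda>x. (mollify j f x - f x) + f x) \<le> sobolev_norm m (\<lambda>x. mollify j f x - f x) + sobolev_norm m f"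
        by (intro sobolev_norm_triangle sobolev_diff mollify_sobolev[OF f] f)
      then have "C * sobolev_norm m (mollify j f) \<le> C * (sobolev_norm m (\<lambda>x. mollify j f x - f x) + sobolev_norm m f)"
        by (intro mult_left_mono C) simp
      ultimately show "\<bar>V t (mollify j f)\<bar> \<le> C * (sobolev_norm m (\<lambda>x. mollify j f x - f x) + sobolev_norm m f)" by linarith
    qed
  qed
  have Uadd: "U t (\<lambda>x. f x + g x) = U t f + U t g" if t: "t \<in> {0..T}" and f: "f \<in> sobolev m" and g: "g \<in> sobolev m" for t f g
  proof (rule LIMSEQ_unique[OF lim[OF t sobolev_add[OF f g]]])
    have "V t (mollify j (\<lambda>x. f x + g x)) = V t (mollify j f) + V t (mollify j g)" for j
      unfolding mollify_add[OF sobolev_L2[OF f] sobolev_L2[OF g]] V_def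
      by (rule ml_value_add[OF m molb[OF f] molb[OF g] \<alpha>(1)])
    then show "(\<lambda>j. V t (mollify j (\<lambda>x. f x + g x))) \<longlonglongrightarrow> U t f + U t g"
      using tendsto_add[OF lim[OF t f] lim[OF t g]] by simp
  qed
  have Ucmult: "U t (\<lambda>x. c * f x) = c * U t f" if t: "t \<in> {0..T}" and f: "f \<in> sobolev m" for t f c
  proof (rule LIMSEQ_unique[OF lim[OF t sobolev_cmult[OF f]]])
    have "V t (mollify j (\<lambda>x. c * f x)) = c * V t (mollify j f)" for j
      unfolding mollify_cmult V_def by (rule ml_value_cmult[OF m molb[OF f] \<alpha>(1)])
    then show "(\<lambda>j. V t (mollify j (\<lambda>x. c * f x))) \<longlonglongrightarrow> c * U t f"
      using tendsto_mult_left[OF lim[OF t f], of c] by simp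
  qed
  \<comment> \<open>Restriction supplies the extensionality demanded by \<open>sobolev_dual\<close>
    and \<open>Linf_alpha\<close>.\<close>
  define u where "u = (\<lambda>t\<in>{0..T}. \<lambda>f\<in>sobolev m. U t f)"
  have u: "u t f = U t f" if "t \<in> {0..T}" "f \<in> sobolev m" for t f using that by (simp add: u_def)
  have dual: "u t \<in> sobolev_dual m" if t: "t \<in> {0..T}" for t
    unfolding sobolev_dual_def
  proof (intro CollectI conjI ballI allI)
    show "u t \<in> extensional (sobolev m)" using t by (simp add: u_def)
    show "u t (\<lambda>x. f x + g x) = u t f + u t g" if "f \<in> sobolev m" "g \<in> sobolev m" for f g
      by (simp only: u[OF t] that sobolev_add Uadd[OF t])
    show "u t (\<lambda>x. c * f x) = c * u t f" if "f \<in> sobolev m" for c f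
      by (simp only: u[OF t] that sobolev_cmult Ucmult[OF t])
    show "\<exists>C. \<forall>f\<in>sobolev m. \<bar>u t f\<bar> \<le> C * sobolev_norm m f"
      by (intro exI[of _ C] ballI) (simp only: u[OF t] Ub[OF t])
  qed
  have norm: "sobolev_dual_norm m (u t) \<le> C" if t: "t \<in> {0..T}" for t
    unfolding sobolev_dual_norm_def
  proof (rule cSUP_least)
    show "{f :: real^'n \<Rightarrow> real. f \<in> sobolev m \<and> sobolev_norm m f \<noteq> 0} \<noteq> {}"
      using sobolev_norm_nonzero[OF m] by blast
    fix f :: "real^'n \<Rightarrow> real" assume f: "f \<in> {f \<in> sobolev m. sobolev_norm m f \<noteq> 0}"
    then have "sobolev_norm m f > 0" by (metis (mono_tags, lifting) less_eq_real_def mem_Collect_eq sobolev_norm_nonneg)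
    then show "\<bar>u t f\<bar> / sobolev_norm m f \<le> C" using Ub[OF t] u[OF t] f by (simp add: divide_le_eq)
  qed
  have Linf: "u \<in> Linf_alpha \<alpha> T m"
    unfolding Linf_alpha_def
  proof (intro CollectI conjI)
    show "u \<in> {0..T} \<rightarrow>\<^sub>E sobolev_dual m"
      using dual by (auto simp: PiE_def u_def)
    \<comment> \<open>The dual norms are bounded by C uniformly in t, so only the weight has to be
      estimated.\<close>
    have "t powr \<alpha> * sobolev_dual_norm m (u t) \<le> T powr \<alpha> * C" if t: "t \<in> {0..T}" for t
    proof -
      have "t powr \<alpha> * sobolev_dual_norm m (u t) \<le> t powr \<alpha> * C" by (intro mult_left_mono norm t) simp
      also have "\<dots> \<le> T powr \<alpha> * C" using t \<alpha> C by (intro mult_right_mono powr_mono2) auto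
      finally show ?thesis .
    qed
    then show "bdd_above ((\<lambda>t. t powr \<alpha> * sobolev_dual_norm m (u t)) ` {0..T})" by (intro bdd_aboveI2[of _ _ "T powr \<alpha> * C"])
  qed
  have "distributional_solution \<alpha> d a T m u"
    unfolding distributional_solution_def
  proof (intro conjI ballI)
    show "u \<in> Linf_alpha \<alpha> T m" by (rule Linf)
    fix \<phi> :: "real^'n \<Rightarrow> real" and t assume \<phi>: "\<phi> \<in> test_functions" and t: "t \<in> {0..T}"
    define \<psi> where "\<psi> = ellop d a \<phi>"
    note s\<phi> = test_functions_smooth_L2[OF \<phi>]
    have s\<psi>: "\<psi> \<in> smooth_L2" unfolding \<psi>_def by (rule smooth_L2_ellop[OF s\<phi>])
    note sob = smooth_L2_sobolev[OF s\<phi>, of m] smooth_L2_sobolev[OF s\<psi>, of m] smooth_L2_sobolev[OF smooth_L2_laplacian[OF s\<phi>], of m]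
    have t0: "t \<ge> 0" and sT: "\<And>s. 0 \<le> s \<Longrightarrow> s \<le> t \<Longrightarrow> s \<in> {0..T}" using t by auto
    define h where "h j s = V s (mollify j \<psi>)" for j s
    \<comment> \<open>The series solves the equation for band-limited functions, so the equation is
      taken for the mollifications of \<phi>, which commute with \<open>ellop\<close>, and then
      passed to the limit.\<close>
    have eqs: "set_integrable lebesgue {0..t} (\<lambda>s. h j s / (t - s) powr (1 - \<alpha>))"
      "V t (mollify j \<phi>) = mollify j \<phi> 0 + 1 / Gamma \<alpha> * (LINT s:{0..t}|lebesgue. h j s / (t - s) powr (1 - \<alpha>))" for j
      using ml_value_equation[OF m molb[OF sob(1)] \<alpha>(1) t0, of d a j]
      unfolding mollify_ellop[OF s\<phi>] V_def h_def \<psi>_def by auto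
    obtain B where B: "\<And>j. sobolev_norm m (mollify j \<psi>) \<le> B"
      using sobolev_norm_approx_bound[OF sob(2) mollify_sobolev[OF sob(2)] e0[OF sob(2)]] by metis
    have hlim: "(\<lambda>j. h j s) \<longlonglongrightarrow> U s \<psi>" if "0 < s" "s \<le> t" for s
      unfolding h_def by (rule lim[OF sT sob(2)]) (use that in auto)
    have hb: "\<bar>h j s\<bar> \<le> (C * B) * s powr (- 0)" if "0 < s" "s \<le> t" for j s
    proof -
      have "\<bar>h j s\<bar> \<le> C * sobolev_norm m (mollify j \<psi>)"
        unfolding h_def by (rule C(2)[OF sT molb[OF sob(2)]]) (use that in auto)
      also have "\<dots> \<le> C * B" by (rule mult_left_mono[OF B C(1)])
      finally show ?thesis using that by simp
    qed
    note dc = fractional_dominated_convergence[OF \<alpha>(1) t0 zero_less_one eqs(1) hlim hb]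
    \<comment> \<open>Evaluation at the origin is continuous in the Sobolev norm; this recovers the
      initial datum.\<close>
    have at0: "(\<lambda>j. mollify j \<phi> 0) \<longlonglongrightarrow> \<phi> 0"
    proof -
      obtain D where D: "\<And>f :: real^'n \<Rightarrow> real. f \<in> smooth_L2 \<Longrightarrow> \<bar>f 0\<bar> \<le> D * sobolev_norm m f"
        using sobolev_inequality[OF m] by metis
      show ?thesis
      proof (rule LIM_zero_cancel, rule Lim_null_comparison[OF _ tendsto_mult_right_zero[OF e0[OF sob(1)], of D]], intro always_eventually allI)
        fix j
        show "norm (mollify j \<phi> 0 - \<phi> 0) \<le> D * sobolev_norm m (\<lambda>x. mollify j \<phi> x - \<phi> x)"
          using D[OF smooth_L2_diff[OF bandlimited_smooth_L2[OF molb[OF sob(1)]] s\<phi>], of j] by simp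
      qed
    qed
    have "(\<lambda>j. V t (mollify j \<phi>)) \<longlonglongrightarrow> \<phi> 0 + 1 / Gamma \<alpha> * (LINT s:{0..t}|lebesgue. U s \<psi> / (t - s) powr (1 - \<alpha>))"
      unfolding eqs(2) by (intro tendsto_add tendsto_mult tendsto_const at0 dc(2))
    then have Ueq: "U t \<phi> = \<phi> 0 + 1 / Gamma \<alpha> * (LINT s:{0..t}|lebesgue. U s \<psi> / (t - s) powr (1 - \<alpha>))"
      by (rule LIMSEQ_unique[OF lim[OF t sob(1)]])
    have eqU: "(d * u s (laplacian \<phi>) + a * u s \<phi>) / (t - s) powr (1 - \<alpha>) = U s \<psi> / (t - s) powr (1 - \<alpha>)" if "s \<in> {0..t}" for s
    proof -
      have s: "s \<in> {0..T}" using that sT by auto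
      have "U s \<psi> = d * U s (laplacian \<phi>) + a * U s \<phi>"
        unfolding \<psi>_def ellop_def by (simp only: Uadd[OF s] Ucmult[OF s] sobolev_cmult sob)
      then show ?thesis by (simp only: u[OF s] sob)
    qed
    have "set_integrable lebesgue {0..t} (\<lambda>s. (d * u s (laplacian \<phi>) + a * u s \<phi>) / (t - s) powr (1 - \<alpha>)) \<longleftrightarrow>
      set_integrable lebesgue {0..t} (\<lambda>s. U s \<psi> / (t - s) powr (1 - \<alpha>))"
      by (rule set_integrable_cong) (use eqU in auto)
    then show "set_integrable lebesgue {0..t} (\<lambda>s. (d * u s (laplacian \<phi>) + a * u s \<phi>) / (t - s) powr (1 - \<alpha>))"
      using dc(1) by simp
    have "(LINT s:{0..t}|lebesgue. (d * u s (laplacian \<phi>) + a * u s \<phi>) / (t - s) powr (1 - \<alpha>)) = (LINT s:{0..t}|lebesgue. U s \<psi> / (t - s) powr (1 - \<alpha>))"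
      by (rule set_lebesgue_integral_cong) (use eqU in auto)
    then show "u t \<phi> = \<phi> 0 + 1 / Gamma \<alpha> * (LINT s:{0..t}|lebesgue. (d * u s (laplacian \<phi>) + a * u s \<phi>) / (t - s) powr (1 - \<alpha>))"
      using Ueq by (simp only: u[OF t] sob)
  qed
  then show ?thesis by blast
qed

section \<open>Uniqueness\<close>

text \<open>The lists are chosen once for all f, so that their lengths, which enter the geometric
  bounds, do not vary with the power of the operator.\<close>

lemma sobolev_norm_le_iter_partials:
  obtains J :: "('n::finite \<Rightarrow> nat) \<Rightarrow> 'n list" where
    "\<And>f :: real^'n \<Rightarrow> real. f \<in> smooth_L2 \<Longrightarrow> sobolev_norm m f \<le> (\<Sum>\<beta> | mi_order \<beta> \<le> m. l2_norm (iter_partial (J \<beta>) f))"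
proof -
  obtain J :: "('n \<Rightarrow> nat) \<Rightarrow> 'n list" where J: "\<And>\<beta>. count_list (J \<beta>) = \<beta>" using multi_index_list by metis
  have "sobolev_norm m f \<le> (\<Sum>\<beta> | mi_order \<beta> \<le> m. l2_norm (iter_partial (J \<beta>) f))" if f: "f \<in> smooth_L2" for f :: "real^'n \<Rightarrow> real"
  proof (rule sobolev_norm_le_sum[OF smooth_L2_L2[OF f]], rule conjI)
    show "iter_partial (J \<beta>) f \<in> L2" for \<beta> by (rule smooth_L2_iter_L2[OF f])
    show "has_weak_deriv \<beta> f (iter_partial (J \<beta>) f)" for \<beta>
      using has_weak_deriv_smooth_L2[OF f, of "J \<beta>"] by (simp only: J)
  qed
  then show ?thesis using that by blast
qed

lemma ellop_tendsto:
  fixes h :: "nat \<Rightarrow> real^'n::finite \<Rightarrow> real"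
  assumes h: "\<And>n. h n \<in> smooth_L2" and lim: "\<And>js. (\<lambda>n. l2_norm (iter_partial js (h n))) \<longlonglongrightarrow> 0"
  shows "(\<lambda>n. l2_norm (iter_partial js (ellop d a (h n)))) \<longlonglongrightarrow> 0"
proof (rule Lim_null_comparison)
  note L = smooth_L2_iter_L2[OF h]
  have "(\<lambda>n. \<bar>d\<bar> * (\<Sum>i\<in>UNIV. l2_norm (iter_partial ([i, i] @ js) (h n))) + \<bar>a\<bar> * l2_norm (iter_partial js (h n))) \<longlonglongrightarrow> \<bar>d\<bar> * (\<Sum>i\<in>(UNIV :: 'n set). 0) + \<bar>a\<bar> * 0"
    by (intro tendsto_intros lim)
  then show "(\<lambda>n. \<bar>d\<bar> * (\<Sum>i\<in>UNIV. l2_norm (iter_partial ([i, i] @ js) (h n))) + \<bar>a\<bar> * l2_norm (iter_partial js (h n))) \<longlonglongrightarrow> 0" by simp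
  show "\<forall>\<^sub>F n in sequentially. norm (l2_norm (iter_partial js (ellop d a (h n)))) \<le> \<bar>d\<bar> * (\<Sum>i\<in>UNIV. l2_norm (iter_partial ([i, i] @ js) (h n))) + \<bar>a\<bar> * l2_norm (iter_partial js (h n))"
  proof (intro always_eventually allI)
    fix n
    have "iter_partial js (ellop d a (h n)) = (\<lambda>x. d * (\<Sum>i\<in>UNIV. iter_partial ([i, i] @ js) (h n) x) + a * iter_partial js (h n) x)"
      using iter_partial_ellop[OF smooth_L2_smooth[OF h], of js d a n]
      unfolding ellop_def[of d a "iter_partial js (h n)"] laplacian_eq iter_partial_append .
    then have "l2_norm (iter_partial js (ellop d a (h n))) \<le> l2_norm (\<lambda>x. d * (\<Sum>i\<in>UNIV. iter_partial ([i, i] @ js) (h n) x)) + l2_norm (\<lambda>x. a * iter_partial js (h n) x)"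
      by (simp only:) (intro l2_norm_triangle L2_cmult L2_sum L)
    also have "\<dots> \<le> \<bar>d\<bar> * (\<Sum>i\<in>UNIV. l2_norm (iter_partial ([i, i] @ js) (h n))) + \<bar>a\<bar> * l2_norm (iter_partial js (h n))"
      unfolding l2_norm_cmult by (intro add_mono mult_left_mono l2_norm_sum_le L order_refl abs_ge_zero)
    finally show "norm (l2_norm (iter_partial js (ellop d a (h n)))) \<le> \<bar>d\<bar> * (\<Sum>i\<in>UNIV. l2_norm (iter_partial ([i, i] @ js) (h n))) + \<bar>a\<bar> * l2_norm (iter_partial js (h n))"
      by simp
  qed
qed

lemma ellop_diff:
  assumes "smooth f" "smooth g"
  shows "ellop d a (\<lambda>x. f x - g x) = (\<lambda>x. ellop d a f x - ellop d a g x)"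
  using ellop_add[OF assms(1) smooth_cmult[OF assms(2), of "-1"], of d a] ellop_cmult[OF assms(2), of d a "-1"] by simp

lemma set_integral_singleton: "(LINT s:{c}|lebesgue. f s) = (0 :: real)" for c :: real and f :: "real \<Rightarrow> real"
proof -
  have "(\<lambda>s. indicator {c} s *\<^sub>R f s) = (\<lambda>s. indicator {c} s *\<^sub>R f c)" by (auto simp: indicator_def)
  then have "(LINT s:{c}|lebesgue. f s) = (LINT s|lebesgue. indicator {c} s *\<^sub>R f c)"
    by (simp only: set_lebesgue_integral_def)
  also have "\<dots> = 0"
    by (subst integral_scaleR_left) (auto intro!: integrable_real_indicator)
  finally show ?thesis .
qed

lemma fractional_integral_bound:
  fixes h :: "real \<Rightarrow> real"
  assumes \<alpha>: "\<alpha> > 0" and t: "t \<ge> 0" and \<beta>: "\<beta> > -1"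
    and int: "set_integrable lebesgue {0..t} (\<lambda>s. h s / (t - s) powr (1 - \<alpha>))"
    and bound: "\<And>s. 0 < s \<Longrightarrow> s \<le> t \<Longrightarrow> \<bar>h s\<bar> \<le> X * s powr \<beta>"
  shows "\<bar>1 / Gamma \<alpha> * (LINT s:{0..t}|lebesgue. h s / (t - s) powr (1 - \<alpha>))\<bar>
    \<le> X * Gamma (\<beta> + 1) / Gamma (\<beta> + \<alpha> + 1) * t powr (\<beta> + \<alpha>)"
proof -
  have G: "Gamma \<alpha> > 0" using \<alpha> by simp
  note k = fractional_kernel_integrable[OF t \<beta> \<alpha>]
  have ik: "integrable lebesgue (\<lambda>s. X * (indicator {0..t} s *\<^sub>R (s powr \<beta> / (t - s) powr (1 - \<alpha>))))"
    using k(1) unfolding set_integrable_def by (intro integrable_mult_right)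
  have "\<bar>LINT s:{0..t}|lebesgue. h s / (t - s) powr (1 - \<alpha>)\<bar> \<le> (LINT s|lebesgue. \<bar>indicator {0..t} s *\<^sub>R (h s / (t - s) powr (1 - \<alpha>))\<bar>)"
    unfolding set_lebesgue_integral_def by (rule integral_abs_bound)
  also have "\<dots> \<le> (LINT s|lebesgue. X * (indicator {0..t} s *\<^sub>R (s powr \<beta> / (t - s) powr (1 - \<alpha>))))"
  proof (rule integral_mono_AE)
    show "integrable lebesgue (\<lambda>s. \<bar>indicator {0..t} s *\<^sub>R (h s / (t - s) powr (1 - \<alpha>))\<bar>)"
      using int unfolding set_integrable_def by (rule integrable_abs)
    show "AE s in lebesgue. \<bar>indicator {0..t} s *\<^sub>R (h s / (t - s) powr (1 - \<alpha>))\<bar> \<le> X * (indicator {0..t} s *\<^sub>R (s powr \<beta> / (t - s) powr (1 - \<alpha>)))"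
    proof (rule AE_mp[OF AE_completion[OF AE_lborel_singleton[of 0]]], intro AE_I2 impI)
      fix s :: real assume s: "s \<noteq> 0"
      show "\<bar>indicator {0..t} s *\<^sub>R (h s / (t - s) powr (1 - \<alpha>))\<bar> \<le> X * (indicator {0..t} s *\<^sub>R (s powr \<beta> / (t - s) powr (1 - \<alpha>)))"
      proof (cases "s \<in> {0..t}")
        case True
        then have "\<bar>h s\<bar> / (t - s) powr (1 - \<alpha>) \<le> X * s powr \<beta> / (t - s) powr (1 - \<alpha>)"
          using s by (intro divide_right_mono bound) auto
        then show ?thesis using True by simp
      qed simp
    qed
  qed (rule ik)
  also have "\<dots> = X * (t powr (\<beta> + \<alpha>) * Beta (\<beta> + 1) \<alpha>)"
    using k(2) unfolding set_lebesgue_integral_def by (subst integral_mult_right_zero) simp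
  finally have "\<bar>1 / Gamma \<alpha> * (LINT s:{0..t}|lebesgue. h s / (t - s) powr (1 - \<alpha>))\<bar> \<le> 1 / Gamma \<alpha> * (X * (t powr (\<beta> + \<alpha>) * Beta (\<beta> + 1) \<alpha>))"
    unfolding abs_mult using G by (intro mult_mono) auto
  also have "\<dots> = X * Gamma (\<beta> + 1) / Gamma (\<beta> + \<alpha> + 1) * t powr (\<beta> + \<alpha>)"
  proof -
    have "\<beta> + 1 + \<alpha> = \<beta> + \<alpha> + 1" by simp
    then show ?thesis using G by (simp only: Beta_def) (simp add: field_simps)
  qed
  finally show ?thesis .
qed

lemma solution_unique:
  fixes \<alpha> d a T :: real and u1 u2 :: "real \<Rightarrow> (real^'n::finite \<Rightarrow> real) \<Rightarrow> real"
  assumes \<alpha>: "0 < \<alpha>" "\<alpha> < 1"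
    and sol: "distributional_solution \<alpha> d a T m u1" "distributional_solution \<alpha> d a T m u2"
  shows "u1 = u2"
proof -
  have Linf: "u1 \<in> Linf_alpha \<alpha> T m" "u2 \<in> Linf_alpha \<alpha> T m"
    using sol unfolding distributional_solution_def by auto
  have dual: "u1 t \<in> sobolev_dual m" "u2 t \<in> sobolev_dual m" if "t \<in> {0..T}" for t
    using Linf that unfolding Linf_alpha_def by auto
  define w where "w t f = u1 t f - u2 t f" for t f
  define D where "D t = sobolev_dual_norm m (u1 t) + sobolev_dual_norm m (u2 t)" for t
  have wb: "\<bar>w t f\<bar> \<le> D t * sobolev_norm m f" if "t \<in> {0..T}" "f \<in> sobolev m" for t f
    using sobolev_dual_bound[OF dual(1)[OF that(1)] that(2)] sobolev_dual_bound[OF dual(2)[OF that(1)] that(2)]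
    unfolding w_def D_def distrib_right by linarith
  have ul: "u t (\<lambda>x. f x + g x) = u t f + u t g" "u t (\<lambda>x. c * f x) = c * u t f"
    if "u \<in> {u1, u2}" "t \<in> {0..T}" "f \<in> sobolev m" "g \<in> sobolev m" for u t f g c
    using that dual[OF that(2)] unfolding sobolev_dual_def by auto
  have wdiff: "w t (\<lambda>x. f x - g x) = w t f - w t g" if t: "t \<in> {0..T}" and f: "f \<in> sobolev m" and g: "g \<in> sobolev m" for t f g
  proof -
    have "u t (\<lambda>x. f x - g x) = u t f - u t g" if "u \<in> {u1, u2}" for u
      using ul(1)[OF that t f sobolev_cmult[OF g, of "-1"]] ul(2)[OF that t g g, of "-1"] by simp
    from this[of u1] this[of u2] show ?thesis by (simp add: w_def)
  qed
  \<comment> \<open>The weighted supremum in \<open>Linf_alpha\<close> turns into a bound with the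
    singularity t^(-\<alpha>).\<close>
  obtain M where M: "M \<ge> 0" "\<And>t. 0 < t \<Longrightarrow> t \<le> T \<Longrightarrow> D t \<le> M * t powr (- \<alpha>)"
  proof -
    obtain M1 M2 where M12: "\<forall>t\<in>{0..T}. t powr \<alpha> * sobolev_dual_norm m (u1 t) \<le> M1"
       "\<forall>t\<in>{0..T}. t powr \<alpha> * sobolev_dual_norm m (u2 t) \<le> M2"
      using Linf unfolding Linf_alpha_def bdd_above_def by auto
    have "D t \<le> \<bar>M1 + M2\<bar> * t powr (- \<alpha>)" if t: "0 < t" "t \<le> T" for t
    proof -
      have "t powr \<alpha> * D t \<le> \<bar>M1 + M2\<bar>"
        unfolding D_def distrib_left using bspec[OF M12(1), of t] bspec[OF M12(2), of t] t by auto
      then have "t powr (- \<alpha>) * (t powr \<alpha> * D t) \<le> t powr (- \<alpha>) * \<bar>M1 + M2\<bar>" by (rule mult_left_mono) simp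
      moreover have "t powr (- \<alpha>) * (t powr \<alpha> * D t) = D t"
        using t by (simp add: mult.assoc[symmetric] powr_add[symmetric])
      ultimately show ?thesis by (simp only: mult.commute)
    qed
    then show ?thesis using that[of "\<bar>M1 + M2\<bar>"] by simp
  qed
  have wM: "\<bar>w t f\<bar> \<le> M * t powr (- \<alpha>) * sobolev_norm m f" if "0 < t" "t \<le> T" "f \<in> sobolev m" for t f
    by (rule order_trans[OF wb mult_right_mono[OF M(2)]]) (use that in auto)
  have test: "set_integrable lebesgue {0..t} (\<lambda>s. w s (ellop d a \<phi>) / (t - s) powr (1 - \<alpha>))"
    "w t \<phi> = 1 / Gamma \<alpha> * (LINT s:{0..t}|lebesgue. w s (ellop d a \<phi>) / (t - s) powr (1 - \<alpha>))"
    if \<phi>: "\<phi> \<in> test_functions" and t: "t \<in> {0..T}" for \<phi> t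
  proof -
    note s\<phi> = test_functions_smooth_L2[OF \<phi>]
    note sob = smooth_L2_sobolev[OF s\<phi>, of m] smooth_L2_sobolev[OF smooth_L2_laplacian[OF s\<phi>], of m]
    have e: "u s (ellop d a \<phi>) = d * u s (laplacian \<phi>) + a * u s \<phi>" if u: "u \<in> {u1, u2}" and s: "s \<in> {0..t}" for u s
    proof -
      have s': "s \<in> {0..T}" using s t by auto
      show ?thesis
        unfolding ellop_def using ul(1)[OF u s' sobolev_cmult[OF sob(2), of d] sobolev_cmult[OF sob(1), of a]]
          ul(2)[OF u s' sob(2,2), of d] ul(2)[OF u s' sob(1,1), of a] by simp
    qed
    let ?g = "\<lambda>u s. (d * u s (laplacian \<phi>) + a * u s \<phi>) / (t - s) powr (1 - \<alpha>)"
    have i: "set_integrable lebesgue {0..t} (?g u1)" "set_integrable lebesgue {0..t} (?g u2)"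
      "u1 t \<phi> = \<phi> 0 + 1 / Gamma \<alpha> * (LINT s:{0..t}|lebesgue. ?g u1 s)"
      "u2 t \<phi> = \<phi> 0 + 1 / Gamma \<alpha> * (LINT s:{0..t}|lebesgue. ?g u2 s)"
      using sol \<phi> t unfolding distributional_solution_def by blast+
    have wg: "w s (ellop d a \<phi>) / (t - s) powr (1 - \<alpha>) = ?g u1 s - ?g u2 s" if "s \<in> {0..t}" for s
      using e[of u1 s] e[of u2 s] that by (simp add: w_def diff_divide_distrib)
    have "set_integrable lebesgue {0..t} (\<lambda>s. w s (ellop d a \<phi>) / (t - s) powr (1 - \<alpha>)) \<longleftrightarrow> set_integrable lebesgue {0..t} (\<lambda>s. ?g u1 s - ?g u2 s)"
      by (rule set_integrable_cong) (use wg in auto)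
    then show "set_integrable lebesgue {0..t} (\<lambda>s. w s (ellop d a \<phi>) / (t - s) powr (1 - \<alpha>))"
      using set_integral_diff(1)[OF i(1,2)] by simp
    have "(LINT s:{0..t}|lebesgue. w s (ellop d a \<phi>) / (t - s) powr (1 - \<alpha>)) = (LINT s:{0..t}|lebesgue. ?g u1 s - ?g u2 s)"
      by (rule set_lebesgue_integral_cong) (use wg in auto)
    also have "\<dots> = (LINT s:{0..t}|lebesgue. ?g u1 s) - (LINT s:{0..t}|lebesgue. ?g u2 s)"
      by (rule set_integral_diff(2)[OF i(1,2)])
    finally show "w t \<phi> = 1 / Gamma \<alpha> * (LINT s:{0..t}|lebesgue. w s (ellop d a \<phi>) / (t - s) powr (1 - \<alpha>))"
      unfolding w_def[of t \<phi>] i(3,4) by (simp only: right_diff_distrib)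
  qed
  \<comment> \<open>The iteration needs the equation for functions whose powers grow geometrically,
    hence beyond test functions. Cutoffs converge together with all derivatives, so f and
    \<open>ellop d a f\<close> are both approximated in the Sobolev norm.\<close>
  have smooth_eq: "set_integrable lebesgue {0..t} (\<lambda>s. w s (ellop d a f) / (t - s) powr (1 - \<alpha>)) \<and>
    w t f = 1 / Gamma \<alpha> * (LINT s:{0..t}|lebesgue. w s (ellop d a f) / (t - s) powr (1 - \<alpha>))"
    if f: "f \<in> smooth_L2" and t: "t \<in> {0..T}" for f t
  proof -
    obtain \<phi> where \<phi>: "\<And>n. \<phi> n \<in> test_functions"
      "\<And>js. (\<lambda>n. l2_norm (\<lambda>x. iter_partial js (\<phi> n) x - iter_partial js f x)) \<longlonglongrightarrow> 0"
      using test_functions_dense_smooth_L2[OF f] by blast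
    note s\<phi> = test_functions_smooth_L2[OF \<phi>(1)]
    define h where "h n = (\<lambda>x. \<phi> n x - f x)" for n
    have h: "h n \<in> smooth_L2" for n unfolding h_def by (rule smooth_L2_diff[OF s\<phi> f])
    have hl: "(\<lambda>n. l2_norm (iter_partial js (h n))) \<longlonglongrightarrow> 0" for js
      unfolding h_def iter_partial_diff[OF smooth_L2_smooth[OF s\<phi>] smooth_L2_smooth[OF f]] by (rule \<phi>(2))
    have h0: "(\<lambda>n. sobolev_norm m (h n)) \<longlonglongrightarrow> 0" by (rule smooth_L2_tendsto_sobolev[OF h hl])
    have Lh: "ellop d a (h n) = (\<lambda>x. ellop d a (\<phi> n) x - ellop d a f x)" for n
      unfolding h_def by (rule ellop_diff[OF smooth_L2_smooth[OF s\<phi>] smooth_L2_smooth[OF f]])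
    have Lh0: "(\<lambda>n. sobolev_norm m (ellop d a (h n))) \<longlonglongrightarrow> 0"
      by (rule smooth_L2_tendsto_sobolev[OF smooth_L2_ellop[OF h] ellop_tendsto[OF h hl]])
    note sob = smooth_L2_sobolev[OF s\<phi>, where m = m] smooth_L2_sobolev[OF f, where m = m]
      smooth_L2_sobolev[OF smooth_L2_ellop[where d = d and a = a, OF s\<phi>], where m = m] smooth_L2_sobolev[OF smooth_L2_ellop[where d = d and a = a, OF f], where m = m]
    have wl: "(\<lambda>n. w s (g n)) \<longlonglongrightarrow> w s g'" if s: "s \<in> {0..T}" and g: "\<And>n. g n \<in> sobolev m" "g' \<in> sobolev m"
      and l: "(\<lambda>n. sobolev_norm m (\<lambda>x. g n x - g' x)) \<longlonglongrightarrow> 0" for s g g'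
    proof (rule LIM_zero_cancel, rule Lim_null_comparison[OF _ tendsto_mult_right_zero[OF l, of "D s"]], intro always_eventually allI)
      show "norm (w s (g n) - w s g') \<le> D s * sobolev_norm m (\<lambda>x. g n x - g' x)" for n
        using wb[OF s sobolev_diff[OF g]] by (simp only: wdiff[OF s g] real_norm_def)
    qed
    obtain B where B: "\<And>n. sobolev_norm m (ellop d a (\<phi> n)) \<le> B"
      using sobolev_norm_approx_bound[OF sob(4) sob(3) Lh0[unfolded Lh]] by metis
    have t0: "t \<ge> 0" using t by simp
    have l: "(\<lambda>n. w s (ellop d a (\<phi> n))) \<longlonglongrightarrow> w s (ellop d a f)" if "0 < s" "s \<le> t" for s
      by (rule wl[OF _ sob(3,4) Lh0[unfolded Lh]]) (use that t in auto)
    have b: "\<bar>w s (ellop d a (\<phi> n))\<bar> \<le> (M * B) * s powr (- \<alpha>)" if "0 < s" "s \<le> t" for n s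
    proof -
      have "\<bar>w s (ellop d a (\<phi> n))\<bar> \<le> M * s powr (- \<alpha>) * sobolev_norm m (ellop d a (\<phi> n))"
        by (rule wM[OF _ _ sob(3)]) (use that t in auto)
      also have "\<dots> \<le> M * s powr (- \<alpha>) * B" using M by (intro mult_left_mono B) auto
      finally show ?thesis by (simp only: mult_ac)
    qed
    note dc = fractional_dominated_convergence[OF \<alpha>(1) t0 \<alpha>(2) test(1)[OF \<phi>(1) t] l b]
    have "(\<lambda>n. w t (\<phi> n)) \<longlonglongrightarrow> 1 / Gamma \<alpha> * (LINT s:{0..t}|lebesgue. w s (ellop d a f) / (t - s) powr (1 - \<alpha>))"
      unfolding test(2)[OF \<phi>(1) t] by (intro tendsto_mult tendsto_const dc(2))
    moreover have "(\<lambda>n. w t (\<phi> n)) \<longlonglongrightarrow> w t f" by (rule wl[OF t sob(1,2) h0[unfolded h_def]])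
    ultimately show ?thesis using dc(1) LIMSEQ_unique by blast
  qed
  have band0: "w t f = 0" if f: "f \<in> bandlimited" and t: "t \<in> {0..T}" for f t
  proof (cases "t = 0")
    \<comment> \<open>At t = 0 the weighted bound carries no information; the equation itself gives
      zero there.\<close>
    case True
    then show ?thesis using smooth_eq[OF bandlimited_smooth_L2[OF f] t] by (simp add: set_integral_singleton)
  next
    case False
    then have tp: "t > 0" "t \<le> T" using t by auto
    note f' = bandlimited_smooth_L2[OF f]
    let ?L = "\<lambda>k. (ellop d a ^^ k) f"
    have L: "?L k \<in> smooth_L2" for k by (rule smooth_L2_ellop_pow[OF f'])
    obtain C \<kappa> where ck: "\<kappa> \<ge> 0" "\<And>k. sobolev_norm m (?L k) \<le> C * \<kappa> ^ k"
    proof -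
      obtain C \<kappa> K where c: "\<kappa> \<ge> 0" "\<And>k js. l2_norm (iter_partial js (?L k)) \<le> C * \<kappa> ^ k * K ^ length js"
        using bandlimited_ellop_pow[OF f, of d a] by metis
      obtain J :: "('n \<Rightarrow> nat) \<Rightarrow> 'n list" where J: "\<And>f :: real^'n \<Rightarrow> real. f \<in> smooth_L2 \<Longrightarrow> sobolev_norm m f \<le> (\<Sum>\<beta> | mi_order \<beta> \<le> m. l2_norm (iter_partial (J \<beta>) f))"
        using sobolev_norm_le_iter_partials by blast
      have "sobolev_norm m (?L k) \<le> (\<Sum>\<beta> | mi_order \<beta> \<le> m. C * K ^ length (J \<beta>)) * \<kappa> ^ k" for k
      proof -
        have "sobolev_norm m (?L k) \<le> (\<Sum>\<beta> | mi_order \<beta> \<le> m. C * \<kappa> ^ k * K ^ length (J \<beta>))"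
          by (rule order_trans[OF J[OF L]]) (intro sum_mono c(2))
        also have "\<dots> = (\<Sum>\<beta> | mi_order \<beta> \<le> m. C * K ^ length (J \<beta>)) * \<kappa> ^ k"
          unfolding sum_distrib_right by (intro sum.cong refl) (simp only: mult_ac)
        finally show ?thesis .
      qed
      with c(1) that show ?thesis by blast
    qed
    \<comment> \<open>The induction starts from the a priori bound with exponent -\<alpha>. Each
      step uses the equation for the k-th power, whose right side contains the next power, so k
      stays arbitrary; the Gamma quotients telescope.\<close>
    have it: "\<bar>w s (?L k)\<bar> \<le> M * C * \<kappa> ^ (k + n) * Gamma (1 - \<alpha>) / Gamma (\<alpha> * real n + (1 - \<alpha>)) * s powr (\<alpha> * real n - \<alpha>)"
      if "0 < s" "s \<le> T" for s k n
      using that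
    proof (induction n arbitrary: k s)
      case 0
      have "\<bar>w s (?L k)\<bar> \<le> M * s powr (- \<alpha>) * sobolev_norm m (?L k)"
        by (rule wM[OF 0 smooth_L2_sobolev[OF L]])
      also have "\<dots> \<le> M * s powr (- \<alpha>) * (C * \<kappa> ^ k)" using M by (intro mult_left_mono ck(2)) auto
      finally have "\<bar>w s (?L k)\<bar> \<le> M * s powr (- \<alpha>) * (C * \<kappa> ^ k)" .
      \<comment> \<open>For n = 0 the two Gamma factors cancel.\<close>
      moreover have "Gamma (1 - \<alpha>) \<noteq> 0" using Gamma_real_pos[of "1 - \<alpha>"] \<alpha> by linarith
      ultimately show ?case by (simp add: mult_ac)
    next
      case (Suc n)
      define \<beta> where "\<beta> = \<alpha> * real n - \<alpha>"
      have \<beta>: "\<beta> > -1" using \<alpha> by (simp add: \<beta>_def) (smt (verit) mult_nonneg_nonneg of_nat_0_le_iff)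
      define X where "X = M * C * \<kappa> ^ (Suc k + n) * Gamma (1 - \<alpha>) / Gamma (\<alpha> * real n + (1 - \<alpha>))"
      have sT: "s \<in> {0..T}" "s \<ge> 0" using Suc.prems by auto
      note eq = smooth_eq[OF L sT(1), of k]
      have Lk: "ellop d a (?L k) = ?L (Suc k)" by simp
      have "\<bar>w s (?L k)\<bar> \<le> X * Gamma (\<beta> + 1) / Gamma (\<beta> + \<alpha> + 1) * s powr (\<beta> + \<alpha>)"
        unfolding conjunct2[OF eq]
      proof (rule fractional_integral_bound[OF \<alpha>(1) sT(2) \<beta> conjunct1[OF eq]])
        fix r assume "0 < r" "r \<le> s"
        then show "\<bar>w r (ellop d a (?L k))\<bar> \<le> X * r powr \<beta>"
          using Suc.IH[of r "Suc k"] Suc.prems unfolding X_def \<beta>_def Lk by simp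
      qed
      also have "\<beta> + \<alpha> = \<alpha> * real (Suc n) - \<alpha>" by (simp add: \<beta>_def algebra_simps)
      also have "X * Gamma (\<beta> + 1) / Gamma (\<alpha> * real (Suc n) - \<alpha> + 1) = M * C * \<kappa> ^ (k + Suc n) * Gamma (1 - \<alpha>) / Gamma (\<alpha> * real (Suc n) + (1 - \<alpha>))"
      proof -
        have 1: "\<alpha> * real n + (1 - \<alpha>) = \<beta> + 1" by (simp add: \<beta>_def)
        have 2: "\<alpha> * real (Suc n) + (1 - \<alpha>) = \<alpha> * real (Suc n) - \<alpha> + 1" by simp
        have "Gamma (\<beta> + 1) > 0" using \<beta> by simp
        then show ?thesis unfolding X_def 1 2 by simp
      qed
      finally show ?case .
    qed
    have "(\<lambda>n. (M * C * Gamma (1 - \<alpha>) * t powr (- \<alpha>)) * ((\<kappa> * t powr \<alpha>) ^ n / Gamma (\<alpha> * real n + (1 - \<alpha>)))) \<longlonglongrightarrow> 0"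
      by (intro tendsto_mult_right_zero summable_LIMSEQ_zero summable_power_over_Gamma) (use \<alpha> ck in auto)
    moreover have "\<bar>w t f\<bar> \<le> (M * C * Gamma (1 - \<alpha>) * t powr (- \<alpha>)) * ((\<kappa> * t powr \<alpha>) ^ n / Gamma (\<alpha> * real n + (1 - \<alpha>)))" for n
    proof -
      have "t powr (\<alpha> * real n - \<alpha>) = (t powr \<alpha>) ^ n * t powr (- \<alpha>)"
        using tp by (simp add: powr_realpow[symmetric] powr_powr powr_add[symmetric])
      then show ?thesis using it[OF tp, of 0 n] by (simp add: power_mult_distrib mult_ac)
    qed
    ultimately have "\<bar>w t f\<bar> \<le> 0" by (intro LIMSEQ_le_const) auto
    then show ?thesis by simp
  qed
  \<comment> \<open>At a fixed time \<open>w t\<close> is continuous on the Sobolev space, so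
    vanishing on mollifications is enough.\<close>
  have sob0: "w t f = 0" if f: "f \<in> sobolev m" and t: "t \<in> {0..T}" for f t
  proof -
    note mf = mollify_sobolev[OF f, of _ m]
    have "\<bar>w t f\<bar> \<le> D t * sobolev_norm m (\<lambda>x. mollify j f x - f x)" for j
      using wb[OF t sobolev_diff[OF mf f], of j] wdiff[OF t mf f, of j] band0[OF mollify_bandlimited[OF sobolev_L2[OF f]] t, of j]
      by simp
    moreover have "(\<lambda>j. D t * sobolev_norm m (\<lambda>x. mollify j f x - f x)) \<longlonglongrightarrow> 0"
      by (rule tendsto_mult_right_zero[OF mollify_tendsto_sobolev[OF f]])
    ultimately have "\<bar>w t f\<bar> \<le> 0" by (intro LIMSEQ_le_const) auto
    then show ?thesis by simp
  qed
  \<comment> \<open>Both solutions are extensional in t and in f, so agreement on [0, T] and on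
    \<open>sobolev m\<close> is equality.\<close>
  show ?thesis
  proof (rule PiE_ext)
    show "u1 \<in> PiE {0..T} (\<lambda>_. sobolev_dual m)" "u2 \<in> PiE {0..T} (\<lambda>_. sobolev_dual m)"
      using Linf unfolding Linf_alpha_def by auto
    fix t assume t: "t \<in> {0..T}"
    show "u1 t = u2 t"
    proof (rule extensionalityI[of _ "sobolev m"])
      show "u1 t \<in> extensional (sobolev m)" "u2 t \<in> extensional (sobolev m)"
        using dual[OF t] unfolding sobolev_dual_def by auto
      show "u1 t f = u2 t f" if "f \<in> sobolev m" for f using sob0[OF that t] by (simp add: w_def)
    qed
  qed
qed

theorem theorem1p1:
  fixes \<alpha> d a T :: real and m :: nat
  assumes "0 < \<alpha>" and "\<alpha> < 1" and "d > 0" and "a \<ge> 0" and "T > 0"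
    and "real m > real CARD('n::finite) / 2"
  shows "\<exists>!u :: real \<Rightarrow> (real^'n \<Rightarrow> real) \<Rightarrow> real. distributional_solution \<alpha> d a T m u"
proof -
  obtain u :: "real \<Rightarrow> (real^'n \<Rightarrow> real) \<Rightarrow> real" where u: "distributional_solution \<alpha> d a T m u"
    using solution_exists[OF assms] by blast
  show ?thesis
    by (rule ex1I[of _ u]) (use u solution_unique[OF assms(1,2)] in auto)
qed

end
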